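(* Let $X\sim GH(\lambda,\alpha,\beta,\delta,0)$ with $\beta>0$ and $\gamma=\sqrt{\alpha^2-\beta^2}>0$, and let $M$ denote the mode of $X$. **(i)** For $\delta>0$ and $\lambda\in\mathbb{R}$, $$\frac{\beta}{\gamma^2}\Big[\lambda-\tfrac32+\sqrt{(\lambda-\tfrac32)^2+\delta^2\gamma^2}\Big]< M<\frac{\beta}{\gamma^2}\Big[\lambda-\tfrac12+\sqrt{(\lambda-\tfrac12)^2+\delta^2\gamma^2}\Big].\qquad (A)$$ The lower bound in (A) also holds for $\delta=0$, $\lambda>3/2$, and the upper bound in (A) also holds for $\delta=0$, $\lambda>1/2$. Moreover, for $\delta>0$ and $\lambda>1$, $$M<\frac{\beta}{\gamma^2}\Big[\lambda-1+\sqrt{(\lambda-1)^2+\delta^2\gamma^2}\Big].\qquad (B)$$ For $\delta>0$ there is equality in (B) if $\lambda=1$, and the inequality (B) is reversed (strict $>$) for $\lambda<1$. The upper bound (B) is also valid for $\delta=0$, $\lambda>1$, and there is equality for $\delta=0$, $\lambda=1$ (that is, $M=0$). Also, for $\delta>0$ and $\lambda>2$, $$M>\frac{\beta}{\gamma^2}\bigg[\lambda-1+\sqrt{(\lambda-1)^2+\gamma^2\Big(\delta^2+\frac{3-2\lambda}{\alpha^2}\Big)}\bigg].\qquad (C)$$ For $\delta>0$ there is equality in (C) if $\lambda=2$, and the inequality (C) is reversed (strict $<$) for $\lambda<2$. The lower bound (C) is also valid for $\delta=0$, $\lambda>2$; there is equality for $\delta=0$, $\lambda=2$; and the reversed inequality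 also holds for $\delta=0$, $1<\lambda<2$. **(ii)** The two-sided inequality (A) is tight in the limits $\lambda\to\infty$ and $\delta\to\infty$: when $\lambda\to\infty$ (other parameters fixed), and likewise when $\delta\to\infty$ (other parameters fixed), the ratio of $M$ to each of the two bounds in (A) tends to $1$. Put $\sigma=1/\gamma$ and $\theta=\beta/\gamma^2$ (so that $\gamma=1/\sigma$, $\beta=\theta/\sigma^2$, $\alpha=\sqrt{\theta^2+\sigma^2}/\sigma^2$). For fixed $\theta>0$, $\lambda$ and $\delta$, as $\sigma\to\infty$, $$M\sim \begin{cases} \theta(2\lambda-3), & \lambda>3/2,\ \delta\geq0, \\[2pt] \dfrac{\theta}{\log \sigma}, & \lambda=3/2,\ \delta\geq0, \\[6pt] \dfrac{2^{2\lambda-2}\,\Gamma(\lambda-\frac{1}{2})}{\Gamma(\frac{3}{2}-\lambda)}\,\dfrac{\theta\,\delta^{3-2\lambda}}{\sigma^{3-2\lambda}}, & 1/2<\lambda<3/2,\ \delta>0, \\[8pt] \dfrac{\theta\delta^2}{(1-2\lambda)\sigma^2}, & \lambda<1/2,\ \delta>0. \end{cases}$$ Additionally, if $\delta=0$, then $M=0$ if $0<\lambda\leq1$; and if $\delta=0$ and $\lambda>1$, then for fixed $\theta>0$ and $\lambda$, $$M\sim 2\theta(\lambda-1),\qquad \sigma\downarrow0.$$ Finally, let $b_a(\lambda,\alpha,\beta,\delta)=\frac{\beta}{\gamma^2}\big[\lambda-a+\sqrt{(\lambda-a)^2+\delta^2\gamma^2}\big]$. The lower bound of (A), the upper bound of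 (A) and the upper bound (B), corresponding to $a=3/2$, $a=1/2$ and $a=1$ respectively, are best possible in their ranges of validity amongst all bounds of the form $b_a(\lambda,\alpha,\beta,\delta)$ with a universal constant $a\in\mathbb{R}$ not involving the parameters. That is: for no $a<3/2$ is $b_a$ a lower bound for $M$ for all parameters for which the lower bound of (A) was asserted; for no $a>1/2$ is $b_a$ an upper bound for $M$ for all parameters for which the upper bound of (A) was asserted; and for no $a>1$ is $b_a$ an upper bound for $M$ for all parameters with $\lambda>1$, $\delta\ge 0$.
   Context: For $\nu\in\mathbb{R}$ and $x>0$, $K_\nu(x)=\int_0^\infty \mathrm{e}^{-x\cosh t}\cosh(\nu t)\,\mathrm{d}t$ is the modified Bessel function of the second kind. Generalized hyperbolic distribution: $X\sim GH(\lambda,\alpha,\beta,\delta,0)$ means that $X$ has density, with $\gamma=\sqrt{\alpha^2-\beta^2}$, $$p(x)=\frac{(\gamma/\delta)^\lambda}{\sqrt{2\pi}K_\lambda(\delta\gamma)}\,\mathrm{e}^{\beta x}\,\frac{K_{\lambda-1/2}\big(\alpha\sqrt{\delta^2+x^2}\big)}{\big(\sqrt{\delta^2+x^2}/\alpha\big)^{1/2-\lambda}},\qquad x\in\mathbb{R}.$$ The admissible parameters with $\gamma>0$ are $\alpha>|\beta|$ together with either $\delta\geq0,\ \lambda>0$, or $\delta>0,\ \lambda\le 0$. When $\delta=0$ (so $\lambda>0$) the density is defined as the limit $\delta\downarrow0$, namely $$p(x)=\frac{\gamma^{2\lambda}}{\sqrt{\pi}\,\Gamma(\lambda)}\Big(\frac{|x|}{2\alpha}\Big)^{\lambda-1/2}\mathrm{e}^{\beta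 x}K_{\lambda-1/2}(\alpha|x|),$$ the variance-gamma density. All these distributions are unimodal; the mode $M$ is the unique point at which the density attains its maximum (if the density is unbounded near $0$, the mode is $0$). The notation $f\sim g$ means $f/g\to1$ in the stated limit. *)

theory Defs
  imports "HOL-Analysis.Analysis" "HOL-Library.Landau_Symbols"
begin

unbundle asymp_equiv_syntax

definition bessel_K :: "real \<Rightarrow> real \<Rightarrow> real" where
  "bessel_K \<nu> x = (LBINT t:{0..}. exp (- x * cosh t) * cosh (\<nu> * t))"

definition gh_gamma :: "real \<Rightarrow> real \<Rightarrow> real" where
  "gh_gamma \<alpha> \<beta> = sqrt (\<alpha>\<^sup>2 - \<beta>\<^sup>2)"

text \<open>The first parameter of the generalized hyperbolic distribution, usually called
  lambda, is written \<open>l\<close>. The location parameter is 0.\<close>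

definition gh_admissible :: "real \<Rightarrow> real \<Rightarrow> real \<Rightarrow> real \<Rightarrow> bool" where
  "gh_admissible l \<alpha> \<beta> \<delta> \<longleftrightarrow> \<bar>\<beta>\<bar> < \<alpha> \<and> (0 \<le> \<delta> \<and> 0 < l \<or> 0 < \<delta> \<and> l \<le> 0)"

definition vg_density :: "real \<Rightarrow> real \<Rightarrow> real \<Rightarrow> real \<Rightarrow> real" where
  "vg_density l \<alpha> \<beta> x =
     gh_gamma \<alpha> \<beta> powr (2 * l) / (sqrt pi * Gamma l)
       * (\<bar>x\<bar> / (2 * \<alpha>)) powr (l - 1/2) * exp (\<beta> * x) * bessel_K (l - 1/2) (\<alpha> * \<bar>x\<bar>)"

text \<open>The variance-gamma formula is meaningless at \<open>x = 0\<close>, where the Bessel function is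
  infinite. For \<open>l > 1/2\<close> the density at 0 is given by continuous extension, which is also
  the limit of the densities at 0 as \<open>\<delta>\<close> decreases to 0. For \<open>l \<le> 1/2\<close> the density is
  unbounded near 0 and the value assigned at 0 is irrelevant.\<close>

definition gh_density :: "real \<Rightarrow> real \<Rightarrow> real \<Rightarrow> real \<Rightarrow> real \<Rightarrow> real" where
  "gh_density l \<alpha> \<beta> \<delta> x =
     (if \<delta> = 0 then
        (if x = 0 then Lim (at 0) (vg_density l \<alpha> \<beta>) else vg_density l \<alpha> \<beta> x)
      else
        (gh_gamma \<alpha> \<beta> / \<delta>) powr l / (sqrt (2 * pi) * bessel_K l (\<delta> * gh_gamma \<alpha> \<beta>))
          * exp (\<beta> * x)
          * (bessel_K (l - 1/2) (\<alpha> * sqrt (\<delta>\<^sup>2 + x\<^sup>2))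
               / (sqrt (\<delta>\<^sup>2 + x\<^sup>2) / \<alpha>) powr (1/2 - l)))"

definition density_mode :: "(real \<Rightarrow> real) \<Rightarrow> real" where
  "density_mode p =
     (if \<forall>e>0. \<not> bdd_above (p ` ball 0 e) then 0
      else (THE M. \<forall>x. p x \<le> p M))"

definition gh_mode :: "real \<Rightarrow> real \<Rightarrow> real \<Rightarrow> real \<Rightarrow> real" where
  "gh_mode l \<alpha> \<beta> \<delta> = density_mode (gh_density l \<alpha> \<beta> \<delta>)"

definition gh_bound :: "real \<Rightarrow> real \<Rightarrow> real \<Rightarrow> real \<Rightarrow> real \<Rightarrow> real" where
  "gh_bound a l \<alpha> \<beta> \<delta> =
     \<beta> / (gh_gamma \<alpha> \<beta>)\<^sup>2 * (l - a + sqrt ((l - a)\<^sup>2 + \<delta>\<^sup>2 * (gh_gamma \<alpha> \<beta>)\<^sup>2))"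

definition gh_bound_C :: "real \<Rightarrow> real \<Rightarrow> real \<Rightarrow> real \<Rightarrow> real" where
  "gh_bound_C l \<alpha> \<beta> \<delta> =
     \<beta> / (gh_gamma \<alpha> \<beta>)\<^sup>2 *
       (l - 1 + sqrt ((l - 1)\<^sup>2 + (gh_gamma \<alpha> \<beta>)\<^sup>2 * (\<delta>\<^sup>2 + (3 - 2 * l) / \<alpha>\<^sup>2)))"

text \<open>The mode in the parametrization \<open>\<gamma> = 1 / \<sigma>\<close>, \<open>\<beta> = \<theta> / \<sigma>\<^sup>2\<close>.\<close>

definition gh_mode_scaled :: "real \<Rightarrow> real \<Rightarrow> real \<Rightarrow> real \<Rightarrow> real" where
  "gh_mode_scaled l \<theta> \<delta> \<sigma> = gh_mode l (sqrt (\<theta>\<^sup>2 + \<sigma>\<^sup>2) / \<sigma>\<^sup>2) (\<theta> / \<sigma>\<^sup>2) \<delta>"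

end

theory Submission
  imports Defs "HOL-Real_Asymp.Real_Asymp"
begin

text \<open>
  Put \<open>\<nu> = l - 1/2\<close>, \<open>s = sqrt (\<delta>\<^sup>2 + x\<^sup>2)\<close>, \<open>y = \<alpha> s\<close> and let \<open>R\<^sub>\<nu> = K\<^sub>\<nu>\<^sub>-\<^sub>1 / K\<^sub>\<nu>\<close>. Up to a constant the
  density is \<open>exp (\<beta> x) y\<^sup>\<nu> K\<^sub>\<nu>(y)\<close>, with logarithmic derivative \<open>\<beta> - \<alpha> x R\<^sub>\<nu>(y) / s\<close>, so the mode
  \<open>M\<close> solves \<open>R\<^sub>\<nu>(y) = \<beta> s / (\<alpha> M)\<close>. Inserting this, \<open>M < b\<^sub>a\<close> becomes
  \<open>R\<^sub>\<nu>\<^sup>2 + 2 (l - a) R\<^sub>\<nu> / y - 1 > 0\<close>. For \<open>a = 1/2\<close> and \<open>a = 3/2\<close> the sign of the left-hand side is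
  that of a Turan determinant; for \<open>a = 1\<close> the left-hand side is \<open>R\<^sub>\<nu>'(y)\<close>, by the Riccati equation,
  and (C) compares with the sign of \<open>R'\<close> at order \<open>\<nu> - 1\<close>. The asymptotics follow from the
  fixed point form \<open>M = (\<beta> / \<alpha>\<^sup>2) y / R\<^sub>\<nu>(y)\<close> and the behaviour of \<open>K\<^sub>\<nu>\<close> at the origin.
\<close>

section \<open>Integral representation, recurrence and derivative of the Bessel function\<close>

text \<open>Existence and uniqueness of the maximum have to be proved, because
  \<open>density_mode\<close> rests on a definite description. For \<nu> > 1/2 uniqueness is easy,
  since R is increasing. For \<nu> < 1/2, R is decreasing and the two terms in the derivative of the
  slope have opposite signs. The slope is therefore only shown to decrease at its zeros, which
  already forbids a second zero; this takes a quantitative bound on R', namely that the elasticity y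
  R' / R is at least 1 - R^2. The inequalities between orders are read off the integrand: a
  combination of Bessel functions is positive once the same combination of hyperbolic cosines is. As
  K is even in its order, replacing \<nu> by 1 - \<nu> inverts R, so half of the inequalities follow
  from the other half. For \<delta> = 0 and l \<le> 1 there is no positive critical point: the
  density peaks at 0, possibly with an infinite value, and this case is treated apart.\<close>

lemma LBINT_atLeast_0: "(LBINT t:{0..}. f t) = (LBINT t=0..\<infinity>. f t)" for f :: "real \<Rightarrow> real"
proof -
  have "(LBINT t:{0..}. f t) = (LBINT t:{0<..}. f t)"
    by (rule set_integral_discrete_difference[where X="{0}"]) auto
  also have "\<dots> = (LBINT t=0..\<infinity>. f t)"
    using interval_integral_to_infinity_eq[of lborel 0 f] by (simp add: zero_ereal_def)
  finally show ?thesis .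
qed

lemma set_integrable_exp_decay:
  fixes c :: real
  assumes c: "0 < c"
  shows "set_integrable lborel {0..} (\<lambda>t::real. exp (- (c * t)))"
proof -
  \<comment> \<open>The fundamental theorem gives integrability on an open interval only; starting
    at -1 makes it contain the endpoint 0.\<close>
  have "set_integrable lborel (einterval (ereal (-1)) \<infinity>) (\<lambda>t::real. exp (- (c * t)))"
  proof (rule interval_integral_FTC_nonneg(1)[where F="\<lambda>t. - exp (- (c * t)) / c" and A="- exp c / c" and B=0])
    show "((((\<lambda>t. - exp (- (c * t)) / c) \<circ> real_of_ereal) \<longlongrightarrow> - exp c / c) (at_right (ereal (-1))))"
      unfolding ereal_tendsto_simps
      by (rule tendsto_eq_intros | use c in simp)+
    have "((\<lambda>t::real. exp (- (c * t))) \<longlongrightarrow> 0) at_top"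
      using c by (intro filterlim_compose[OF exp_at_bot] filterlim_compose[OF filterlim_uminus_at_bot_at_top]
        filterlim_tendsto_pos_mult_at_top[OF tendsto_const _ filterlim_ident])
    then have "((\<lambda>t::real. - exp (- (c * t)) / c) \<longlongrightarrow> - 0 / c) at_top"
      using c by (intro tendsto_minus tendsto_divide tendsto_const) auto
    then show "((((\<lambda>t. - exp (- (c * t)) / c) \<circ> real_of_ereal) \<longlongrightarrow> 0) (at_left \<infinity>))"
      unfolding ereal_tendsto_simps by simp
  qed (use c in \<open>auto intro!: derivative_eq_intros continuous_intros\<close>)
  then show ?thesis
    by (rule set_integrable_subset) auto
qed

lemma cosh_ge_quadratic:
  fixes t :: real
  assumes "0 \<le> t"
  shows "t\<^sup>2 / 4 \<le> cosh t"
  using exp_lower_Taylor_quadratic[OF assms] exp_ge_add_one_self[of "-t"] 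
  by (simp add: cosh_def)

text \<open>Completing the square against the quadratic lower bound for cosh absorbs any exponential
  growth; the shift from a to a + 1 is what leaves the integrable factor exp (-t).\<close>

lemma exp_cosh_bound:
  fixes x a t :: real
  assumes "0 < x" "0 \<le> t"
  shows "exp (- x * cosh t) * exp (a * t) \<le> exp ((a+1)\<^sup>2 / x) * exp (-t)"
proof -
  have "x * (t\<^sup>2 / 4) \<le> x * cosh t"
    using cosh_ge_quadratic[OF assms(2)] assms(1) by (intro mult_left_mono) auto
  moreover have "0 \<le> (x * t / 2 - (a+1))\<^sup>2 / x" using assms by simp
  then have "(a+1) * t \<le> x * (t\<^sup>2/4) + (a+1)\<^sup>2 / x"
    using assms by (simp add: field_simps power2_eq_square)
  ultimately have "- x * cosh t + a * t \<le> (a+1)\<^sup>2 / x + (-t)"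
    by (simp add: algebra_simps)
  then show ?thesis
    by (simp flip: exp_add)
qed

lemma cosh_le_exp_abs: "cosh (a * t) \<le> exp (\<bar>a\<bar> * t)" if "0 \<le> t" for a t :: real
proof -
  have "cosh (a*t) = cosh \<bar>a*t\<bar>" by (metis cosh_real_abs)
  also have "\<dots> \<le> exp \<bar>a * t\<bar>" unfolding cosh_def
    by simp
  finally show ?thesis using that by (simp add: abs_mult)
qed

text \<open>The integrands below are exp (-x cosh t) times a factor of at most exponential growth,
  so one dominating function serves them all.\<close>

lemma set_integrable_bessel:
  fixes g :: "real \<Rightarrow> real"
  assumes x: "0 < x" and g: "continuous_on UNIV g" and b: "\<And>t. 0 \<le> t \<Longrightarrow> \<bar>g t\<bar> \<le> C * exp (a * t)"
  shows "set_integrable lborel {0..} (\<lambda>t. exp (- x * cosh t) * g t)"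
proof (rule set_integrable_bound)
  show "set_integrable lborel {0..} (\<lambda>t. C * exp ((a+1)\<^sup>2 / x) * exp (-t))"
    using set_integrable_exp_decay[of 1] by simp
  have [measurable]: "g \<in> borel_measurable borel"
    using g by (rule borel_measurable_continuous_onI)
  have [measurable]: "(\<lambda>t::real. cosh t) \<in> borel_measurable borel"
    by (intro borel_measurable_continuous_onI continuous_intros)
  show "set_borel_measurable lborel {0..} (\<lambda>t. exp (- x * cosh t) * g t)"
    unfolding set_borel_measurable_def by measurable
  have C: "0 \<le> C" using b[of 0] by simp
  have "\<bar>exp (- x * cosh t) * g t\<bar> \<le> \<bar>C * exp ((a+1)\<^sup>2 / x) * exp (-t)\<bar>" if "0 \<le> t" for t
  proof -
    have "\<bar>exp (- x * cosh t) * g t\<bar> \<le> exp (- x * cosh t) * (C * exp (a * t))"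
      using b[OF that] by (simp add: abs_mult)
    also have "\<dots> = C * (exp (- x * cosh t) * exp (a * t))" by simp
    also have "\<dots> \<le> C * (exp ((a+1)\<^sup>2 / x) * exp (-t))"
      using exp_cosh_bound[OF x that] C by (intro mult_left_mono)
    finally show ?thesis using C by simp
  qed
  then show "AE t in lborel. t \<in> {0..} \<longrightarrow> norm (exp (- x * cosh t) * g t) \<le> norm (C * exp ((a+1)\<^sup>2 / x) * exp (-t))"
    by auto
qed

lemma set_integrable_bessel_K:
  fixes x \<nu> :: real
  assumes "0 < x"
  shows "set_integrable lborel {0..} (\<lambda>t. exp (- x * cosh t) * cosh (\<nu> * t))"
  using cosh_le_exp_abs[of _ \<nu>]
  by (intro set_integrable_bessel[where C=1 and a="\<bar>\<nu>\<bar>"] assms) (auto intro!: continuous_intros)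

text \<open>The exceptional point c is for the Chebyshev integrand below, which vanishes where its
  two factors change sign.\<close>

lemma set_integral_pos_except:
  fixes f :: "real \<Rightarrow> real"
  assumes f: "set_integrable lborel {0..} f"
    and pos: "\<And>t. 0 < t \<Longrightarrow> t \<noteq> c \<Longrightarrow> 0 < f t"
  shows "0 < (LBINT t:{0..}. f t)"
proof -
  have i: "integrable lborel (\<lambda>t. indicat_real {0..} t *\<^sub>R f t)"
    using f by (simp add: set_integrable_def)
  have nn': "AE t in lborel. 0 \<le> indicat_real {0..} t *\<^sub>R f t"
    using AE_lborel_singleton[of 0] AE_lborel_singleton[of c]
  proof eventually_elim
    case (elim t)
    show ?case
    proof (cases "0 < t")
      case True
      then have "0 < f t" using elim pos by blast
      then show ?thesis by simp
    next
      case False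
      then show ?thesis using elim by simp
    qed
  qed
  have "0 \<le> (LBINT t:{0..}. f t)"
    unfolding set_lebesgue_integral_def by (intro integral_nonneg_AE nn')
  moreover have "(LBINT t:{0..}. f t) \<noteq> 0"
  proof
    assume "(LBINT t:{0..}. f t) = 0"
    then have "AE t in lborel. indicat_real {0..} t *\<^sub>R f t = 0"
      using integral_nonneg_eq_0_iff_AE[OF i nn'] by (simp add: set_lebesgue_integral_def)
    moreover have "AE t in lborel. t \<noteq> c"
      by (rule AE_lborel_singleton)
    ultimately have "AE t in lborel. t \<notin> {0<..<1::real}"
    proof eventually_elim
      case (elim t)
      then show ?case using pos[of t] by (force simp: indicator_def)
    qed
    then have "emeasure lborel {0<..<1::real} = 0"
      by (subst (asm) AE_iff_measurable[where N="{0<..<1}"]) auto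
    then show False by simp
  qed
  ultimately show ?thesis by simp
qed

lemma bessel_K_pos: "0 < x \<Longrightarrow> 0 < bessel_K \<nu> x"
  unfolding bessel_K_def
  by (rule set_integral_pos_except[where c=0], erule set_integrable_bessel_K) auto

lemma bessel_K_minus: "bessel_K (-\<nu>) x = bessel_K \<nu> x"
  by (simp add: bessel_K_def)

lemma bessel_K_abs: "bessel_K \<bar>\<nu>\<bar> x = bessel_K \<nu> x"
  by (simp add: bessel_K_minus abs_if)

lemma cosh_mult_cosh: "cosh a * cosh b = (cosh (a + b) + cosh (a - b)) / 2" for a b :: real
  by (simp add: cosh_add cosh_diff)

lemma sinh_mult_sinh: "sinh a * sinh b = (cosh (a + b) - cosh (a - b)) / 2" for a b :: real
  by (simp add: cosh_add cosh_diff)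

text \<open>Integration by parts: the integrand is the derivative of
  \<open>exp (- x * cosh t) * sinh (\<nu> * t)\<close>, which vanishes at 0 and at infinity. The
  product of the two sinh factors splits into the orders \<nu> + 1 and \<nu> - 1.\<close>

lemma bessel_K_recurrence:
  assumes x: "0 < x"
  shows "x * (bessel_K (\<nu> + 1) x - bessel_K (\<nu> - 1) x) = 2 * \<nu> * bessel_K \<nu> x"
proof -
  let ?f = "\<lambda>t. \<nu> * (exp (- x * cosh t) * cosh (\<nu> * t)) - x / 2 * (exp (- x * cosh t) * cosh ((\<nu> + 1) * t))
     + x / 2 * (exp (- x * cosh t) * cosh ((\<nu> - 1) * t))"
  have int: "set_integrable lborel {0..} ?f"
    using x by (intro set_integral_add set_integral_diff set_integrable_mult_right set_integrable_bessel_K)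
  have "(LBINT t=0..\<infinity>. ?f t) = 0 - 0"
  proof (rule interval_integral_FTC_integrable[where F="\<lambda>t. exp (- x * cosh t) * sinh (\<nu> * t)"])
    fix t :: real
    show "((\<lambda>t. exp (- x * cosh t) * sinh (\<nu> * t)) has_vector_derivative ?f t) (at t)"
    proof -
      have *: "?f t = \<nu> * (exp (- x * cosh t) * cosh (\<nu> * t)) - x * exp (- x * cosh t) * (sinh (\<nu> * t) * sinh t)"
      proof -
        have 1: "(\<nu> + 1) * t = \<nu> * t + t" "(\<nu> - 1) * t = \<nu> * t - t"
          by (simp_all add: distrib_right left_diff_distrib)
        have gen: "a - x / 2 * (e * A) + x / 2 * (e * B) = a - x * e * ((A - B) / 2)" for a e A B :: real
          by (simp add: field_simps)
        show ?thesis unfolding sinh_mult_sinh 1 by (rule gen)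
      qed
      show ?thesis unfolding * has_real_derivative_iff_has_vector_derivative[symmetric]
        by (auto intro!: derivative_eq_intros)
    qed
    show "isCont ?f t" by (intro continuous_intros)
  next
    show "set_integrable lborel (einterval 0 \<infinity>) ?f"
      by (rule set_integrable_subset[OF int]) (auto simp: einterval_def)
    show "((((\<lambda>t. exp (- x * cosh t) * sinh (\<nu> * t)) \<circ> real_of_ereal) \<longlongrightarrow> 0) (at_right 0))"
      unfolding zero_ereal_def ereal_tendsto_simps
      by (rule tendsto_eq_intros | simp)+
    have "((\<lambda>t::real. exp ((\<bar>\<nu>\<bar>+1)\<^sup>2 / x) * exp (-t)) \<longlongrightarrow> exp ((\<bar>\<nu>\<bar>+1)\<^sup>2 / x) * 0) at_top"
      by (intro tendsto_mult tendsto_const filterlim_compose[OF exp_at_bot] filterlim_uminus_at_bot_at_top)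
    then have lim: "((\<lambda>t::real. exp ((\<bar>\<nu>\<bar>+1)\<^sup>2 / x) * exp (-t)) \<longlongrightarrow> 0) at_top"
      by simp
    have "((\<lambda>t. exp (- x * cosh t) * sinh (\<nu> * t)) \<longlongrightarrow> 0) at_top"
    proof (rule Lim_null_comparison[OF _ lim], rule eventually_at_top_linorderI[of 0])
      fix t :: real assume t: "0 \<le> t"
      have "\<bar>sinh (\<nu> * t)\<bar> \<le> cosh (\<nu> * t)"
        unfolding sinh_def cosh_def by (simp add: abs_le_iff)
      also have "\<dots> \<le> exp (\<bar>\<nu>\<bar> * t)" by (rule cosh_le_exp_abs[OF t])
      finally have "exp (- x * cosh t) * \<bar>sinh (\<nu> * t)\<bar> \<le> exp (- x * cosh t) * exp (\<bar>\<nu>\<bar> * t)"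
        by simp
      also note exp_cosh_bound[OF x t]
      finally show "norm (exp (- x * cosh t) * sinh (\<nu> * t)) \<le> exp ((\<bar>\<nu>\<bar>+1)\<^sup>2 / x) * exp (-t)"
        by (simp add: abs_mult)
    qed
    then show "((((\<lambda>t. exp (- x * cosh t) * sinh (\<nu> * t)) \<circ> real_of_ereal) \<longlongrightarrow> 0) (at_left \<infinity>))"
      unfolding ereal_tendsto_simps .
  qed auto
  then have "0 = (LBINT t:{0..}. ?f t)"
    by (simp add: LBINT_atLeast_0)
  also have "\<dots> = \<nu> * bessel_K \<nu> x - x / 2 * bessel_K (\<nu>+1) x + x / 2 * bessel_K (\<nu>-1) x"
    by (simp only: bessel_K_def set_integral_add(2) set_integral_diff(2) set_integral_mult_right
          set_integral_add(1) set_integral_diff(1) set_integrable_mult_right set_integrable_bessel_K[OF x])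
  finally show ?thesis by (simp add: algebra_simps)
qed

lemma exp_minus_quadratic_bound: "\<bar>exp (-u) - 1 + u\<bar> \<le> u\<^sup>2 * exp \<bar>u\<bar>" for u :: real
  using Taylor_exp_field[of "-u" 1] by (simp add: power2_eq_square mult.commute)

text \<open>Differentiation under the integral sign by a Taylor estimate: the remainder of the
  integrand in h is at most \<open>h\<^sup>2\<close> times a function free of h, with integral
  C.\<close>

lemma bessel_K_has_derivative:
  assumes x: "0 < x"
  shows "(bessel_K \<nu> has_real_derivative - (bessel_K (\<nu> + 1) x + bessel_K (\<nu> - 1) x) / 2) (at x)"
proof -
  define C where "C = (LBINT t:{0..}. exp (- (x/2) * cosh t) * ((cosh t)\<^sup>2 * cosh (\<nu> * t)))"
  have intC: "set_integrable lborel {0..} (\<lambda>t. exp (- (x/2) * cosh t) * ((cosh t)\<^sup>2 * cosh (\<nu> * t)))"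
  proof (rule set_integrable_bessel[where C=1 and a="2 + \<bar>\<nu>\<bar>"])
    fix t :: real assume t: "0 \<le> t"
    have "(cosh t)\<^sup>2 * cosh (\<nu> * t) \<le> (exp t)\<^sup>2 * exp (\<bar>\<nu>\<bar> * t)"
      using cosh_le_exp_abs[OF t, of 1] cosh_le_exp_abs[OF t, of \<nu>]
      by (intro mult_mono power_mono) auto
    then show "\<bar>(cosh t)\<^sup>2 * cosh (\<nu> * t)\<bar> \<le> 1 * exp ((2 + \<bar>\<nu>\<bar>) * t)"
      by (simp add: abs_mult distrib_right exp_add exp_double)
  qed (use x in \<open>auto intro!: continuous_intros\<close>)
  have bound: "\<bar>bessel_K \<nu> (x + h) - bessel_K \<nu> x + h * ((bessel_K (\<nu> + 1) x + bessel_K (\<nu> - 1) x) / 2)\<bar>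
      \<le> h\<^sup>2 * C" if h: "\<bar>h\<bar> \<le> x / 2" for h
  proof -
    let ?e = "\<lambda>\<nu> x t. exp (- x * cosh t) * cosh (\<nu> * t)"
    let ?f = "\<lambda>t. ?e \<nu> (x + h) t - ?e \<nu> x t + h / 2 * (?e (\<nu> + 1) x t + ?e (\<nu> - 1) x t)"
    have xh: "0 < x + h" using h x by auto
    note i = set_integrable_bessel_K[OF x] set_integrable_bessel_K[OF xh]
    have int: "set_integrable lborel {0..} ?f"
      by (intro set_integral_add(1) set_integral_diff(1) set_integrable_mult_right i)
    have pw: "\<bar>?f t\<bar> \<le> h\<^sup>2 * (exp (- (x/2) * cosh t) * ((cosh t)\<^sup>2 * cosh (\<nu> * t)))" for t
    proof -
      \<comment> \<open>The mean of the neighbouring orders reproduces the factor cosh t that comes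
        from differentiating exp (-x cosh t) in x.\<close>
      have c: "cosh ((\<nu> + 1) * t) + cosh ((\<nu> - 1) * t) = 2 * (cosh t * cosh (\<nu> * t))"
        by (simp add: distrib_right left_diff_distrib cosh_add cosh_diff)
      have "?f t = ?e \<nu> (x + h) t - ?e \<nu> x t + h / 2 * exp (- x * cosh t) * (cosh ((\<nu> + 1) * t) + cosh ((\<nu> - 1) * t))"
        by (simp add: algebra_simps)
      also have "\<dots> = exp (- x * cosh t) * cosh (\<nu> * t) * (exp (- (h * cosh t)) - 1 + h * cosh t)"
      proof -
        have "exp (- (x + h) * cosh t) = exp (- x * cosh t) * exp (- (h * cosh t))"
          by (subst exp_add[symmetric]) (simp add: algebra_simps)
        then show ?thesis unfolding c by (simp add: algebra_simps)
      qed
      finally have "\<bar>?f t\<bar> = exp (- x * cosh t) * cosh (\<nu> * t) * \<bar>exp (- (h * cosh t)) - 1 + h * cosh t\<bar>"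
        by (simp add: abs_mult)
      also have "\<dots> \<le> exp (- x * cosh t) * cosh (\<nu> * t) * ((h * cosh t)\<^sup>2 * exp \<bar>h * cosh t\<bar>)"
        by (intro mult_left_mono exp_minus_quadratic_bound) simp
      also have "\<dots> = h\<^sup>2 * (exp (- x * cosh t + \<bar>h\<bar> * cosh t) * ((cosh t)\<^sup>2 * cosh (\<nu> * t)))"
        unfolding exp_add by (simp add: abs_mult power_mult_distrib)
      \<comment> \<open>Half of the decay is given up to absorb exp (|h| cosh t); this is why h is
        restricted to |h| \<le> x/2 and why C is built with x/2.\<close>
      also have "\<dots> \<le> h\<^sup>2 * (exp (- (x/2) * cosh t) * ((cosh t)\<^sup>2 * cosh (\<nu> * t)))"
      proof -
        have "\<bar>h\<bar> * cosh t \<le> x / 2 * cosh t"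
          using h by (intro mult_right_mono) auto
        then have "- x * cosh t + \<bar>h\<bar> * cosh t \<le> - (x/2) * cosh t" by linarith
        then show ?thesis by (intro mult_left_mono mult_right_mono) auto
      qed
      finally show ?thesis .
    qed
    have eq: "bessel_K \<nu> (x + h) - bessel_K \<nu> x + h * ((bessel_K (\<nu> + 1) x + bessel_K (\<nu> - 1) x) / 2)
       = (LBINT t:{0..}. ?f t)"
      by (simp only: bessel_K_def set_integral_add(2) set_integral_diff set_integral_mult_right
          set_integral_add(1) set_integrable_mult_right i)
    have "\<bar>LBINT t:{0..}. ?f t\<bar> \<le> (LBINT t:{0..}. \<bar>?f t\<bar>)"
      using set_integral_norm_bound[OF int] by simp
    also have "\<dots> \<le> (LBINT t:{0..}. h\<^sup>2 * (exp (- (x/2) * cosh t) * ((cosh t)\<^sup>2 * cosh (\<nu> * t))))"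
    proof (rule set_integral_mono)
      show "set_integrable lborel {0..} (\<lambda>t. \<bar>?f t\<bar>)"
        by (rule set_integrable_abs[OF int])
      show "set_integrable lborel {0..} (\<lambda>t. h\<^sup>2 * (exp (- (x/2) * cosh t) * ((cosh t)\<^sup>2 * cosh (\<nu> * t))))"
        by (rule set_integrable_mult_right[OF intC])
      show "\<bar>?f t\<bar> \<le> h\<^sup>2 * (exp (- (x/2) * cosh t) * ((cosh t)\<^sup>2 * cosh (\<nu> * t)))" for t
        by (rule pw)
    qed
    also have "\<dots> = h\<^sup>2 * C" by (simp add: C_def)
    finally show ?thesis unfolding eq .
  qed
  let ?D = "- (bessel_K (\<nu> + 1) x + bessel_K (\<nu> - 1) x) / 2"
  have "((\<lambda>h. (bessel_K \<nu> (x + h) - bessel_K \<nu> x) / h - ?D) \<longlongrightarrow> 0) (at 0)"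
  proof (rule Lim_null_comparison)
    show "((\<lambda>h. \<bar>h\<bar> * C) \<longlongrightarrow> 0) (at 0)"
      by (rule tendsto_eq_intros | simp)+
    have "norm ((bessel_K \<nu> (x + h) - bessel_K \<nu> x) / h - ?D) \<le> \<bar>h\<bar> * C" if "h \<noteq> 0" "\<bar>h\<bar> \<le> x / 2" for h
    proof -
      have "\<bar>h\<bar> * norm ((bessel_K \<nu> (x + h) - bessel_K \<nu> x) / h - ?D)
        = \<bar>bessel_K \<nu> (x + h) - bessel_K \<nu> x + h * ((bessel_K (\<nu> + 1) x + bessel_K (\<nu> - 1) x) / 2)\<bar>"
      proof -
        have "h * ((bessel_K \<nu> (x + h) - bessel_K \<nu> x) / h - ?D)
          = bessel_K \<nu> (x + h) - bessel_K \<nu> x + h * ((bessel_K (\<nu> + 1) x + bessel_K (\<nu> - 1) x) / 2)"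
          using that(1) by (simp add: field_simps)
        then show ?thesis by (simp only: real_norm_def flip: abs_mult)
      qed
      also have "\<dots> \<le> \<bar>h\<bar> * (\<bar>h\<bar> * C)"
        using bound[OF that(2)] by (simp add: power2_eq_square flip: mult.assoc)
      finally show ?thesis using that(1) by simp
    qed
    then show "\<forall>\<^sub>F h in at 0. norm ((bessel_K \<nu> (x + h) - bessel_K \<nu> x) / h - ?D) \<le> \<bar>h\<bar> * C"
      using x unfolding eventually_at by (intro exI[of _ "x/2"]) (auto simp: dist_real_def)
  qed
  then show ?thesis
    unfolding DERIV_def using Lim_null by blast
qed

section \<open>Inequalities between Bessel functions of different orders\<close>

text \<open>Transfers a pointwise inequality between hyperbolic cosines to the Bessel functions.
  Four terms are what the Chebyshev argument uses; the other applications pad with zero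
  coefficients. The point z is where the pointwise inequality may fail to be strict.\<close>

lemma bessel_K_lincomb_pos:
  fixes a b c d p q r s x z :: real
  assumes x: "0 < x"
    and pos: "\<And>t. 0 < t \<Longrightarrow> t \<noteq> z \<Longrightarrow> 0 < a * cosh (p * t) + b * cosh (q * t) + c * cosh (r * t) + d * cosh (s * t)"
  shows "0 < a * bessel_K p x + b * bessel_K q x + c * bessel_K r x + d * bessel_K s x"
proof -
  let ?e = "\<lambda>\<nu> t. exp (- x * cosh t) * cosh (\<nu> * t)"
  let ?f = "\<lambda>t. a * ?e p t + b * ?e q t + c * ?e r t + d * ?e s t"
  note i = set_integrable_bessel_K[OF x]
  have "0 < (LBINT t:{0..}. ?f t)"
  proof (rule set_integral_pos_except[where c=z])
    show "set_integrable lborel {0..} ?f"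
      by (intro set_integral_add(1) set_integrable_mult_right i)
    fix t :: real assume t: "0 < t" "t \<noteq> z"
    have "?f t = exp (- x * cosh t) * (a * cosh (p * t) + b * cosh (q * t) + c * cosh (r * t) + d * cosh (s * t))"
      by (simp add: algebra_simps)
    also have "\<dots> > 0" using pos[OF t] by (intro mult_pos_pos) auto
    finally show "0 < ?f t" .
  qed
  also have "\<dots> = a * bessel_K p x + b * bessel_K q x + c * bessel_K r x + d * bessel_K s x"
    by (simp only: bessel_K_def set_integral_add(2) set_integral_mult_right
          set_integral_add(1) set_integrable_mult_right i)
  finally show ?thesis .
qed

lemma bessel_K_strict_mono_order:
  assumes "0 < x" "\<bar>\<mu>\<bar> < \<bar>\<nu>\<bar>"
  shows "bessel_K \<mu> x < bessel_K \<nu> x"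
proof -
  have "cosh (\<mu> * t) < cosh (\<nu> * t)" if "0 < t" for t
  proof -
    have "cosh \<bar>\<mu> * t\<bar> < cosh \<bar>\<nu> * t\<bar>"
      using assms that by (subst cosh_real_nonneg_less_iff) (auto simp: abs_mult)
    then show ?thesis by simp
  qed
  then have "0 < 1 * bessel_K \<nu> x + (-1) * bessel_K \<mu> x + 0 * bessel_K 0 x + 0 * bessel_K 0 x"
    by (intro bessel_K_lincomb_pos[OF assms(1)]) auto
  then show ?thesis by simp
qed

lemma bessel_K_mono_order:
  assumes "0 < x" "\<bar>\<mu>\<bar> \<le> \<bar>\<nu>\<bar>"
  shows "bessel_K \<mu> x \<le> bessel_K \<nu> x"
  using bessel_K_strict_mono_order[OF assms(1), of \<mu> \<nu>] assms bessel_K_abs[of \<mu> x] bessel_K_abs[of \<nu> x]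
  by (cases "\<bar>\<mu>\<bar> = \<bar>\<nu>\<bar>") auto

text \<open>Cauchy-Schwarz as a quadratic in a: the integrand is half the sum of two weighted
  squares. The chosen a minimizes the integrated quadratic, and the minimum is the Turan determinant
  divided by \<open>bessel_K (\<nu> - 1) x\<close>.\<close>

lemma bessel_K_turan:
  assumes x: "0 < x"
  shows "(bessel_K \<nu> x)\<^sup>2 < bessel_K (\<nu> - 1) x * bessel_K (\<nu> + 1) x"
proof -
  define a where "a = bessel_K \<nu> x / bessel_K (\<nu> - 1) x"
  have "0 < a\<^sup>2 * cosh ((\<nu> - 1) * t) + (- 2 * a) * cosh (\<nu> * t) + 1 * cosh ((\<nu> + 1) * t) + 0 * cosh (0 * t)"
    if t: "0 < t" for t
  proof -
    have e: "exp ((\<nu> - 1) * t) * (exp t)\<^sup>2 = exp ((\<nu> + 1) * t)" "exp ((\<nu> - 1) * t) * exp t = exp (\<nu> * t)"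
       "exp (- ((\<nu> - 1) * t)) * (exp (-t))\<^sup>2 = exp (- ((\<nu> + 1) * t))"
       "exp (- ((\<nu> - 1) * t)) * exp (-t) = exp (- (\<nu> * t))"
      by (simp_all add: algebra_simps flip: exp_add exp_double)
    \<comment> \<open>Both squares vanish only if exp t = exp (-t), which is excluded for t > 0;
      hence strictness.\<close>
    have "0 < exp ((\<nu> - 1) * t) * (a - exp t)\<^sup>2 + exp (- ((\<nu> - 1) * t)) * (a - exp (-t))\<^sup>2"
    proof (cases "a = exp t")
      case True
      then have "a \<noteq> exp (-t)" using t by simp
      then show ?thesis by (intro add_nonneg_pos) auto
    qed (intro add_pos_nonneg, auto)
    also have "\<dots> = a\<^sup>2 * exp ((\<nu> - 1) * t) - 2 * a * exp (\<nu> * t) + exp ((\<nu> + 1) * t)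
      + (a\<^sup>2 * exp (- ((\<nu> - 1) * t)) - 2 * a * exp (- (\<nu> * t)) + exp (- ((\<nu> + 1) * t)))"
      unfolding e[symmetric] by (simp only: power2_diff) (simp only: algebra_simps)
    finally show ?thesis unfolding cosh_def by (simp add: algebra_simps)
  qed
  from bessel_K_lincomb_pos[OF x this]
  have "0 < a\<^sup>2 * bessel_K (\<nu> - 1) x - 2 * a * bessel_K \<nu> x + bessel_K (\<nu> + 1) x"
    by simp
  then show ?thesis
    using bessel_K_pos[OF x, of "\<nu> - 1"] unfolding a_def by (simp add: field_simps power2_eq_square)
qed

text \<open>Monotonicity of the quotient of cosh (\<nu> t) by cosh ((\<nu> - 1) t), with
  denominators cleared. The difference is a sum of products of two sinh values, and 2 \<nu> - 1 > 0
  makes all their arguments positive.\<close>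

lemma cosh_cross_less:
  fixes t u \<nu> :: real
  assumes \<nu>: "1/2 < \<nu>" and u: "0 \<le> u" "u < t"
  shows "cosh (\<nu> * u) * cosh ((\<nu> - 1) * t) < cosh (\<nu> * t) * cosh ((\<nu> - 1) * u)"
proof -
  have c: "cosh a - cosh b = 2 * (sinh ((a + b) / 2) * sinh ((a - b) / 2))" for a b :: real
    unfolding sinh_mult_sinh by (simp add: field_simps)
  have 1: "cosh (\<nu> * t + (\<nu> - 1) * u) - cosh (\<nu> * u + (\<nu> - 1) * t) =
      2 * (sinh ((2 * \<nu> - 1) * (t + u) / 2) * sinh ((t - u) / 2))"
    unfolding c by (simp add: algebra_simps)
  have 2: "cosh (\<nu> * t - (\<nu> - 1) * u) - cosh (\<nu> * u - (\<nu> - 1) * t) =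
      2 * (sinh ((t + u) / 2) * sinh ((2 * \<nu> - 1) * (t - u) / 2))"
    unfolding c by (simp add: algebra_simps)
  have "0 < cosh (\<nu> * t + (\<nu> - 1) * u) - cosh (\<nu> * u + (\<nu> - 1) * t)"
    "0 < cosh (\<nu> * t - (\<nu> - 1) * u) - cosh (\<nu> * u - (\<nu> - 1) * t)"
    unfolding 1 2 using assms by (auto intro!: mult_pos_pos)
  then show ?thesis unfolding cosh_mult_cosh by simp
qed

text \<open>Chebyshev's integral inequality: \<open>cosh (\<nu> t) - \<rho> cosh ((\<nu> - 1) t)\<close> and \<open>cosh t - c\<close> change sign at the
  same point \<open>u\<close>, and \<open>c\<close> is chosen such that \<open>\<rho>\<close> drops out of the integrated product.\<close>

lemma bessel_K_ratio_ineq: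
  assumes x: "0 < x" and \<nu>: "1/2 < \<nu>"
  shows "bessel_K \<nu> x * (bessel_K \<nu> x + bessel_K (\<nu> - 2) x)
    < bessel_K (\<nu> - 1) x * (bessel_K (\<nu> + 1) x + bessel_K (\<nu> - 1) x)"
proof -
  define c where "c = (bessel_K \<nu> x + bessel_K (\<nu> - 2) x) / (2 * bessel_K (\<nu> - 1) x)"
  have K: "0 < bessel_K (\<nu> - 1) x" using x by (rule bessel_K_pos)
  \<comment> \<open>Prepares 1 \<le> c, without which c would not be of the form cosh u: c is the
    mean of cosh t for the weight exp (-x cosh t) cosh ((\<nu> - 1) t).\<close>
  have "0 < 1/2 * cosh (\<nu> * t) + 1/2 * cosh ((\<nu> - 2) * t) + (-1) * cosh ((\<nu> - 1) * t) + 0 * cosh (0 * t)"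
    if "0 < t" for t
  proof -
    have "cosh (\<nu> * t) + cosh ((\<nu> - 2) * t) = 2 * (cosh ((\<nu> - 1) * t) * cosh t)"
      unfolding cosh_mult_cosh by (simp add: algebra_simps)
    moreover have "cosh ((\<nu> - 1) * t) * 1 < cosh ((\<nu> - 1) * t) * cosh t"
      using that cosh_real_nonneg_less_iff[of 0 t] by (intro mult_strict_left_mono) auto
    ultimately show ?thesis by linarith
  qed
  from bessel_K_lincomb_pos[OF x this] have "1 \<le> c"
    using K unfolding c_def by (simp add: field_simps)
  define u where "u = arcosh c"
  have u: "cosh u = c" "0 \<le> u" using \<open>1 \<le> c\<close> unfolding u_def by auto
  define \<rho> where "\<rho> = cosh (\<nu> * u) / cosh ((\<nu> - 1) * u)"
  have "0 < 1/2 * cosh ((\<nu> + 1) * t) + (1/2 + \<rho> * c) * cosh ((\<nu> - 1) * t) + (- (\<rho> / 2 + c)) * cosh (\<nu> * t)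
     + (- \<rho> / 2) * cosh ((\<nu> - 2) * t)" if t: "0 < t" "t \<noteq> u" for t
  proof -
    have "0 < (cosh (\<nu> * t) - \<rho> * cosh ((\<nu> - 1) * t)) * (cosh t - cosh u)"
    proof (cases "u < t")
      case True
      then show ?thesis
        using cosh_cross_less[OF \<nu> u(2) True] u t cosh_real_nonneg_less_iff[of u t] unfolding \<rho>_def
        by (intro mult_pos_pos) (auto simp: field_simps)
    next
      case False
      then have "t < u" using t by simp
      then show ?thesis
        using cosh_cross_less[OF \<nu> less_imp_le[OF t(1)] \<open>t < u\<close>] u t cosh_real_nonneg_less_iff[of t u] unfolding \<rho>_def
        by (intro mult_neg_neg) (auto simp: field_simps)
    qed
    also have "\<dots> = cosh (\<nu> * t) * cosh t - \<rho> * (cosh ((\<nu> - 1) * t) * cosh t) - c * cosh (\<nu> * t) + \<rho> * c * cosh ((\<nu> - 1) * t)"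
      unfolding u by (simp add: algebra_simps)
    also have "cosh (\<nu> * t) * cosh t = (cosh ((\<nu> + 1) * t) + cosh ((\<nu> - 1) * t)) / 2"
      unfolding cosh_mult_cosh by (simp add: algebra_simps)
    also have "cosh ((\<nu> - 1) * t) * cosh t = (cosh (\<nu> * t) + cosh ((\<nu> - 2) * t)) / 2"
      unfolding cosh_mult_cosh by (simp add: algebra_simps)
    finally show ?thesis by (simp add: field_simps)
  qed
  from bessel_K_lincomb_pos[OF x this]
  have "0 < 1/2 * (bessel_K (\<nu> + 1) x + bessel_K (\<nu> - 1) x) - \<rho> * (1/2 * (bessel_K \<nu> x + bessel_K (\<nu> - 2) x) - c * bessel_K (\<nu> - 1) x)
     - c * bessel_K \<nu> x" by (simp add: algebra_simps)
  moreover have "1/2 * (bessel_K \<nu> x + bessel_K (\<nu> - 2) x) - c * bessel_K (\<nu> - 1) x = 0"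
    using K unfolding c_def by (simp add: field_simps)
  ultimately have "c * bessel_K \<nu> x < 1/2 * (bessel_K (\<nu> + 1) x + bessel_K (\<nu> - 1) x)" by simp
  then show ?thesis using K unfolding c_def by (simp add: field_simps)
qed

section \<open>The ratio of neighbouring orders: recurrence, reflection, Riccati equation\<close>

lemma bessel_K_plus_1:
  "0 < x \<Longrightarrow> bessel_K (\<nu> + 1) x = bessel_K (\<nu> - 1) x + 2 * \<nu> * bessel_K \<nu> x / x"
  using bessel_K_recurrence[of x \<nu>] by (simp add: field_simps)

lemma bessel_K_minus_2:
  "0 < x \<Longrightarrow> bessel_K (\<nu> - 2) x = bessel_K \<nu> x - 2 * (\<nu> - 1) * bessel_K (\<nu> - 1) x / x"
  using bessel_K_plus_1[of x "\<nu> - 1"] by simp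

definition bessel_R :: "real \<Rightarrow> real \<Rightarrow> real" where
  "bessel_R \<nu> y = bessel_K (\<nu> - 1) y / bessel_K \<nu> y"

lemma bessel_R_pos: "0 < y \<Longrightarrow> 0 < bessel_R \<nu> y"
  unfolding bessel_R_def by (simp add: bessel_K_pos)

lemma bessel_R_recurrence:
  assumes "0 < y"
  shows "bessel_R (\<nu> + 1) y = 1 / (bessel_R \<nu> y + 2 * \<nu> / y)"
proof -
  have "bessel_R \<nu> y + 2 * \<nu> / y = bessel_K (\<nu> + 1) y / bessel_K \<nu> y"
    using bessel_K_pos[OF assms, of \<nu>] assms
    unfolding bessel_R_def bessel_K_plus_1[OF assms] by (simp add: field_simps)
  then show ?thesis by (simp add: bessel_R_def)
qed

text \<open>Evenness of K in its order. It transfers results from \<nu> > 1/2 to \<nu> < 1/2 and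
  turns the upper Turan inequality into the lower one.\<close>

lemma bessel_R_reflect: "bessel_R (1 - \<nu>) y = 1 / bessel_R \<nu> y"
  using bessel_K_minus[of \<nu> y] bessel_K_minus[of "\<nu> - 1" y] unfolding bessel_R_def by simp

text \<open>The quotient rule brings in the orders \<nu> + 1 and \<nu> - 2; the recurrence reduces
  them to \<nu> and \<nu> - 1, and a Riccati equation results.\<close>

lemma bessel_R_has_derivative:
  assumes y: "0 < y"
  shows "(bessel_R \<nu> has_real_derivative (bessel_R \<nu> y)\<^sup>2 + (2 * \<nu> - 1) * bessel_R \<nu> y / y - 1) (at y)"
proof -
  have K: "0 < bessel_K \<nu> y" using y by (rule bessel_K_pos)
  note 1 = bessel_K_plus_1[OF y, of \<nu>]
  note 2 = bessel_K_minus_2[OF y, of \<nu>]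
  have "(bessel_R \<nu> has_real_derivative
    ((- (bessel_K \<nu> y + bessel_K (\<nu> - 2) y) / 2) * bessel_K \<nu> y -
      bessel_K (\<nu> - 1) y * (- (bessel_K (\<nu> + 1) y + bessel_K (\<nu> - 1) y) / 2)) / (bessel_K \<nu> y * bessel_K \<nu> y)) (at y)"
    unfolding bessel_R_def
    using bessel_K_has_derivative[OF y, of "\<nu> - 1"] bessel_K_has_derivative[OF y, of \<nu>] K
    by (intro DERIV_divide) auto
  moreover have "((- (bessel_K \<nu> y + bessel_K (\<nu> - 2) y) / 2) * bessel_K \<nu> y -
      bessel_K (\<nu> - 1) y * (- (bessel_K (\<nu> + 1) y + bessel_K (\<nu> - 1) y) / 2)) / (bessel_K \<nu> y * bessel_K \<nu> y)
    = (bessel_R \<nu> y)\<^sup>2 + (2 * \<nu> - 1) * bessel_R \<nu> y / y - 1"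
    unfolding 1 2 bessel_R_def using K y by (simp add: field_simps power2_eq_square)
  ultimately show ?thesis by simp
qed

lemma bessel_R_turan_upper:
  assumes y: "0 < y"
  shows "0 < (bessel_R \<nu> y)\<^sup>2 + 2 * \<nu> * bessel_R \<nu> y / y - 1"
proof -
  have K: "0 < bessel_K \<nu> y" using y by (rule bessel_K_pos)
  note 1 = bessel_K_plus_1[OF y, of \<nu>]
  have "(bessel_R \<nu> y)\<^sup>2 + 2 * \<nu> * bessel_R \<nu> y / y - 1 =
    (bessel_K (\<nu> - 1) y * bessel_K (\<nu> + 1) y - (bessel_K \<nu> y)\<^sup>2) / (bessel_K \<nu> y)\<^sup>2"
    unfolding 1 bessel_R_def using K y by (simp add: field_simps power2_eq_square)
  then show ?thesis using bessel_K_turan[OF y, of \<nu>] K by simp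
qed

text \<open>The upper inequality at order 1 - \<nu>, where the ratio is the reciprocal, multiplied
  by the square of the ratio.\<close>

lemma bessel_R_turan_lower:
  assumes y: "0 < y"
  shows "(bessel_R \<nu> y)\<^sup>2 + 2 * (\<nu> - 1) * bessel_R \<nu> y / y - 1 < 0"
proof -
  have R: "0 < bessel_R \<nu> y" using y by (rule bessel_R_pos)
  have "0 < (1 / bessel_R \<nu> y)\<^sup>2 + 2 * (1 - \<nu>) * (1 / bessel_R \<nu> y) / y - 1"
    using bessel_R_turan_upper[OF y, of "1 - \<nu>"] unfolding bessel_R_reflect .
  then have "0 < (bessel_R \<nu> y)\<^sup>2 * ((1 / bessel_R \<nu> y)\<^sup>2 + 2 * (1 - \<nu>) * (1 / bessel_R \<nu> y) / y - 1)"
    using R by simp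
  also have "\<dots> = 1 + 2 * (1 - \<nu>) * bessel_R \<nu> y / y - (bessel_R \<nu> y)\<^sup>2"
    using R y by (simp add: field_simps power2_eq_square)
  finally show ?thesis by (simp add: algebra_simps diff_divide_distrib)
qed

text \<open>Up to the factor \<open>2 * (bessel_K \<nu> y)\<^sup>2\<close> this derivative of R is
  the gap in the Chebyshev inequality, so R is strictly increasing for \<nu> > 1/2.\<close>

lemma bessel_R_riccati_pos:
  assumes y: "0 < y" and \<nu>: "1/2 < \<nu>"
  shows "0 < (bessel_R \<nu> y)\<^sup>2 + (2 * \<nu> - 1) * bessel_R \<nu> y / y - 1"
proof -
  have K: "0 < bessel_K \<nu> y" using y by (rule bessel_K_pos)
  note 1 = bessel_K_plus_1[OF y, of \<nu>]
  note 2 = bessel_K_minus_2[OF y, of \<nu>]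
  have "(bessel_R \<nu> y)\<^sup>2 + (2 * \<nu> - 1) * bessel_R \<nu> y / y - 1 =
    (bessel_K (\<nu> - 1) y * (bessel_K (\<nu> + 1) y + bessel_K (\<nu> - 1) y)
      - bessel_K \<nu> y * (bessel_K \<nu> y + bessel_K (\<nu> - 2) y)) / (2 * (bessel_K \<nu> y)\<^sup>2)"
    unfolding 1 2 bessel_R_def using K y by (simp add: field_simps power2_eq_square)
  then show ?thesis using bessel_K_ratio_ineq[OF y \<nu>] K by simp
qed

lemma bessel_R_half: "0 < y \<Longrightarrow> bessel_R (1/2) y = 1"
  using bessel_K_minus[of "1/2" y] bessel_K_pos[of y "1/2"] unfolding bessel_R_def by simp

lemma bessel_R_riccati_neg:
  assumes y: "0 < y" and \<nu>: "\<nu> < 1/2"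
  shows "(bessel_R \<nu> y)\<^sup>2 + (2 * \<nu> - 1) * bessel_R \<nu> y / y - 1 < 0"
proof -
  have R: "0 < bessel_R \<nu> y" using y by (rule bessel_R_pos)
  have "0 < (1 / bessel_R \<nu> y)\<^sup>2 + (2 * (1 - \<nu>) - 1) * (1 / bessel_R \<nu> y) / y - 1"
    using bessel_R_riccati_pos[OF y, of "1 - \<nu>"] \<nu> unfolding bessel_R_reflect by simp
  then have "0 < (bessel_R \<nu> y)\<^sup>2 * ((1 / bessel_R \<nu> y)\<^sup>2 + (2 * (1 - \<nu>) - 1) * (1 / bessel_R \<nu> y) / y - 1)"
    using R by simp
  also have "\<dots> = 1 + (1 - 2 * \<nu>) * bessel_R \<nu> y / y - (bessel_R \<nu> y)\<^sup>2"
    using R y by (simp add: field_simps power2_eq_square)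
  finally show ?thesis by (simp add: algebra_simps diff_divide_distrib)
qed

lemma bessel_R_riccati_half:
  assumes y: "0 < y"
  shows "(bessel_R (1/2) y)\<^sup>2 + (2 * (1/2) - 1) * bessel_R (1/2) y / y - 1 = 0"
  using bessel_R_half[OF y] by simp

section \<open>Behaviour at the origin and the elasticity of the Bessel ratio\<close>

text \<open>Dominated convergence needs the gamma integral as a Lebesgue integral over
  \<open>lborel\<close>; nonnegativity of the integrand gives the passage from the gauge
  integral.\<close>

lemma Gamma_lborel:
  fixes \<nu> :: real
  assumes "0 < \<nu>"
  shows "integrable lborel (\<lambda>u. indicator {0<..} u * (u powr (\<nu> - 1) * exp (-u)))"
    and "(LBINT u. indicator {0<..} u * (u powr (\<nu> - 1) * exp (-u))) = Gamma \<nu>"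
proof -
  let ?f = "\<lambda>u::real. u powr (\<nu> - 1) * exp (-u)"
  have hi: "(?f has_integral Gamma \<nu>) {0<..}"
    using Gamma_integral_real[OF assms]
    by (subst has_integral_spike_set_eq[where T="{0..}"])
       (auto simp: exp_minus divide_inverse intro!: negligible_subset[OF negligible_sing[of 0]])
  then have "?f absolutely_integrable_on {0<..}"
    by (intro nonnegative_absolutely_integrable_1) auto
  then have "integrable lebesgue (\<lambda>u. indicator {0<..} u *\<^sub>R ?f u)"
    by (simp add: set_integrable_def)
  then have i: "set_integrable lborel {0<..} ?f"
    unfolding set_integrable_def by (subst (asm) integrable_completion) measurable
  then show "integrable lborel (\<lambda>u. indicator {0<..} u * (u powr (\<nu> - 1) * exp (-u)))"
    by (simp add: set_integrable_def)
  show "(LBINT u. indicator {0<..} u * (u powr (\<nu> - 1) * exp (-u))) = Gamma \<nu>"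
    using set_borel_integral_eq_integral(2)[OF i] integral_unique[OF hi]
    by (simp add: set_lebesgue_integral_def)
qed

text \<open>With u = (y/2) exp t the exponent y cosh t becomes
  \<open>u + y\<^sup>2 / (4 * u)\<close>. As y tends to 0 both this perturbation and the lower limit
  y/2 disappear, and a gamma integral remains.\<close>

lemma bessel_integral_substitution:
  fixes \<nu> y :: real
  assumes y: "0 < y"
  shows "(LBINT t:{0..}. exp (- y * cosh t) * exp (\<nu> * t))
    = (2 / y) powr \<nu> * (LBINT u. indicator {y/2<..} u * (u powr (\<nu> - 1) * exp (- u - y\<^sup>2 / (4 * u))))"
proof -
  let ?g = "\<lambda>t. y / 2 * exp t"
  let ?f = "\<lambda>u. u powr (\<nu> - 1) * exp (- u - y\<^sup>2 / (4 * u))"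
  have eq: "?f (?g t) * ?g t = (y / 2) powr \<nu> * (exp (- y * cosh t) * exp (\<nu> * t))" for t
  proof -
    have "?g t powr (\<nu> - 1) * ?g t = ?g t powr \<nu>"
      using y by (simp add: powr_diff)
    also have "\<dots> = (y / 2) powr \<nu> * exp (\<nu> * t)"
      using y by (subst powr_mult) (auto simp: powr_def[of "exp t"])
    finally have 1: "?g t powr (\<nu> - 1) * ?g t = (y / 2) powr \<nu> * exp (\<nu> * t)" .
    have 2: "- ?g t - y\<^sup>2 / (4 * ?g t) = - y * cosh t"
      using y by (simp add: cosh_def field_simps exp_minus power2_eq_square)
    have "?f (?g t) * ?g t = (?g t powr (\<nu> - 1) * ?g t) * exp (- ?g t - y\<^sup>2 / (4 * ?g t))" by simp
    also have "\<dots> = (y / 2) powr \<nu> * (exp (- y * cosh t) * exp (\<nu> * t))"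
      unfolding 1 2 by simp
    finally show ?thesis .
  qed
  have int: "set_integrable lborel {0..} (\<lambda>t. exp (- y * cosh t) * exp (\<nu> * t))"
    by (rule set_integrable_bessel[OF y, where C=1 and a=\<nu>]) (auto intro!: continuous_intros)
  have "(LBINT u=ereal (y/2)..\<infinity>. ?f u) = (LBINT t=0..\<infinity>. ?f (?g t) * ?g t)"
  proof (rule interval_integral_substitution_nonneg(2))
    have "(?g \<longlongrightarrow> y / 2 * exp 0) (at_right 0)"
      by (intro tendsto_intros)
    then show "((ereal \<circ> ?g \<circ> real_of_ereal) \<longlongrightarrow> ereal (y/2)) (at_right 0)"
      unfolding zero_ereal_def ereal_tendsto_simps by simp
    have "filterlim ?g at_top at_top"
      using y by (intro filterlim_tendsto_pos_mult_at_top[OF tendsto_const] exp_at_top) auto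
    then show "((ereal \<circ> ?g \<circ> real_of_ereal) \<longlongrightarrow> \<infinity>) (at_left \<infinity>)"
      unfolding ereal_tendsto_simps by (simp add: comp_def tendsto_PInfty_eq_at_top)
    have "set_integrable lborel (einterval 0 \<infinity>) (\<lambda>t. exp (- y * cosh t) * exp (\<nu> * t))"
      by (rule set_integrable_subset[OF int]) (auto simp: einterval_def)
    then show "set_integrable lborel (einterval 0 \<infinity>) (\<lambda>t. ?f (?g t) * ?g t)"
      unfolding eq by (rule set_integrable_mult_right)
  next
    fix t assume "(0::ereal) < ereal t" "ereal t < \<infinity>"
    show "isCont ?f (?g t)"
      using y by (intro continuous_intros) auto
  qed (use y in \<open>auto intro!: derivative_eq_intros continuous_intros\<close>)
  also have "\<dots> = (y / 2) powr \<nu> * (LBINT t:{0..}. exp (- y * cosh t) * exp (\<nu> * t))"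
    unfolding eq LBINT_atLeast_0 by simp
  also have "(LBINT u=ereal (y/2)..\<infinity>. ?f u) = (LBINT u. indicator {y/2<..} u * ?f u)"
    unfolding interval_integral_to_infinity_eq by (simp add: set_lebesgue_integral_def)
  finally show ?thesis using y by (simp add: powr_divide field_simps)
qed

lemma tendsto_powr_at_right_0:
  fixes a :: real
  assumes "0 < a"
  shows "((\<lambda>y. y powr a) \<longlongrightarrow> 0) (at_right 0)"
proof -
  have "((\<lambda>y. y powr a) \<longlongrightarrow> 0 powr a) (at_right (0::real))"
    using assms by (intro tendsto_powr' tendsto_ident_at tendsto_const)
      (auto simp: eventually_at_right_less intro: eventually_mono[OF eventually_at_right_less])
  then show ?thesis by simp
qed

text \<open>The cosh is split into its two exponentials. The growing half I carries the gamma
  integral; the decaying half F is bounded by the integral of exp (-\<nu> t), so the factor y^\<nu>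
  kills it.\<close>

lemma bessel_K_asymp_0:
  assumes \<nu>: "0 < \<nu>"
  shows "((\<lambda>y. y powr \<nu> * bessel_K \<nu> y) \<longlongrightarrow> 2 powr (\<nu> - 1) * Gamma \<nu>) (at_right 0)"
proof -
  define I where "I y = (LBINT u. indicator {y/2<..} u * (u powr (\<nu> - 1) * exp (- u - y\<^sup>2 / (4 * u))))" for y :: real
  define F where "F y = (LBINT t:{0..}. exp (- y * cosh t) * exp (- (\<nu> * t)))" for y :: real
  \<comment> \<open>Dominated convergence is applied along \<open>at_top\<close>, hence the
    reciprocal argument.\<close>
  have "((\<lambda>x. I (inverse x)) \<longlongrightarrow> Gamma \<nu>) at_top"
    unfolding I_def Gamma_lborel(2)[OF \<nu>, symmetric]
  proof (rule integral_dominated_convergence_at_top[OF _ _ Gamma_lborel(1)[OF \<nu>]])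
    show "\<forall>\<^sub>F x in at_top. AE u in lborel. norm (indicator {inverse x/2<..} u *
      (u powr (\<nu> - 1) * exp (- u - (inverse x)\<^sup>2 / (4 * u)))) \<le> indicator {0<..} u * (u powr (\<nu> - 1) * exp (- u))"
      using eventually_gt_at_top[of "0::real"]
    proof eventually_elim
      case (elim x)
      have "norm (indicator {inverse x/2<..} u * (u powr (\<nu> - 1) * exp (- u - (inverse x)\<^sup>2 / (4 * u))))
        \<le> indicator {0<..} u * (u powr (\<nu> - 1) * exp (- u))" for u
      proof (cases "inverse x / 2 < u")
        case True
        moreover have "0 < inverse x / 2" using elim by simp
        ultimately have u: "0 < u" by linarith
        show ?thesis using True u by (simp add: mult_left_mono)
      qed (simp add: indicator_def)
      then show ?case by simp
    qed
    show "AE u in lborel. ((\<lambda>x. indicator {inverse x/2<..} u * (u powr (\<nu> - 1) * exp (- u - (inverse x)\<^sup>2 / (4 * u))))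
      \<longlongrightarrow> indicator {0<..} u * (u powr (\<nu> - 1) * exp (- u))) at_top"
    proof (rule AE_I2)
      fix u :: real
      show "((\<lambda>x. indicator {inverse x/2<..} u * (u powr (\<nu> - 1) * exp (- u - (inverse x)\<^sup>2 / (4 * u))))
      \<longlongrightarrow> indicator {0<..} u * (u powr (\<nu> - 1) * exp (- u))) at_top"
      proof (cases "0 < u")
        case True
        have inv: "((\<lambda>x::real. inverse x) \<longlongrightarrow> 0) at_top" by (rule tendsto_inverse_0_at_top[OF filterlim_ident])
        have L: "((\<lambda>x. u powr (\<nu> - 1) * exp (- u - (inverse x)\<^sup>2 / (4 * u))) \<longlongrightarrow> u powr (\<nu> - 1) * exp (- u - 0\<^sup>2 / (4 * u))) at_top"
          using True by (intro tendsto_intros inv) auto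
        have "\<forall>\<^sub>F x::real in at_top. inverse x / 2 < u"
          using order_tendstoD(2)[OF inv, of "2 * u"] True by (auto elim: eventually_mono)
        then have "\<forall>\<^sub>F x in at_top. u powr (\<nu> - 1) * exp (- u - (inverse x)\<^sup>2 / (4 * u))
           = indicator {inverse x/2<..} u * (u powr (\<nu> - 1) * exp (- u - (inverse x)\<^sup>2 / (4 * u)))"
          by eventually_elim simp
        from Lim_transform_eventually[OF L this] show ?thesis using True by simp
      next
        case False
        have "\<forall>\<^sub>F x::real in at_top. 0 = indicator {inverse x/2<..} u * (u powr (\<nu> - 1) * exp (- u - (inverse x)\<^sup>2 / (4 * u)))"
          using eventually_gt_at_top[of "0::real"]
        proof eventually_elim
          case (elim x)
          then have "0 < inverse x / 2" by simp
          then have "\<not> inverse x / 2 < u" using False by linarith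
          then show ?case by simp
        qed
        then show ?thesis using False by (auto intro: Lim_transform_eventually[OF tendsto_const])
      qed
    qed
  qed measurable
  then have I: "(I \<longlongrightarrow> Gamma \<nu>) (at_right 0)"
    by (simp add: filterlim_at_right_to_top)
  have intF: "set_integrable lborel {0..} (\<lambda>t. exp (- y * cosh t) * exp (- (\<nu> * t)))" if "0 < y" for y :: real
    by (rule set_integrable_bessel[OF that, where C=1 and a="-\<nu>"]) (auto intro!: continuous_intros)
  have intE: "set_integrable lborel {0..} (\<lambda>t. exp (- y * cosh t) * exp (\<nu> * t))" if "0 < y" for y :: real
    by (rule set_integrable_bessel[OF that, where C=1 and a="\<nu>"]) (auto intro!: continuous_intros)
  have F: "0 \<le> F y" "F y \<le> (LBINT t:{0..}. exp (- (\<nu> * t)))" if "0 < y" for y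
  proof -
    show "0 \<le> F y" unfolding F_def set_lebesgue_integral_def by (intro integral_nonneg_AE) auto
    have "exp (- y * cosh t) * exp (- (\<nu> * t)) \<le> exp (- (\<nu> * t))" for t
      using that by (intro mult_left_le_one_le) auto
    then show "F y \<le> (LBINT t:{0..}. exp (- (\<nu> * t)))"
      unfolding F_def by (intro set_integral_mono intF[OF that] set_integrable_exp_decay \<nu>)
  qed
  have K: "y powr \<nu> * bessel_K \<nu> y = 2 powr (\<nu> - 1) * I y + y powr \<nu> * (F y / 2)" if y: "0 < y" for y
  proof -
    have "bessel_K \<nu> y = (LBINT t:{0..}. 1/2 * (exp (- y * cosh t) * exp (\<nu> * t)) + 1/2 * (exp (- y * cosh t) * exp (- (\<nu> * t))))"
      unfolding bessel_K_def cosh_def[of "_ * _"]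
      by (intro set_lebesgue_integral_cong) (auto simp: algebra_simps)
    also have "\<dots> = 1/2 * (LBINT t:{0..}. exp (- y * cosh t) * exp (\<nu> * t)) + 1/2 * F y"
      by (simp only: set_integral_add(2) set_integral_mult_right F_def
          set_integrable_mult_right intE[OF y] intF[OF y])
    also have "(LBINT t:{0..}. exp (- y * cosh t) * exp (\<nu> * t)) = (2 / y) powr \<nu> * I y"
      unfolding I_def by (rule bessel_integral_substitution[OF y])
    finally have "bessel_K \<nu> y = 1/2 * ((2 / y) powr \<nu> * I y) + 1/2 * F y" .
    moreover have "y powr \<nu> * (1/2 * ((2 / y) powr \<nu> * I y)) = 2 powr (\<nu> - 1) * I y"
      using y by (simp add: powr_divide powr_diff)
    ultimately show ?thesis by (simp add: algebra_simps)
  qed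
  have "((\<lambda>y. y powr \<nu> * (F y / 2)) \<longlongrightarrow> 0) (at_right 0)"
  proof (rule Lim_null_comparison)
    show "((\<lambda>y. y powr \<nu> * (LBINT t:{0..}. exp (- (\<nu> * t)))) \<longlongrightarrow> 0) (at_right 0)"
      by (intro tendsto_mult_left_zero tendsto_powr_at_right_0 \<nu>)
    show "\<forall>\<^sub>F y in at_right 0. norm (y powr \<nu> * (F y / 2)) \<le> y powr \<nu> * (LBINT t:{0..}. exp (- (\<nu> * t)))"
      using eventually_at_right_less[of 0]
    proof eventually_elim
      case (elim y)
      have "\<bar>F y / 2\<bar> \<le> (LBINT t:{0..}. exp (- (\<nu> * t)))"
        using F[OF elim] by simp
      then have "y powr \<nu> * \<bar>F y / 2\<bar> \<le> y powr \<nu> * (LBINT t:{0..}. exp (- (\<nu> * t)))"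
        by (intro mult_left_mono) auto
      then show ?case by (simp add: abs_mult)
    qed
  qed
  then have "((\<lambda>y. 2 powr (\<nu> - 1) * I y + y powr \<nu> * (F y / 2)) \<longlongrightarrow> 2 powr (\<nu> - 1) * Gamma \<nu> + 0) (at_right 0)"
    by (intro tendsto_add tendsto_mult tendsto_const I)
  then have "((\<lambda>y. 2 powr (\<nu> - 1) * I y + y powr \<nu> * (F y / 2)) \<longlongrightarrow> 2 powr (\<nu> - 1) * Gamma \<nu>) (at_right 0)"
    by simp
  moreover have "\<forall>\<^sub>F y in at_right 0. 2 powr (\<nu> - 1) * I y + y powr \<nu> * (F y / 2) = y powr \<nu> * bessel_K \<nu> y"
    using eventually_at_right_less[of 0] by eventually_elim (simp add: K)
  ultimately show ?thesis by (rule Lim_transform_eventually)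
qed

text \<open>Covers \<mu> = 0 as well, where K grows logarithmically: the order is raised to the
  midpoint \<kappa> of |\<mu>| and a, which is positive and leaves a positive power of y
  over.\<close>

lemma bessel_K_powr_null_0:
  assumes "\<bar>\<mu>\<bar> < a"
  shows "((\<lambda>y. y powr a * bessel_K \<mu> y) \<longlongrightarrow> 0) (at_right 0)"
proof (rule Lim_null_comparison)
  define \<kappa> where "\<kappa> = (\<bar>\<mu>\<bar> + a) / 2"
  have \<kappa>: "0 < \<kappa>" "\<bar>\<mu>\<bar> \<le> \<bar>\<kappa>\<bar>" "0 < a - \<kappa>" using assms unfolding \<kappa>_def by auto
  from tendsto_mult[OF tendsto_powr_at_right_0[OF \<kappa>(3)] bessel_K_asymp_0[OF \<kappa>(1)]]
  show "((\<lambda>y. y powr (a - \<kappa>) * (y powr \<kappa> * bessel_K \<kappa> y)) \<longlongrightarrow> 0) (at_right 0)"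
    by simp
  show "\<forall>\<^sub>F y in at_right 0. norm (y powr a * bessel_K \<mu> y) \<le> y powr (a - \<kappa>) * (y powr \<kappa> * bessel_K \<kappa> y)"
    using eventually_at_right_less[of 0]
  proof eventually_elim
    case (elim y)
    have "y powr a * bessel_K \<mu> y \<le> y powr a * bessel_K \<kappa> y"
      using bessel_K_mono_order[OF elim \<kappa>(2)] by (intro mult_left_mono) auto
    then show ?case using bessel_K_pos[OF elim, of \<mu>] by (simp add: abs_mult flip: mult.assoc powr_add)
  qed
qed

text \<open>The second hypothesis reads \<nu> > 1/2 for b = 0 and \<nu> > 0 for b = 1, the two cases
  drawn from it below.\<close>

lemma bessel_R_powr_null_0:
  assumes "0 < \<nu>" "\<bar>\<nu> - 1\<bar> < \<nu> + b"
  shows "((\<lambda>y. y powr b * bessel_R \<nu> y) \<longlongrightarrow> 0) (at_right 0)"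
proof -
  have "((\<lambda>y. y powr (\<nu> + b) * bessel_K (\<nu> - 1) y / (y powr \<nu> * bessel_K \<nu> y)) \<longlongrightarrow> 0 / (2 powr (\<nu> - 1) * Gamma \<nu>)) (at_right 0)"
    using Gamma_real_pos[OF assms(1)]
    by (intro tendsto_divide bessel_K_powr_null_0 bessel_K_asymp_0 assms) auto
  then have "((\<lambda>y. y powr (\<nu> + b) * bessel_K (\<nu> - 1) y / (y powr \<nu> * bessel_K \<nu> y)) \<longlongrightarrow> 0) (at_right 0)"
    by simp
  moreover have "\<forall>\<^sub>F y in at_right 0. y powr (\<nu> + b) * bessel_K (\<nu> - 1) y / (y powr \<nu> * bessel_K \<nu> y) = y powr b * bessel_R \<nu> y"
    using eventually_at_right_less[of 0] by eventually_elim (simp add: powr_add bessel_R_def)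
  ultimately show ?thesis by (rule Lim_transform_eventually)
qed

lemma bessel_R_null_0:
  assumes "1/2 < \<nu>"
  shows "(bessel_R \<nu> \<longlongrightarrow> 0) (at_right 0)"
proof -
  have "((\<lambda>y. y powr 0 * bessel_R \<nu> y) \<longlongrightarrow> 0) (at_right 0)"
    using assms by (intro bessel_R_powr_null_0) auto
  moreover have "\<forall>\<^sub>F y in at_right 0. y powr 0 * bessel_R \<nu> y = bessel_R \<nu> y"
    using eventually_at_right_less[of 0] by eventually_elim simp
  ultimately show ?thesis by (rule Lim_transform_eventually)
qed

lemma bessel_R_mult_null_0:
  assumes "0 < \<nu>"
  shows "((\<lambda>y. y * bessel_R \<nu> y) \<longlongrightarrow> 0) (at_right 0)"
proof -
  have "((\<lambda>y. y powr 1 * bessel_R \<nu> y) \<longlongrightarrow> 0) (at_right 0)"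
    using assms by (intro bessel_R_powr_null_0) auto
  moreover have "\<forall>\<^sub>F y in at_right 0. y powr 1 * bessel_R \<nu> y = y * bessel_R \<nu> y"
    using eventually_at_right_less[of 0] by eventually_elim simp
  ultimately show ?thesis by (rule Lim_transform_eventually)
qed

text \<open>L'Hopital's rule against -ln y: the derivative of \<open>bessel_K 0\<close> is minus
  \<open>bessel_K 1\<close>, and y times \<open>bessel_K 1 y\<close> tends to 1.\<close>

lemma bessel_K_0_asymp_0: "((\<lambda>y. bessel_K 0 y / (- ln y)) \<longlongrightarrow> 1) (at_right 0)"
proof (rule lhopital_right_at_top)
  show "LIM y at_right 0. - ln (y::real) :> at_top"
    using ln_at_0 unfolding filterlim_uminus_at_bot .
  show "\<forall>\<^sub>F y in at_right 0. - inverse y \<noteq> (0::real)"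
    using eventually_at_right_less[of 0] by eventually_elim simp
  show "\<forall>\<^sub>F y in at_right 0. DERIV (bessel_K 0) y :> - bessel_K 1 y"
    using eventually_at_right_less[of 0]
  proof eventually_elim
    case (elim y)
    show ?case using bessel_K_has_derivative[OF elim, of 0] bessel_K_minus[of 1 y] by simp
  qed
  show "\<forall>\<^sub>F y::real in at_right 0. DERIV (\<lambda>y. - ln y) y :> - inverse y"
    by (rule eventually_mono[OF eventually_at_right_less])
       (auto intro!: derivative_eq_intros simp: divide_inverse)
  have "\<forall>\<^sub>F y in at_right 0. y powr 1 * bessel_K 1 y = - bessel_K 1 y / - inverse y"
    using eventually_at_right_less[of 0] by eventually_elim (simp add: divide_inverse)
  then show "((\<lambda>y. - bessel_K 1 y / - inverse y) \<longlongrightarrow> 1) (at_right 0)"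
    using bessel_K_asymp_0[of 1] by (auto intro: Lim_transform_eventually)
qed

lemma bessel_K_0_at_top: "LIM y at_right 0. bessel_K 0 y :> at_top"
proof -
  have ln: "LIM y at_right 0. - ln (y::real) :> at_top"
    using ln_at_0 unfolding filterlim_uminus_at_bot .
  have "LIM y at_right 0. bessel_K 0 y / (- ln y) * (- ln y) :> at_top"
    by (rule filterlim_tendsto_pos_mult_at_top[OF bessel_K_0_asymp_0 _ ln]) simp
  moreover have ev: "\<forall>\<^sub>F y in at_right 0. bessel_K 0 y / (- ln y) * (- ln y) = bessel_K 0 (y::real)"
    using eventually_at_right_less[of 0] order_tendstoD(2)[OF tendsto_ident_at[of 0 "{0<..}"] zero_less_one]
    by eventually_elim simp
  ultimately show ?thesis using filterlim_cong[OF refl refl ev] by simp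
qed

text \<open>A function that decreases at each of its zeros can cross zero only downwards: at a first
  return to 0 its values just to the left would have to be positive. It serves the auxiliary
  function G of the elasticity inequality and the slope of the log-density.\<close>

lemma neg_after_decreasing_zeros:
  fixes f f' :: "real \<Rightarrow> real"
  assumes deriv: "\<And>z. a \<le> z \<Longrightarrow> (f has_real_derivative f' z) (at z)"
    and dec: "\<And>z. a \<le> z \<Longrightarrow> f z = 0 \<Longrightarrow> f' z < 0"
    and a: "f a \<le> 0" and x: "a < x"
  shows "f x < 0"
proof (rule ccontr)
  assume "\<not> f x < 0"
  obtain b where b: "a \<le> b" "b < x" "f b < 0"
  proof (cases "f a = 0")
    case True
    then obtain d where "0 < d" "\<And>h. 0 < h \<Longrightarrow> h < d \<Longrightarrow> f (a + h) < f a"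
      using DERIV_neg_dec_right[OF deriv dec] by blast
    note d = this
    define h where "h = min (d/2) ((x - a)/2)"
    have "0 < h" "h < d" "a + h < x"
      using x d(1) by (auto simp: h_def min_def field_simps)
    moreover from this have "f (a + h) < f a" by (intro d(2))
    ultimately
    show ?thesis using that[of "a + h"] True by simp
  next
    case False
    then show ?thesis using that[of a] a x by auto
  qed
  define S where "S = {z \<in> {b..x}. 0 \<le> f z}"
  have cont: "continuous_on {b..x} f"
    by (intro continuous_at_imp_continuous_on ballI) (meson DERIV_isCont atLeastAtMost_iff b(1) deriv order_trans)
  have "S = {b..x} \<inter> f -` {0..}" unfolding S_def by auto
  then have "closed S"
    using continuous_closed_preimage[OF cont closed_atLeastAtMost closed_atLeast] by simp
  moreover have "S \<noteq> {}" "bdd_below S" using \<open>\<not> f x < 0\<close> b unfolding S_def by auto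
  ultimately have zS: "Inf S \<in> S" by (intro closed_contains_Inf)
  define z where "z = Inf S"
  have z: "b < z" "z \<le> x" "0 \<le> f z" using zS b unfolding S_def z_def by (auto simp: less_le)
  have before: "f w < 0" if "b \<le> w" "w < z" for w
    using cInf_lower[OF _ \<open>bdd_below S\<close>, of w] that z unfolding z_def S_def by force
  have "f z = 0"
  proof (rule ccontr)
    assume "f z \<noteq> 0"
    then obtain w where "b \<le> w" "w \<le> z" "f w = 0"
      using IVT'[of f b 0 z] z b continuous_on_subset[OF cont, of "{b..z}"] by auto
    then show False using before[of w] \<open>f z \<noteq> 0\<close> by (cases "w = z") auto
  qed
  moreover have "a \<le> z" using z b by simp
  ultimately obtain d where "0 < d" "\<And>h. 0 < h \<Longrightarrow> h < d \<Longrightarrow> f z < f (z - h)"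
    using DERIV_neg_dec_left[OF deriv dec] by blast
  note d = this
  define h where "h = min (d/2) (z - b)"
  have h: "0 < h" "h < d" "b \<le> z - h" "z - h < z" using z d(1) by (auto simp: h_def min_def)
  show False using before[OF h(3,4)] d(2)[OF h(1,2)] \<open>f z = 0\<close> by simp
qed

lemma bessel_R_ge_1:
  assumes "0 < y" "\<nu> < 1/2"
  shows "1 \<le> bessel_R \<nu> y"
  using bessel_K_mono_order[OF assms(1), of \<nu> "\<nu> - 1"] assms bessel_K_pos[OF assms(1), of \<nu>]
  unfolding bessel_R_def by auto

text \<open>The difference \<open>G\<close> of the two sides decreases at its zeros, so it stays negative once it is; then
  \<open>R\<close> would decrease so fast that it falls below 1. The inequality makes the slope of the log-density
  decrease at its zeros also when \<open>R\<close> is decreasing.\<close>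

lemma bessel_R_elasticity:
  assumes y: "0 < y" and \<nu>: "\<nu> < 1/2"
  shows "(1 - 2 * \<nu>) * bessel_R \<nu> y \<le> ((bessel_R \<nu> y)\<^sup>2 - 1) * (y + bessel_R \<nu> y)"
proof (rule ccontr)
  define R where "R = bessel_R \<nu>"
  define m where "m = 1 - 2 * \<nu>"
  define R' where "R' z = (R z)\<^sup>2 - m * R z / z - 1" for z
  define G where "G z = ((R z)\<^sup>2 - 1) * (z + R z) - m * R z" for z
  define G' where "G' z = 2 * R z * R' z * (z + R z) + ((R z)\<^sup>2 - 1) * (1 + R' z) - m * R' z" for z
  have m: "0 < m" using \<nu> by (simp add: m_def)
  have R1: "1 \<le> R z" if "0 < z" for z using bessel_R_ge_1[OF that \<nu>] by (simp add: R_def)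
  have dR: "(R has_real_derivative R' z) (at z)" if "0 < z" for z
  proof -
    have "R' z = (bessel_R \<nu> z)\<^sup>2 + (2 * \<nu> - 1) * bessel_R \<nu> z / z - 1"
      unfolding R'_def R_def m_def using that by (simp add: field_simps)
    then show ?thesis using bessel_R_has_derivative[OF that, of \<nu>] by (simp add: R_def)
  qed
  have dG: "(G has_real_derivative G' z) (at z)" if "0 < z" for z
    unfolding G_def G'_def using dR[OF that]
    by (auto intro!: derivative_eq_intros simp: algebra_simps)
  have neg: "G' z < 0" if z: "0 < z" and G0: "G z = 0" for z
  proof -
    have E: "m * R z = ((R z)\<^sup>2 - 1) * (z + R z)" using G0 by (simp add: G_def)
    have pos: "0 < (R z)\<^sup>2 - 1"
    proof (rule zero_less_mult_pos2)
      show "0 < ((R z)\<^sup>2 - 1) * (z + R z)" unfolding E[symmetric] using m R1[OF z] by simp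
      show "0 < z + R z" using z R1[OF z] by simp
    qed
    \<comment> \<open>At a zero of G, \<open>E\<close> eliminates m from the Riccati equation. All
      terms of G' then share the factor \<open>((R z)\<^sup>2 - 1) / z\<close>, and a second use of
      \<open>E\<close> leaves a negative cofactor.\<close>
    have R'z: "R' z = - ((R z)\<^sup>2 - 1) * R z / z"
      unfolding R'_def E using z by (simp add: field_simps)
    have "G' z = ((R z)\<^sup>2 - 1) / z * (z - R z * (2 * R z * (z + R z) + (R z)\<^sup>2 - 1) + m * R z)"
      unfolding G'_def R'z using z by (simp add: field_simps)
    also have "\<dots> = ((R z)\<^sup>2 - 1) / z * (- (R z)\<^sup>2 * (z + 2 * R z))"
      unfolding E by (simp add: algebra_simps power2_eq_square)
    also have "\<dots> < 0"
    proof -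
      have "0 < (R z)\<^sup>2 * (z + 2 * R z)" using z R1[OF z] by (intro mult_pos_pos) auto
      then have "0 < ((R z)\<^sup>2 - 1) / z * ((R z)\<^sup>2 * (z + 2 * R z))"
        using pos z mult_pos_pos divide_pos_pos by blast
      then show ?thesis by (simp only: mult_minus_left mult_minus_right neg_less_0_iff_less)
    qed
    finally show ?thesis .
  qed
  assume "\<not> ?thesis"
  then have "G y < 0" by (simp add: G_def R_def m_def)
  then have Gneg: "G z < 0" if "y \<le> z" for z
    using neg_after_decreasing_zeros[of y G G' z] dG neg y that by (cases "z = y") auto
  \<comment> \<open>A negative G forces the derivative of R below that of m / (z + 1), so H does not
    increase. But R \<ge> 1 keeps H above 1 - m / (z + 1), which tends to 1. Hence H y \<ge>
    1.\<close>
  define H where "H z = R z - m / (z + 1)" for z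
  have dec: "H z \<le> H y" if "y \<le> z" for z
  proof (rule DERIV_nonpos_imp_nonincreasing[OF that])
    fix w assume w: "y \<le> w" "w \<le> z"
    then have w0: "0 < w" using y by simp
    have "R' w \<le> - m / (w + 1)\<^sup>2"
    proof -
      have "((R w)\<^sup>2 - 1) * (w + R w) < m * R w" using Gneg[OF w(1)] by (simp add: G_def)
      then have "(R w)\<^sup>2 - 1 < m * R w / (w + R w)"
        using w0 R1[OF w0] by (simp add: field_simps)
      then have "R' w < m * R w / (w + R w) - m * R w / w" by (simp add: R'_def)
      also have "\<dots> = - m * ((R w)\<^sup>2 / (w * (w + R w)))"
        using w0 R1[OF w0] by (simp add: divide_simps) (simp add: algebra_simps power2_eq_square)
      also have "\<dots> \<le> - m * (1 / (w + 1)\<^sup>2)"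
      proof -
        have "1 / (w + 1)\<^sup>2 \<le> (R w)\<^sup>2 / (w * (w + R w))"
        proof -
          have 1: "1 \<le> (R w)\<^sup>2" using R1[OF w0] by (rule one_le_power)
          have "R w \<le> (R w)\<^sup>2" using R1[OF w0] by (simp add: power2_eq_square)
          then have "w * R w \<le> w * (R w)\<^sup>2" "0 \<le> w * (R w)\<^sup>2" "1 * w\<^sup>2 \<le> (R w)\<^sup>2 * w\<^sup>2"
            using w0 mult_right_mono[OF 1, of "w\<^sup>2"] by simp_all
          moreover have "w * (w + R w) = w\<^sup>2 + w * R w"
            "(R w)\<^sup>2 * (w + 1)\<^sup>2 = (R w)\<^sup>2 * w\<^sup>2 + 2 * (w * (R w)\<^sup>2) + (R w)\<^sup>2"
            by (simp_all add: power2_eq_square algebra_simps)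
          ultimately have "w * (w + R w) \<le> (R w)\<^sup>2 * (w + 1)\<^sup>2" using 1 by linarith
          then show ?thesis using w0 R1[OF w0] by (simp add: divide_simps)
        qed
        then show ?thesis using m by (intro mult_left_mono_neg) auto
      qed
      finally show ?thesis by simp
    qed
    then have "R' w + m / (w + 1)\<^sup>2 \<le> 0" by simp
    moreover have "(H has_real_derivative R' w + m / (w + 1)\<^sup>2) (at w)"
      unfolding H_def using dR[OF w0] w0
      by (auto intro!: derivative_eq_intros simp: power2_eq_square)
    ultimately show "\<exists>d. (H has_real_derivative d) (at w) \<and> d \<le> 0" by blast
  qed
  have "((\<lambda>z. 1 - m / (z + 1)) \<longlongrightarrow> 1 - 0) at_top"
    by (intro tendsto_diff tendsto_const real_tendsto_divide_at_top[OF tendsto_const]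
        filterlim_at_top_add_at_top filterlim_ident filterlim_at_top_mono[OF filterlim_ident] always_eventually) auto
  moreover have "\<forall>\<^sub>F z in at_top. 1 - m / (z + 1) \<le> H y"
    using eventually_ge_at_top[of y]
  proof eventually_elim
    case (elim z)
    then have "1 - m / (z + 1) \<le> H z" using R1[of z] y by (simp add: H_def)
    then show ?case using dec[OF elim] by simp
  qed
  ultimately have "1 \<le> H y"
    using tendsto_upperbound[of "\<lambda>z. 1 - m / (z + 1)" "1 - 0" at_top "H y"] by simp
  then have "m / (y + 1) \<le> R y - 1" by (simp add: H_def)
  \<comment> \<open>Multiplying by (R + 1)(y + R) recreates the left part of G; the contradiction
    closes because (R + 1)(y + R) exceeds R (y + 1) by R^2 + y.\<close>
  then have "m / (y + 1) * ((R y + 1) * (y + R y)) \<le> (R y - 1) * ((R y + 1) * (y + R y))"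
    using R1[OF y] y by (intro mult_right_mono) auto
  also have "\<dots> = ((R y)\<^sup>2 - 1) * (y + R y)"
    by (simp add: power2_eq_square algebra_simps)
  also have "\<dots> < m * R y" using \<open>G y < 0\<close> by (simp add: G_def)
  also have "\<dots> \<le> m / (y + 1) * ((R y + 1) * (y + R y))"
  proof -
    have "R y * (y + 1) \<le> (R y + 1) * (y + R y)"
      using R1[OF y] y by (simp add: algebra_simps)
    then have "m / (y + 1) * (R y * (y + 1)) \<le> m / (y + 1) * ((R y + 1) * (y + R y))"
      using m y by (intro mult_left_mono) auto
    then show ?thesis using y by simp
  qed
  finally show False by simp
qed

section \<open>The critical point equation\<close>

definition gh_slope :: "real \<Rightarrow> real \<Rightarrow> real \<Rightarrow> real \<Rightarrow> real \<Rightarrow> real" where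
  "gh_slope \<nu> \<alpha> \<beta> \<delta> x = \<beta> - \<alpha> * (x * bessel_R \<nu> (\<alpha> * sqrt (\<delta>\<^sup>2 + x\<^sup>2)) / sqrt (\<delta>\<^sup>2 + x\<^sup>2))"

text \<open>Dividing the quadratic by r gives r + c - 1/r, which increases strictly on r > 0
  whatever the sign of c; the statement is this monotonicity with denominators cleared.\<close>

lemma pos_quadratic_compare:
  fixes R r c :: real
  assumes "0 < R" "0 < r"
  shows "r < R \<longleftrightarrow> R * (r\<^sup>2 + c * r - 1) < r * (R\<^sup>2 + c * R - 1)"
proof -
  have "r * (R\<^sup>2 + c * R - 1) - R * (r\<^sup>2 + c * r - 1) = (R - r) * (R * r + 1)"
    by (simp add: algebra_simps power2_eq_square)
  moreover have "0 < R * r + 1" using assms by (simp add: add_pos_pos)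
  then have "0 < (R - r) * (R * r + 1) \<longleftrightarrow> r < R"
    by (simp add: zero_less_mult_iff)
  ultimately show ?thesis by linarith
qed

lemma pos_mult_diff_iff:
  fixes k q r :: real
  assumes "0 < k"
  shows "k * (q - r) < 0 \<longleftrightarrow> q < r" "0 < k * (q - r) \<longleftrightarrow> r < q" "k * (q - r) = 0 \<longleftrightarrow> r = q"
  using assms by (auto simp: zero_less_mult_iff mult_less_0_iff)

lemma filterlim_mult_at_right_0:
  fixes a :: real
  assumes "0 < a"
  shows "filterlim (\<lambda>x. a * x) (at_right 0) (at_right 0)"
proof (rule filterlim_at_withinI)
  have "((\<lambda>x. a * x) \<longlongrightarrow> a * 0) (at_right 0)"
    by (intro tendsto_intros)
  then show "((\<lambda>x. a * x) \<longlongrightarrow> 0) (at_right 0)" by simp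
  show "\<forall>\<^sub>F x in at_right 0. a * x \<in> {0<..} - {0}"
    using eventually_at_right_less[of 0] by eventually_elim (use assms in simp)
qed

text \<open>With R' written by the Riccati equation for c = 2 \<nu>, the hypothesis
  \<open>el\<close> says that y R' is at least R - R^3. The conclusion's expression is then at least
  R times \<open>S\<^sup>2 - (x * R)\<^sup>2\<close>, which is positive by
  \<open>less\<close>.\<close>

lemma elasticity_slope_pos:
  fixes R S c d x y :: real
  assumes x: "0 < x" and R: "0 < R" and y: "0 < y"
    and el: "(1 - c) * R \<le> (R\<^sup>2 - 1) * (y + R)" and S: "S\<^sup>2 = d\<^sup>2 + x\<^sup>2" and less: "x * R < S"
  shows "0 < R * d\<^sup>2 + x\<^sup>2 * y * (R\<^sup>2 + (c - 1) * R / y - 1)"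
proof -
  have "(x * R)\<^sup>2 < S\<^sup>2"
    using x R less by (intro power_strict_mono) auto
  then have "0 < R * (S\<^sup>2 - (x * R)\<^sup>2)" using R by simp
  also have "\<dots> = R * d\<^sup>2 + x\<^sup>2 * (R - R^3)"
    unfolding S by (simp add: algebra_simps power2_eq_square power3_eq_cube)
  also have "\<dots> \<le> R * d\<^sup>2 + x\<^sup>2 * (y * R\<^sup>2 + (c - 1) * R - y)"
  proof -
    have "R - R^3 \<le> y * R\<^sup>2 + (c - 1) * R - y"
      using el by (simp add: algebra_simps power2_eq_square power3_eq_cube)
    then show ?thesis by (intro add_left_mono mult_left_mono) auto
  qed
  also have "y * R\<^sup>2 + (c - 1) * R - y = y * (R\<^sup>2 + (c - 1) * R / y - 1)"
    using y by (simp add: field_simps)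
  finally show ?thesis by (simp add: mult.assoc)
qed

locale gh_parameters =
  fixes \<nu> \<alpha> \<beta> \<delta> :: real
  assumes \<beta>: "0 < \<beta>" "\<beta> < \<alpha>" and \<delta>: "0 \<le> \<delta>"
begin

abbreviation "s x \<equiv> sqrt (\<delta>\<^sup>2 + x\<^sup>2)"
abbreviation "D \<equiv> gh_slope \<nu> \<alpha> \<beta> \<delta>"
abbreviation "R x \<equiv> bessel_R \<nu> (\<alpha> * s x)"

lemma \<alpha>: "0 < \<alpha>" using \<beta> by simp

lemma s_pos: "0 < \<delta> \<or> x \<noteq> 0 \<Longrightarrow> 0 < s x"
  using \<delta> by (auto simp: add_pos_nonneg add_nonneg_pos)

lemma R_pos: "0 < \<delta> \<or> x \<noteq> 0 \<Longrightarrow> 0 < R x"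
  using s_pos[of x] \<alpha> by (intro bessel_R_pos) simp

lemma gamma_sq: "(gh_gamma \<alpha> \<beta>)\<^sup>2 = \<alpha>\<^sup>2 - \<beta>\<^sup>2" "0 < gh_gamma \<alpha> \<beta>"
proof -
  have "\<beta>\<^sup>2 < \<alpha>\<^sup>2" using \<beta> by (intro power_strict_mono) auto
  then show "(gh_gamma \<alpha> \<beta>)\<^sup>2 = \<alpha>\<^sup>2 - \<beta>\<^sup>2" "0 < gh_gamma \<alpha> \<beta>" by (auto simp: gh_gamma_def)
qed

text \<open>The slope is a positive multiple of the threshold minus R; the threshold is the value
  that R takes at a critical point.\<close>

lemma slope_neg_iff:
  assumes x: "0 < x"
  shows "D x < 0 \<longleftrightarrow> \<beta> * s x / (\<alpha> * x) < R x" and "0 < D x \<longleftrightarrow> R x < \<beta> * s x / (\<alpha> * x)"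
  and "D x = 0 \<longleftrightarrow> R x = \<beta> * s x / (\<alpha> * x)"
proof -
  have s: "0 < s x" using x s_pos by simp
  have D: "D x = \<alpha> * x / s x * (\<beta> * s x / (\<alpha> * x) - R x)"
    using s x \<alpha> unfolding gh_slope_def by (simp add: field_simps)
  have k: "0 < \<alpha> * x / s x" using x \<alpha> s by simp
  show "D x < 0 \<longleftrightarrow> \<beta> * s x / (\<alpha> * x) < R x" "0 < D x \<longleftrightarrow> R x < \<beta> * s x / (\<alpha> * x)"
    "D x = 0 \<longleftrightarrow> R x = \<beta> * s x / (\<alpha> * x)"
    unfolding D by (rule pos_mult_diff_iff[OF k])+
qed

text \<open>Inserting the threshold for R removes the Bessel function. What remains is a polynomial
  in x whose larger root is \<open>gh_bound a\<close> when c = l - a.\<close>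

lemma quadratic_at_slope:
  assumes x: "0 < x"
  shows "(\<beta> * s x / (\<alpha> * x))\<^sup>2 + 2 * c / (\<alpha> * s x) * (\<beta> * s x / (\<alpha> * x)) - 1
    = - ((gh_gamma \<alpha> \<beta>)\<^sup>2 * x\<^sup>2 - 2 * c * \<beta> * x - \<delta>\<^sup>2 * \<beta>\<^sup>2) / (\<alpha>\<^sup>2 * x\<^sup>2)"
proof -
  have s: "0 < s x" using x s_pos by simp
  have ss: "(s x)\<^sup>2 = \<delta>\<^sup>2 + x\<^sup>2" by simp
  have 1: "(\<beta> * s x / (\<alpha> * x))\<^sup>2 = \<beta>\<^sup>2 * (\<delta>\<^sup>2 + x\<^sup>2) / (\<alpha>\<^sup>2 * x\<^sup>2)"
    unfolding power_divide power_mult_distrib ss ..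
  have 2: "2 * c / (\<alpha> * s x) * (\<beta> * s x / (\<alpha> * x)) = 2 * c * \<beta> * x / (\<alpha>\<^sup>2 * x\<^sup>2)"
  proof -
    have "2 * c / (\<alpha> * S) * (\<beta> * S / (\<alpha> * x)) = 2 * c * \<beta> * x / (\<alpha>\<^sup>2 * x\<^sup>2)" if "0 < S" for S
      using that x \<alpha> by (simp add: field_simps power2_eq_square)
    then show ?thesis using s by blast
  qed
  have 3: "(\<alpha>\<^sup>2 * x\<^sup>2) / (\<alpha>\<^sup>2 * x\<^sup>2) = 1" using x \<alpha> by simp
  have "(\<beta> * s x / (\<alpha> * x))\<^sup>2 + 2 * c / (\<alpha> * s x) * (\<beta> * s x / (\<alpha> * x)) - 1
    = \<beta>\<^sup>2 * (\<delta>\<^sup>2 + x\<^sup>2) / (\<alpha>\<^sup>2 * x\<^sup>2) + 2 * c * \<beta> * x / (\<alpha>\<^sup>2 * x\<^sup>2) - (\<alpha>\<^sup>2 * x\<^sup>2) / (\<alpha>\<^sup>2 * x\<^sup>2)"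
    unfolding 1 2 3 ..
  also have "\<dots> = - ((gh_gamma \<alpha> \<beta>)\<^sup>2 * x\<^sup>2 - 2 * c * \<beta> * x - \<delta>\<^sup>2 * \<beta>\<^sup>2) / (\<alpha>\<^sup>2 * x\<^sup>2)"
    unfolding gamma_sq by (simp add: algebra_simps diff_divide_distrib add_divide_distrib)
  finally show ?thesis .
qed

text \<open>From the upper Turan inequality: right of the larger root of the polynomial with c =
  \<nu>, the quadratic is nonpositive at the threshold but positive at R, so R exceeds the
  threshold.\<close>

lemma slope_neg_large:
  assumes x: "0 < x" and q: "0 \<le> (gh_gamma \<alpha> \<beta>)\<^sup>2 * x\<^sup>2 - 2 * \<nu> * \<beta> * x - \<delta>\<^sup>2 * \<beta>\<^sup>2"
  shows "D x < 0"
proof -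
  have s: "0 < s x" using x s_pos by simp
  have R: "0 < R x" using R_pos x by simp
  have r: "0 < \<beta> * s x / (\<alpha> * x)" using \<alpha> \<beta> s x by simp
  have "0 < (R x)\<^sup>2 + 2 * \<nu> / (\<alpha> * s x) * R x - 1"
    using bessel_R_turan_upper[of "\<alpha> * s x" \<nu>] \<alpha> s by simp
  moreover have "(\<beta> * s x / (\<alpha> * x))\<^sup>2 + 2 * \<nu> / (\<alpha> * s x) * (\<beta> * s x / (\<alpha> * x)) - 1 \<le> 0"
    unfolding quadratic_at_slope[OF x] using q by (simp add: divide_nonpos_nonneg)
  ultimately have "R x * ((\<beta> * s x / (\<alpha> * x))\<^sup>2 + 2 * \<nu> / (\<alpha> * s x) * (\<beta> * s x / (\<alpha> * x)) - 1)
     < (\<beta> * s x / (\<alpha> * x)) * ((R x)\<^sup>2 + 2 * \<nu> / (\<alpha> * s x) * R x - 1)"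
    by (intro le_less_trans[OF mult_nonneg_nonpos[OF less_imp_le[OF R]] mult_pos_pos[OF r]])
  then show ?thesis unfolding slope_neg_iff(1)[OF x] pos_quadratic_compare[OF R r, of "2 * \<nu> / (\<alpha> * s x)"] .
qed

lemma s_has_derivative:
  assumes "0 < \<delta> \<or> x \<noteq> 0"
  shows "(s has_real_derivative x / s x) (at x)"
proof -
  have s2: "0 < \<delta>\<^sup>2 + x\<^sup>2" using s_pos[OF assms] by simp
  have "((\<lambda>x. \<delta>\<^sup>2 + x\<^sup>2) has_real_derivative 2 * x) (at x)"
    by (auto intro!: derivative_eq_intros)
  from DERIV_chain2[where f=sqrt and g="\<lambda>x. \<delta>\<^sup>2 + x\<^sup>2", OF DERIV_real_sqrt[OF s2] this]
  show ?thesis by (simp add: inverse_eq_divide)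
qed

lemma slope_derivative:
  assumes "0 < \<delta> \<or> x \<noteq> 0"
  shows "(D has_real_derivative - \<alpha> / (s x)^3 * (R x * \<delta>\<^sup>2 + x\<^sup>2 * (\<alpha> * s x) * ((R x)\<^sup>2 + (2 * \<nu> - 1) * R x / (\<alpha> * s x) - 1))) (at x)"
proof -
  let ?R' = "(R x)\<^sup>2 + (2 * \<nu> - 1) * R x / (\<alpha> * s x) - 1"
  have s: "0 < s x" using assms by (rule s_pos)
  note ds = s_has_derivative[OF assms]
  have y: "0 < \<alpha> * s x" using s \<alpha> by simp
  have "((\<lambda>x. \<alpha> * s x) has_real_derivative \<alpha> * (x / s x)) (at x)"
    using ds by (rule DERIV_cmult)
  from DERIV_chain2[where f="bessel_R \<nu>" and g="\<lambda>x. \<alpha> * s x", OF bessel_R_has_derivative[OF y] this]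
  have dR: "(R has_real_derivative ?R' * (\<alpha> * (x / s x))) (at x)" .
  have "(D has_real_derivative 0 - \<alpha> * (((1 * R x + ?R' * (\<alpha> * (x / s x)) * x) * s x - x * R x * (x / s x)) / (s x * s x))) (at x)"
    unfolding gh_slope_def
    by (intro DERIV_diff DERIV_const DERIV_cmult DERIV_divide DERIV_mult DERIV_ident dR ds) (use s in auto)
  also have "0 - \<alpha> * (((1 * R x + ?R' * (\<alpha> * (x / s x)) * x) * s x - x * R x * (x / s x)) / (s x * s x))
     = - \<alpha> / (s x)^3 * (R x * ((s x)\<^sup>2 - x\<^sup>2) + x\<^sup>2 * (\<alpha> * s x) * ?R')"
  proof -
    have gen: "0 - a * (((1 * r + r' * (a * (x / S)) * x) * S - x * r * (x / S)) / (S * S))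
       = - a / S^3 * (r * (S\<^sup>2 - x\<^sup>2) + x\<^sup>2 * (a * S) * r')" if "0 < S" for a r r' S :: real
      using that by (simp add: field_simps power2_eq_square power3_eq_cube)
    show ?thesis by (rule gen[OF s])
  qed
  also have "(s x)\<^sup>2 - x\<^sup>2 = \<delta>\<^sup>2" by simp
  finally show ?thesis .
qed

text \<open>For \<nu> \<ge> 1/2 neither term in the bracket is negative. For \<nu> < 1/2 the second
  is negative, and the zero of the slope supplies x R = (\<beta>/\<alpha>) s < s, which the
  elasticity estimate needs.\<close>

lemma slope_derivative_neg:
  assumes x: "0 < x" and D0: "D x = 0" and nd: "0 < \<delta> \<or> 1/2 < \<nu>"
  shows "- \<alpha> / (s x)^3 * (R x * \<delta>\<^sup>2 + x\<^sup>2 * (\<alpha> * s x) * ((R x)\<^sup>2 + (2 * \<nu> - 1) * R x / (\<alpha> * s x) - 1)) < 0"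
proof -
  have s: "0 < s x" using x s_pos by simp
  have R: "0 < R x" using R_pos x by simp
  have y: "0 < \<alpha> * s x" using \<alpha> s by simp
  let ?R' = "(R x)\<^sup>2 + (2 * \<nu> - 1) * R x / (\<alpha> * s x) - 1"
  have "0 < R x * \<delta>\<^sup>2 + x\<^sup>2 * (\<alpha> * s x) * ?R'"
  proof (cases "1/2 < \<nu>")
    case True
    have "0 < x\<^sup>2" using x by simp
    from mult_pos_pos[OF mult_pos_pos[OF this y] bessel_R_riccati_pos[OF y True]]
    have "0 < x\<^sup>2 * (\<alpha> * s x) * ?R'" .
    moreover have "0 \<le> R x * \<delta>\<^sup>2" using less_imp_le[OF R] by (rule mult_nonneg_nonneg) simp
    ultimately show ?thesis by linarith
  next
    case False
    then have d: "0 < \<delta>" using nd by simp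
    have Rd: "0 < R x * \<delta>\<^sup>2" using R d by simp
    show ?thesis
    proof (cases "\<nu> = 1/2")
      case True
      have "?R' = 0" unfolding True by (rule bessel_R_riccati_half[OF y])
      then show ?thesis using Rd by simp
    next
      case False
      then have nu: "\<nu> < 1/2" using \<open>\<not> 1/2 < \<nu>\<close> by simp
      have "x * R x = \<beta> / \<alpha> * s x"
        using D0 x \<alpha> unfolding slope_neg_iff(3)[OF x] by simp
      also have "\<dots> < 1 * s x" using \<beta> \<alpha> s by (intro mult_strict_right_mono) auto
      finally have "x * R x < s x" by simp
      then show ?thesis
        by (intro elasticity_slope_pos[OF x R y bessel_R_elasticity[OF y nu], of "s x"]) auto
    qed
  qed
  moreover have "- \<alpha> / (s x)^3 < 0" using \<alpha> zero_less_power[OF s, of 3] by (intro divide_neg_pos) linarith+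
  ultimately show ?thesis by (intro mult_neg_pos)
qed

text \<open>The slope tends to \<beta> > 0 at the origin and is negative far out, so it has a zero;
  decreasing at every zero, it has no other on the positive axis.\<close>

lemma slope_crossing:
  assumes nd: "0 < \<delta> \<or> 1/2 < \<nu>"
  shows "\<exists>M>0. D M = 0 \<and> (\<forall>x. 0 < x \<longrightarrow> x < M \<longrightarrow> 0 < D x) \<and> (\<forall>x>M. D x < 0)"
proof -
  let ?g = "gh_gamma \<alpha> \<beta>"
  \<comment> \<open>An upper estimate of the larger root of the polynomial with c = \<nu>, obtained
    by bounding its square root by |\<nu>| + \<delta> \<gamma>.\<close>
  define x2 where "x2 = 2 * \<bar>\<nu>\<bar> * \<beta> / ?g\<^sup>2 + \<delta> * \<beta> / ?g"
  have x2: "0 < x2" "D x2 < 0"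
  proof -
    have "0 \<le> 2 * \<bar>\<nu>\<bar> * \<beta> / ?g\<^sup>2" "0 \<le> \<delta> * \<beta> / ?g"
      using \<beta>(1) \<delta> gamma_sq(2) by simp_all
    moreover have "0 < 2 * \<bar>\<nu>\<bar> * \<beta> / ?g\<^sup>2 \<or> 0 < \<delta> * \<beta> / ?g"
    proof (cases "0 < \<delta>")
      case True
      then show ?thesis using \<beta>(1) gamma_sq(2) by simp
    next
      case False
      then have "0 < \<bar>\<nu>\<bar>" using nd by simp
      then show ?thesis using \<beta>(1) gamma_sq(2) by simp
    qed
    ultimately show p: "0 < x2" unfolding x2_def by linarith
    have "?g\<^sup>2 * x2 = 2 * \<bar>\<nu>\<bar> * \<beta> + \<delta> * \<beta> * ?g"
      using gamma_sq(2) unfolding x2_def by (simp add: field_simps power2_eq_square)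
    then have "?g\<^sup>2 * x2\<^sup>2 = 2 * \<bar>\<nu>\<bar> * \<beta> * x2 + \<delta> * \<beta> * ?g * x2"
      by (simp add: power2_eq_square algebra_simps)
    moreover have "2 * \<nu> * \<beta> * x2 \<le> 2 * \<bar>\<nu>\<bar> * \<beta> * x2"
      using p \<beta> by (intro mult_right_mono) auto
    moreover have "\<delta> * \<beta> * ?g * (\<delta> * \<beta> / ?g) \<le> \<delta> * \<beta> * ?g * x2"
      using \<delta> \<beta> gamma_sq(2) unfolding x2_def by (intro mult_left_mono) auto
    moreover have "\<delta> * \<beta> * ?g * (\<delta> * \<beta> / ?g) = \<delta>\<^sup>2 * \<beta>\<^sup>2"
      using gamma_sq(2) by (simp add: power2_eq_square)
    ultimately show "D x2 < 0" using p by (intro slope_neg_large) auto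
  qed
  have "(D \<longlongrightarrow> \<beta>) (at_right 0)"
  proof (cases "0 < \<delta>")
    case True
    then have "isCont D 0" using slope_derivative[of 0] DERIV_isCont by blast
    then have "(D \<longlongrightarrow> D 0) (at_right 0)"
      unfolding isCont_def by (rule filterlim_mono[OF _ order_refl at_le]) simp
    then show ?thesis by (simp add: gh_slope_def)
  next
    \<comment> \<open>For \<delta> = 0 the factor x/s equals 1, so the limit rests on R tending to 0
      at the origin, where \<nu> > 1/2 enters.\<close>
    case False
    then have d: "\<delta> = 0" and nu: "1/2 < \<nu>" using \<delta> nd by auto
    note filterlim_compose[OF bessel_R_null_0[OF nu] filterlim_mult_at_right_0[OF \<alpha>]]
    then have lim: "((\<lambda>x. \<beta> - \<alpha> * bessel_R \<nu> (\<alpha> * x)) \<longlongrightarrow> \<beta> - \<alpha> * 0) (at_right 0)"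
      by (intro tendsto_intros)
    have "\<forall>\<^sub>F x in at_right 0. \<beta> - \<alpha> * bessel_R \<nu> (\<alpha> * x) = D x"
      using eventually_at_right_less[of 0] by eventually_elim (simp add: gh_slope_def d)
    from Lim_transform_eventually[OF lim this] show ?thesis by simp
  qed
  then have "\<forall>\<^sub>F x in at_right 0. 0 < D x" using \<beta> by (intro order_tendstoD) auto
  moreover have "\<forall>\<^sub>F x in at_right 0. x < x2"
    using x2 by (intro order_tendstoD[OF tendsto_ident_at])
  ultimately have "\<forall>\<^sub>F x in at_right 0. 0 < x \<and> x < x2 \<and> 0 < D x"
    using eventually_at_right_less[of 0] by eventually_elim simp
  then obtain x1 where x1: "0 < x1" "x1 < x2" "0 < D x1"
    using eventually_happens'[OF trivial_limit_at_right_real] by blast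
  have "continuous_on {x1..x2} D"
    using x1 by (intro DERIV_continuous_on[OF has_field_derivative_at_within[OF slope_derivative]]) auto
  then obtain M where M: "x1 \<le> M" "M \<le> x2" "D M = 0"
    using IVT2'[of D x2 0 x1] x1 x2 by auto
  have neg: "D x < 0" if "0 < a" "D a \<le> 0" "a < x" for a x
    using that by (intro neg_after_decreasing_zeros[OF slope_derivative slope_derivative_neg[OF _ _ nd]]) auto
  have M0: "0 < M" using M x1 by simp
  have "0 < D x" if "0 < x" "x < M" for x
    using neg[OF that(1) _ that(2)] M(3) by (cases "D x \<le> 0") auto
  moreover have "D x < 0" if "M < x" for x
    using neg[OF M0 _ that] M(3) by simp
  ultimately show ?thesis using M0 M(3) by (intro exI[of _ M] conjI allI impI)
qed

end

section \<open>The mode as a critical point\<close>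

text \<open>The power of y is chosen so that the logarithmic derivative is exactly -R, without a
  term \<nu>/y.\<close>

definition bessel_w :: "real \<Rightarrow> real \<Rightarrow> real" where
  "bessel_w \<nu> y = y powr \<nu> * bessel_K \<nu> y"

lemma bessel_w_pos: "0 < y \<Longrightarrow> 0 < bessel_w \<nu> y"
  unfolding bessel_w_def by (simp add: bessel_K_pos)

lemma bessel_w_has_derivative:
  assumes y: "0 < y"
  shows "(bessel_w \<nu> has_real_derivative - (bessel_w \<nu> y * bessel_R \<nu> y)) (at y)"
proof -
  have K: "0 < bessel_K \<nu> y" using y by (rule bessel_K_pos)
  have "((\<lambda>y. y powr \<nu>) has_real_derivative \<nu> * y powr (\<nu> - 1)) (at y)"
    using y by (rule has_real_derivative_powr)
  from DERIV_mult[OF this bessel_K_has_derivative[OF y, of \<nu>]]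
  have "(bessel_w \<nu> has_real_derivative \<nu> * y powr (\<nu> - 1) * bessel_K \<nu> y
    + - (bessel_K (\<nu> + 1) y + bessel_K (\<nu> - 1) y) / 2 * y powr \<nu>) (at y)"
    unfolding bessel_w_def .
  moreover have "\<nu> * y powr (\<nu> - 1) * bessel_K \<nu> y + - (bessel_K (\<nu> + 1) y + bessel_K (\<nu> - 1) y) / 2 * y powr \<nu>
    = - (bessel_w \<nu> y * bessel_R \<nu> y)"
  proof -
    have p: "y powr (\<nu> - 1) = y powr \<nu> / y" using y by (simp add: powr_diff)
    show ?thesis
      unfolding p bessel_K_plus_1[OF y] bessel_w_def bessel_R_def using y K by (simp add: field_simps)
  qed
  ultimately show ?thesis by simp
qed

text \<open>A strict global maximum settles both parts of the definition: the density is bounded, so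
  the exceptional branch is not taken, and the maximizer is unique.\<close>

lemma density_mode_eqI:
  assumes "\<And>x. x \<noteq> M \<Longrightarrow> p x < p M"
  shows "density_mode p = M"
proof -
  have le: "p x \<le> p M" for x using assms[of x] by (cases "x = M") auto
  have "bdd_above (p ` ball 0 1)" by (rule bdd_aboveI2[OF le])
  then have "\<not> (\<forall>e>0. \<not> bdd_above (p ` ball 0 e))" using zero_less_one by blast
  moreover have "(THE M. \<forall>x. p x \<le> p M) = M"
  proof (rule the_equality)
    show "\<forall>x. p x \<le> p M" using le by blast
    show "N = M" if "\<forall>x. p x \<le> p N" for N
      using that assms[of N] by (meson not_le)
  qed
  ultimately show ?thesis unfolding density_mode_def by (simp only: if_False)
qed

lemma density_mode_unimodal:
  assumes cont: "continuous_on UNIV p"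
    and deriv: "\<And>x. x \<noteq> 0 \<Longrightarrow> (p has_real_derivative p' x) (at x)"
    and inc: "\<And>x. x < M \<Longrightarrow> x \<noteq> 0 \<Longrightarrow> 0 < p' x"
    and dec: "\<And>x. M < x \<Longrightarrow> x \<noteq> 0 \<Longrightarrow> p' x < 0"
  shows "density_mode p = M"
proof (rule density_mode_eqI)
  have up0: "p a < p b" if "a < b" "b \<le> M" "0 \<notin> {a<..<b}" for a b
  proof (rule DERIV_pos_imp_increasing_open[OF that(1)])
    show "\<exists>y. (p has_real_derivative y) (at x) \<and> 0 < y" if x: "a < x" "x < b" for x
    proof -
      have "x \<noteq> 0" using x \<open>0 \<notin> {a<..<b}\<close> by auto
      then show ?thesis using deriv[of x] inc[of x] x \<open>b \<le> M\<close> by auto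
    qed
    show "continuous_on {a..b} p" using cont by (rule continuous_on_subset) simp
  qed
  have down0: "p b < p a" if "a < b" "M \<le> a" "0 \<notin> {a<..<b}" for a b
  proof (rule DERIV_neg_imp_decreasing_open[OF that(1)])
    show "\<exists>y. (p has_real_derivative y) (at x) \<and> y < 0" if x: "a < x" "x < b" for x
    proof -
      have "x \<noteq> 0" using x \<open>0 \<notin> {a<..<b}\<close> by auto
      then show ?thesis using deriv[of x] dec[of x] x \<open>M \<le> a\<close> by auto
    qed
    show "continuous_on {a..b} p" using cont by (rule continuous_on_subset) simp
  qed
  fix x assume "x \<noteq> M"
  then consider "x < M" | "M < x" by linarith
  then show "p x < p M"
  proof cases
    case 1
    show ?thesis
    proof (cases "x < 0 \<and> 0 < M")
      case True
      then show ?thesis using up0[of x 0] up0[of 0 M] by simp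
    qed (use 1 in \<open>auto intro: up0\<close>)
  next
    case 2
    show ?thesis
    proof (cases "M < 0 \<and> 0 < x")
      case True
      then show ?thesis using down0[of M 0] down0[of 0 x] by simp
    qed (use 2 in \<open>auto intro: down0\<close>)
  qed
qed

context gh_parameters
begin

definition kern :: "real \<Rightarrow> real" where
  "kern x = exp (\<beta> * x) * bessel_w \<nu> (\<alpha> * s x)"

lemma kern_pos: "0 < \<delta> \<or> x \<noteq> 0 \<Longrightarrow> 0 < kern x"
  using s_pos[of x] \<alpha> unfolding kern_def by (intro mult_pos_pos bessel_w_pos) auto

lemma kern_has_derivative:
  assumes "0 < \<delta> \<or> x \<noteq> 0"
  shows "(kern has_real_derivative kern x * D x) (at x)"
proof -
  have s: "0 < s x" using assms by (rule s_pos)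
  note ds = s_has_derivative[OF assms]
  have y: "0 < \<alpha> * s x" using s \<alpha> by simp
  have "((\<lambda>x. \<alpha> * s x) has_real_derivative \<alpha> * (x / s x)) (at x)"
    using ds by (rule DERIV_cmult)
  from DERIV_chain2[where f="bessel_w \<nu>" and g="\<lambda>x. \<alpha> * s x", OF bessel_w_has_derivative[OF y] this]
  have dw: "((\<lambda>x. bessel_w \<nu> (\<alpha> * s x)) has_real_derivative - (bessel_w \<nu> (\<alpha> * s x) * R x) * (\<alpha> * (x / s x))) (at x)" .
  have "((\<lambda>x. exp (\<beta> * x)) has_real_derivative exp (\<beta> * x) * \<beta>) (at x)"
    by (auto intro!: derivative_eq_intros)
  from DERIV_mult[OF this dw]
  have "(kern has_real_derivative exp (\<beta> * x) * \<beta> * bessel_w \<nu> (\<alpha> * s x)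
     + - (bessel_w \<nu> (\<alpha> * s x) * R x) * (\<alpha> * (x / s x)) * exp (\<beta> * x)) (at x)"
    unfolding kern_def .
  moreover have "exp (\<beta> * x) * \<beta> * bessel_w \<nu> (\<alpha> * s x)
     + - (bessel_w \<nu> (\<alpha> * s x) * R x) * (\<alpha> * (x / s x)) * exp (\<beta> * x) = kern x * D x"
    unfolding kern_def gh_slope_def by (simp add: algebra_simps)
  ultimately show ?thesis by simp
qed

lemma density_mode_kern:
  assumes C: "0 < C" and p: "\<And>x. 0 < \<delta> \<or> x \<noteq> 0 \<Longrightarrow> p x = C * kern x" and p0: "isCont p 0"
    and inc: "\<And>x. x < M \<Longrightarrow> x \<noteq> 0 \<Longrightarrow> 0 < D x" and dec: "\<And>x. M < x \<Longrightarrow> x \<noteq> 0 \<Longrightarrow> D x < 0"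
  shows "density_mode p = M"
proof (rule density_mode_unimodal)
  show d: "(p has_real_derivative C * (kern x * D x)) (at x)" if "x \<noteq> 0" for x
  proof (rule has_field_derivative_transform_within_open)
    show "((\<lambda>x. C * kern x) has_real_derivative C * (kern x * D x)) (at x)"
      using kern_has_derivative[of x] that by (intro DERIV_cmult) auto
    show "open (- {0::real})" by (simp add: open_Compl)
  qed (use that p in auto)
  show "continuous_on UNIV p"
    using p0 DERIV_isCont[OF d] by (auto simp: continuous_on_eq_continuous_at) (metis continuous_at_imp_continuous_at_within)
  show "0 < C * (kern x * D x)" if "x < M" "x \<noteq> 0" for x
    using C kern_pos[of x] inc[OF that] that by (intro mult_pos_pos) auto
  show "C * (kern x * D x) < 0" if "M < x" "x \<noteq> 0" for x
    using C kern_pos[of x] dec[OF that] that by (intro mult_pos_neg) auto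
qed

lemma slope_pos_left: "x < 0 \<Longrightarrow> 0 < D x"
proof -
  assume x: "x < 0"
  then have "\<alpha> * (x * R x / s x) \<le> 0"
    using \<alpha> s_pos[of x] R_pos[of x] by (intro mult_nonneg_nonpos divide_nonpos_pos mult_nonpos_nonneg) auto
  then show ?thesis using \<beta> unfolding gh_slope_def by linarith
qed

lemma gh_density_kern:
  assumes "0 < \<delta>"
  obtains C where "0 < C" "\<And>x. gh_density (\<nu> + 1/2) \<alpha> \<beta> \<delta> x = C * kern x"
proof -
  define A where "A = (gh_gamma \<alpha> \<beta> / \<delta>) powr (\<nu> + 1/2) / (sqrt (2 * pi) * bessel_K (\<nu> + 1/2) (\<delta> * gh_gamma \<alpha> \<beta>))"
  have "0 < A" unfolding A_def using gamma_sq assms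
    by (auto intro!: divide_pos_pos mult_pos_pos bessel_K_pos)
  show ?thesis
  proof
    show "0 < A * (\<alpha>\<^sup>2) powr (- \<nu>)" using \<open>0 < A\<close> \<alpha> by simp
    fix x
    have s: "0 < s x" using assms by (intro s_pos) simp
    \<comment> \<open>Turns the base of the power into the argument of the Bessel function; the
      remaining power of \<open>\<alpha>\<^sup>2\<close> joins the constant.\<close>
    have "s x / \<alpha> = \<alpha> * s x / \<alpha>\<^sup>2" using \<alpha> by (simp add: power2_eq_square)
    then have "(s x / \<alpha>) powr (- \<nu>) = (\<alpha> * s x) powr (- \<nu>) / (\<alpha>\<^sup>2) powr (- \<nu>)"
      using s \<alpha> by (simp add: powr_divide)
    then have "bessel_K \<nu> (\<alpha> * s x) / (s x / \<alpha>) powr (- \<nu>) = bessel_w \<nu> (\<alpha> * s x) * (\<alpha>\<^sup>2) powr (- \<nu>)"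
      unfolding bessel_w_def using s \<alpha> by (simp add: powr_minus field_simps)
    moreover have "gh_density (\<nu> + 1/2) \<alpha> \<beta> \<delta> x = A * exp (\<beta> * x) * (bessel_K \<nu> (\<alpha> * s x) / (s x / \<alpha>) powr (- \<nu>))"
      using assms unfolding gh_density_def A_def by simp
    ultimately show "gh_density (\<nu> + 1/2) \<alpha> \<beta> \<delta> x = A * (\<alpha>\<^sup>2) powr (- \<nu>) * kern x"
      unfolding kern_def by simp
  qed
qed

lemma vg_density_kern:
  assumes "\<delta> = 0" "- 1/2 < \<nu>"
  obtains C where "0 < C" "\<And>x. x \<noteq> 0 \<Longrightarrow> vg_density (\<nu> + 1/2) \<alpha> \<beta> x = C * kern x"
proof -
  define A where "A = gh_gamma \<alpha> \<beta> powr (2 * (\<nu> + 1/2)) / (sqrt pi * Gamma (\<nu> + 1/2))"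
  have "0 < A" unfolding A_def using gamma_sq Gamma_real_pos[of "\<nu> + 1/2"] assms
    by (auto intro!: divide_pos_pos mult_pos_pos)
  show ?thesis
  proof
    show "0 < A / (2 * \<alpha>\<^sup>2) powr \<nu>" using \<open>0 < A\<close> \<alpha> by simp
    fix x :: real assume x: "x \<noteq> 0"
    have "\<bar>x\<bar> / (2 * \<alpha>) = \<alpha> * \<bar>x\<bar> / (2 * \<alpha>\<^sup>2)" using \<alpha> by (simp add: power2_eq_square)
    then have "(\<bar>x\<bar> / (2 * \<alpha>)) powr \<nu> = (\<alpha> * \<bar>x\<bar>) powr \<nu> / (2 * \<alpha>\<^sup>2) powr \<nu>"
      using x \<alpha> by (simp only:) (subst powr_divide, auto)
    then have "vg_density (\<nu> + 1/2) \<alpha> \<beta> x = A * ((\<alpha> * \<bar>x\<bar>) powr \<nu> / (2 * \<alpha>\<^sup>2) powr \<nu>) * exp (\<beta> * x) * bessel_K \<nu> (\<alpha> * \<bar>x\<bar>)"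
      unfolding vg_density_def A_def by simp
    then show "vg_density (\<nu> + 1/2) \<alpha> \<beta> x = A / (2 * \<alpha>\<^sup>2) powr \<nu> * kern x"
      unfolding kern_def bessel_w_def using assms by simp
  qed
qed

lemma kern_tendsto_0:
  assumes "\<delta> = 0" "0 < \<nu>"
  shows "(kern \<longlongrightarrow> 2 powr (\<nu> - 1) * Gamma \<nu>) (at 0)"
proof -
  have "filterlim (\<lambda>x. \<alpha> * s x) (at_right 0) (at 0)"
  proof (rule filterlim_at_withinI)
    have "((\<lambda>x. \<alpha> * \<bar>x\<bar>) \<longlongrightarrow> \<alpha> * \<bar>0\<bar>) (at (0::real))"
      by (intro tendsto_intros)
    then show "((\<lambda>x. \<alpha> * s x) \<longlongrightarrow> 0) (at 0)" using assms by simp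
    show "\<forall>\<^sub>F x in at 0. \<alpha> * s x \<in> {0<..} - {0}"
      using \<alpha> assms by (auto simp: eventually_at_filter)
  qed
  from filterlim_compose[OF bessel_K_asymp_0[OF assms(2)] this]
  have "((\<lambda>x. bessel_w \<nu> (\<alpha> * s x)) \<longlongrightarrow> 2 powr (\<nu> - 1) * Gamma \<nu>) (at 0)"
    by (simp add: bessel_w_def)
  moreover have "((\<lambda>x. exp (\<beta> * x)) \<longlongrightarrow> exp (\<beta> * 0)) (at 0)"
    by (intro tendsto_intros)
  ultimately have "((\<lambda>x. exp (\<beta> * x) * bessel_w \<nu> (\<alpha> * s x)) \<longlongrightarrow> exp (\<beta> * 0) * (2 powr (\<nu> - 1) * Gamma \<nu>)) (at 0)"
    by (intro tendsto_mult)
  then show ?thesis unfolding kern_def by simp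
qed

text \<open>The condition \<open>nd\<close> asks only for a finite value at 0. It thus includes
  \<delta> = 0 with 0 < \<nu> \<le> 1/2, where the density is continuous and peaks at 0 without a
  critical point.\<close>

lemma gh_mode_kern:
  assumes nd: "0 < \<delta> \<or> 0 < \<nu>"
    and inc: "\<And>x. x < M \<Longrightarrow> x \<noteq> 0 \<Longrightarrow> 0 < D x" and dec: "\<And>x. M < x \<Longrightarrow> x \<noteq> 0 \<Longrightarrow> D x < 0"
  shows "gh_mode (\<nu> + 1/2) \<alpha> \<beta> \<delta> = M"
proof (cases "0 < \<delta>")
  case True
  then obtain C where C: "0 < C" "\<And>x. gh_density (\<nu> + 1/2) \<alpha> \<beta> \<delta> x = C * kern x"
    using gh_density_kern by blast
  have "isCont (\<lambda>x. C * kern x) 0"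
    using DERIV_isCont[OF kern_has_derivative[of 0]] True by simp
  moreover have "gh_density (\<nu> + 1/2) \<alpha> \<beta> \<delta> = (\<lambda>x. C * kern x)" using C(2) by blast
  ultimately have "isCont (gh_density (\<nu> + 1/2) \<alpha> \<beta> \<delta>) 0" by simp
  then show ?thesis unfolding gh_mode_def
    by (intro density_mode_kern[OF C(1)] C(2) inc dec)
next
  case False
  then have d: "\<delta> = 0" and nu: "0 < \<nu>" using \<delta> nd by auto
  from nu have "- 1/2 < \<nu>" by simp
  then obtain C where C: "0 < C" "\<And>x. x \<noteq> 0 \<Longrightarrow> vg_density (\<nu> + 1/2) \<alpha> \<beta> x = C * kern x"
    using vg_density_kern[OF d] by blast
  let ?L = "C * (2 powr (\<nu> - 1) * Gamma \<nu>)"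
  have lim: "((\<lambda>x. C * kern x) \<longlongrightarrow> ?L) (at 0)"
    by (intro tendsto_mult tendsto_const kern_tendsto_0 d nu)
  have "(vg_density (\<nu> + 1/2) \<alpha> \<beta> \<longlongrightarrow> ?L) (at 0)"
    by (rule Lim_transform_eventually[OF lim]) (auto simp: eventually_at_filter C(2))
  then have L: "Lim (at 0) (vg_density (\<nu> + 1/2) \<alpha> \<beta>) = ?L"
    by (intro tendsto_Lim) auto
  have p: "gh_density (\<nu> + 1/2) \<alpha> \<beta> \<delta> x = C * kern x" if "x \<noteq> 0" for x
    using that C(2) d by (simp add: gh_density_def)
  have "(gh_density (\<nu> + 1/2) \<alpha> \<beta> \<delta> \<longlongrightarrow> ?L) (at 0)"
    by (rule Lim_transform_eventually[OF lim]) (auto simp: eventually_at_filter p)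
  then have "isCont (gh_density (\<nu> + 1/2) \<alpha> \<beta> \<delta>) 0"
    using L d unfolding isCont_def by (simp add: gh_density_def)
  then show ?thesis unfolding gh_mode_def
    using p d by (intro density_mode_kern[OF C(1)] inc dec) auto
qed

lemma gh_mode_slope:
  assumes nd: "0 < \<delta> \<or> 1/2 < \<nu>"
  shows "0 < gh_mode (\<nu> + 1/2) \<alpha> \<beta> \<delta>" "D (gh_mode (\<nu> + 1/2) \<alpha> \<beta> \<delta>) = 0"
    "0 < x \<Longrightarrow> 0 < D x \<Longrightarrow> x < gh_mode (\<nu> + 1/2) \<alpha> \<beta> \<delta>"
proof -
  obtain M where M: "0 < M" "D M = 0" "\<And>x. 0 < x \<Longrightarrow> x < M \<Longrightarrow> 0 < D x" "\<And>x. M < x \<Longrightarrow> D x < 0"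
    using slope_crossing[OF nd] by blast
  have eq: "gh_mode (\<nu> + 1/2) \<alpha> \<beta> \<delta> = M"
  proof (rule gh_mode_kern)
    show "0 < D x" if "x < M" "x \<noteq> 0" for x
      using M(3)[of x] slope_pos_left[of x] that by (cases "x < 0") auto
  qed (use nd M(4) in auto)
  show "0 < gh_mode (\<nu> + 1/2) \<alpha> \<beta> \<delta>" "D (gh_mode (\<nu> + 1/2) \<alpha> \<beta> \<delta>) = 0"
    unfolding eq by (fact M)+
  show "0 < x \<Longrightarrow> 0 < D x \<Longrightarrow> x < gh_mode (\<nu> + 1/2) \<alpha> \<beta> \<delta>"
    unfolding eq using M(2) M(4)[of x] by (metis less_asym less_irrefl linorder_neqE_linordered_idom)
qed

text \<open>For \<nu> > 0 the ratio is at least 1 > \<beta>/\<alpha>, so the slope is negative on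
  the whole positive axis. For \<nu> \<le> 0 the density is unbounded at 0: when y < 1, y^\<nu> is
  at least 1 and K of order \<nu> is at least K of order 0, which tends to infinity.\<close>

lemma gh_mode_eq_0:
  assumes d: "\<delta> = 0" and nu: "- 1/2 < \<nu>" "\<nu> \<le> 1/2"
  shows "gh_mode (\<nu> + 1/2) \<alpha> \<beta> \<delta> = 0"
proof (cases "0 < \<nu>")
  case True
  show ?thesis
  proof (rule gh_mode_kern)
    show "D x < 0" if x: "0 < x" for x
    proof -
      have y: "0 < \<alpha> * s x" using s_pos[of x] x \<alpha> by simp
      then have "1 \<le> R x"
      proof (cases "\<nu> = 1/2")
        case True
        show ?thesis unfolding True using bessel_R_half[OF y] by simp
      qed (use bessel_R_ge_1[OF y, of \<nu>] nu in auto)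
      moreover have "D x = \<beta> - \<alpha> * R x" using x d by (simp add: gh_slope_def)
      moreover have "\<alpha> * 1 \<le> \<alpha> * R x" using \<open>1 \<le> R x\<close> \<alpha> by (intro mult_left_mono) auto
      ultimately show ?thesis using \<beta> by linarith
    qed
  qed (use True slope_pos_left in auto)
next
  case False
  obtain C where C: "0 < C" "\<And>x. x \<noteq> 0 \<Longrightarrow> vg_density (\<nu> + 1/2) \<alpha> \<beta> x = C * kern x"
    using vg_density_kern[OF d nu(1)] by blast
  have p: "gh_density (\<nu> + 1/2) \<alpha> \<beta> \<delta> x = C * kern x" if "x \<noteq> 0" for x
    using that C(2) d by (simp add: gh_density_def)
  have lim: "LIM x at_right 0. C * bessel_K 0 (\<alpha> * x) :> at_top"
    by (intro filterlim_tendsto_pos_mult_at_top[OF tendsto_const C(1)]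
       filterlim_compose[OF bessel_K_0_at_top] filterlim_mult_at_right_0 \<alpha>)
  have le: "C * bessel_K 0 (\<alpha> * x) \<le> gh_density (\<nu> + 1/2) \<alpha> \<beta> \<delta> x" if x: "0 < x" "\<alpha> * x < 1" for x
  proof -
    have y: "0 < \<alpha> * x" using x \<alpha> by simp
    have "1 * bessel_K 0 (\<alpha> * x) \<le> (\<alpha> * x) powr \<nu> * bessel_K \<nu> (\<alpha> * x)"
    proof (intro mult_mono)
      have "(\<alpha> * x) powr 0 \<le> (\<alpha> * x) powr \<nu>"
        using y x False by (intro powr_mono') auto
      moreover have "(\<alpha> * x) powr 0 = 1" using less_imp_neq[OF y] powr_zero_eq_one by metis
      ultimately show "1 \<le> (\<alpha> * x) powr \<nu>" by linarith
      show "bessel_K 0 (\<alpha> * x) \<le> bessel_K \<nu> (\<alpha> * x)"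
        using y by (intro bessel_K_mono_order) auto
      show "0 \<le> bessel_K 0 (\<alpha> * x)" using bessel_K_pos[OF y] by (rule less_imp_le)
    qed simp
    also have "\<dots> \<le> exp (\<beta> * x) * ((\<alpha> * x) powr \<nu> * bessel_K \<nu> (\<alpha> * x))"
      using x \<beta> bessel_w_pos[OF y, of \<nu>] unfolding bessel_w_def by (intro mult_le_cancel_right1[THEN iffD2]) auto
    also have "\<dots> = kern x" unfolding kern_def bessel_w_def using x d by simp
    finally show ?thesis using C(1) p[of x] x by simp
  qed
  have "\<not> bdd_above (gh_density (\<nu> + 1/2) \<alpha> \<beta> \<delta> ` ball 0 e)" if e: "0 < e" for e
  proof
    assume "bdd_above (gh_density (\<nu> + 1/2) \<alpha> \<beta> \<delta> ` ball 0 e)"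
    then obtain B where B: "\<And>x. x \<in> ball 0 e \<Longrightarrow> gh_density (\<nu> + 1/2) \<alpha> \<beta> \<delta> x \<le> B"
      unfolding bdd_above_def by blast
    have "\<forall>\<^sub>F x in at_right 0. B < C * bessel_K 0 (\<alpha> * x)"
      using lim by (simp add: filterlim_at_top_dense)
    moreover have "\<forall>\<^sub>F x::real in at_right 0. x < e" "\<forall>\<^sub>F x in at_right 0. x < 1 / \<alpha>"
      using e \<alpha> by (auto intro!: order_tendstoD[OF tendsto_ident_at])
    ultimately have "\<forall>\<^sub>F x::real in at_right 0. False"
      using eventually_at_right_less[of 0]
    proof eventually_elim
      case (elim x)
      have "\<alpha> * x < 1" using elim \<alpha> by (simp add: field_simps)
      then show ?case using le[of x] B[of x] elim by simp
    qed
    then show False by simp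
  qed
  then show ?thesis unfolding gh_mode_def density_mode_def by simp
qed

end

section \<open>Bounds for the mode\<close>

text \<open>The derivative of the recurrence R_\<nu> = 1 / R_(\<nu>+1) - 2 \<nu> / y, with both
  derivatives expressed through the Riccati equation.\<close>

lemma riccati_shift:
  assumes y: "0 < y"
  shows "(bessel_R \<nu> y)\<^sup>2 + (2 * \<nu> - 1) * bessel_R \<nu> y / y - 1
    = - ((bessel_R (\<nu> + 1) y)\<^sup>2 + (2 * (\<nu> + 1) - 1) * bessel_R (\<nu> + 1) y / y - 1) / (bessel_R (\<nu> + 1) y)\<^sup>2 + 2 * \<nu> / y\<^sup>2"
proof -
  define r where "r = bessel_R (\<nu> + 1) y"
  have r: "0 < r" using y unfolding r_def by (rule bessel_R_pos)
  have T: "bessel_R \<nu> y = 1 / r - 2 * \<nu> / y"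
    using bessel_R_recurrence[OF y, of \<nu>] r unfolding r_def by simp
  show ?thesis
    unfolding r_def[symmetric] T using r y by (simp add: field_simps power2_eq_square)
qed

text \<open>An upper bound for the derivative of R, from the increase of R at order \<nu> + 1; it
  serves the limit of the variance-gamma mode.\<close>

lemma bessel_R_riccati_less:
  assumes y: "0 < y" and \<nu>: "- 1/2 < \<nu>"
  shows "(bessel_R \<nu> y)\<^sup>2 + (2 * \<nu> - 1) * bessel_R \<nu> y / y - 1 < 2 * \<nu> / y\<^sup>2"
proof -
  have "0 < ((bessel_R (\<nu> + 1) y)\<^sup>2 + (2 * (\<nu> + 1) - 1) * bessel_R (\<nu> + 1) y / y - 1) / (bessel_R (\<nu> + 1) y)\<^sup>2"
    using bessel_R_riccati_pos[OF y, of "\<nu> + 1"] bessel_R_pos[OF y, of "\<nu> + 1"] \<nu>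
    by (intro divide_pos_pos) auto
  then show ?thesis unfolding riccati_shift[OF y, of \<nu>] minus_divide_left[symmetric] by linarith
qed

text \<open>The polynomial factors over its two roots; \<open>pos\<close> says that M lies above the
  smaller one, so its sign is that of M - b.\<close>

lemma quadratic_root_compare:
  fixes b c g E M \<beta> :: real
  assumes g: "0 < g" and E: "0 \<le> c\<^sup>2 + g * E"
    and b: "b = \<beta> / g * (c + sqrt (c\<^sup>2 + g * E))"
    and pos: "\<beta> * c < g * M + \<beta> * sqrt (c\<^sup>2 + g * E)"
  shows "M < b \<longleftrightarrow> g * M\<^sup>2 - 2 * c * \<beta> * M - \<beta>\<^sup>2 * E < 0"
    and "b < M \<longleftrightarrow> 0 < g * M\<^sup>2 - 2 * c * \<beta> * M - \<beta>\<^sup>2 * E"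
    and "M = b \<longleftrightarrow> g * M\<^sup>2 - 2 * c * \<beta> * M - \<beta>\<^sup>2 * E = 0"
proof -
  let ?q = "sqrt (c\<^sup>2 + g * E)"
  have gb: "g * b = \<beta> * c + \<beta> * ?q" using g unfolding b by (simp add: algebra_simps)
  have q: "?q\<^sup>2 = c\<^sup>2 + g * E" using E by simp
  have "g * (g * M\<^sup>2 - 2 * c * \<beta> * M - \<beta>\<^sup>2 * E) = (g * M - \<beta> * c)\<^sup>2 - \<beta>\<^sup>2 * ?q\<^sup>2"
    unfolding q by (simp add: algebra_simps power2_eq_square)
  also have "\<dots> = (g * M - g * b) * (g * M + \<beta> * ?q - \<beta> * c)"
    unfolding gb by (simp add: algebra_simps power2_eq_square)
  finally have "g * (g * M\<^sup>2 - 2 * c * \<beta> * M - \<beta>\<^sup>2 * E) = g * ((g * M + \<beta> * ?q - \<beta> * c) * (M - b))"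
    by (simp add: algebra_simps)
  then have eq: "g * M\<^sup>2 - 2 * c * \<beta> * M - \<beta>\<^sup>2 * E = (g * M + \<beta> * ?q - \<beta> * c) * (M - b)"
    using g by simp
  have k: "0 < g * M + \<beta> * ?q - \<beta> * c" using pos by simp
  show "M < b \<longleftrightarrow> g * M\<^sup>2 - 2 * c * \<beta> * M - \<beta>\<^sup>2 * E < 0"
    "b < M \<longleftrightarrow> 0 < g * M\<^sup>2 - 2 * c * \<beta> * M - \<beta>\<^sup>2 * E"
    "M = b \<longleftrightarrow> g * M\<^sup>2 - 2 * c * \<beta> * M - \<beta>\<^sup>2 * E = 0"
    unfolding eq pos_mult_diff_iff[OF k] by auto
qed

text \<open>A negative value puts M between the roots, so its position relative to the smaller root
  need not be known beforehand. This matters for (C) with l < 2.\<close>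

lemma quadratic_root_less:
  fixes b c g E M \<beta> :: real
  assumes g: "0 < g" and \<beta>: "0 < \<beta>" and E: "0 \<le> c\<^sup>2 + g * E"
    and b: "b = \<beta> / g * (c + sqrt (c\<^sup>2 + g * E))"
    and neg: "g * M\<^sup>2 - 2 * c * \<beta> * M - \<beta>\<^sup>2 * E < 0"
  shows "M < b"
proof (cases "\<beta> * c < g * M + \<beta> * sqrt (c\<^sup>2 + g * E)")
  case True
  then show ?thesis using quadratic_root_compare(1)[OF g E b True] neg by simp
next
  case False
  have "g * b = \<beta> * c + \<beta> * sqrt (c\<^sup>2 + g * E)" using g unfolding b by (simp add: algebra_simps)
  moreover have "0 \<le> \<beta> * sqrt (c\<^sup>2 + g * E)" using \<beta> E by simp
  moreover have "M \<noteq> b"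
  proof
    assume "M = b"
    then have gM: "g * M = \<beta> * c + \<beta> * sqrt (c\<^sup>2 + g * E)" using \<open>g * b = _\<close> by simp
    have "g * (g * M\<^sup>2 - 2 * c * \<beta> * M - \<beta>\<^sup>2 * E) = (g * M - \<beta> * c)\<^sup>2 - \<beta>\<^sup>2 * (sqrt (c\<^sup>2 + g * E))\<^sup>2"
      using E by (simp add: algebra_simps power2_eq_square)
    also have "\<dots> = 0" unfolding gM by (simp add: power_mult_distrib)
    finally show False using neg g by simp
  qed
  ultimately have "g * M \<le> g * b" using False by linarith
  then show ?thesis using g \<open>M \<noteq> b\<close> by simp
qed

text \<open>The condition \<open>nd\<close> describes the range in which the mode is a positive
  critical point; for \<delta> = 0 and 0 < l \<le> 1 the mode is 0.\<close>

locale gh_mode_parameters = gh_parameters +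
  assumes nd: "0 < \<delta> \<or> 1/2 < \<nu>"
begin

abbreviation "M \<equiv> gh_mode (\<nu> + 1/2) \<alpha> \<beta> \<delta>"
abbreviation "\<gamma> \<equiv> gh_gamma \<alpha> \<beta>"
abbreviation "y \<equiv> \<alpha> * s M"

lemma M_pos: "0 < M" by (rule gh_mode_slope(1)[OF nd])

lemma y_pos: "0 < y" using \<alpha> M_pos s_pos[of M] by simp

lemma R_M: "bessel_R \<nu> y = \<beta> * s M / (\<alpha> * M)"
  using gh_mode_slope(2)[OF nd] unfolding slope_neg_iff(3)[OF M_pos] .

lemma quadratic_mode:
  "\<gamma>\<^sup>2 * M\<^sup>2 - 2 * c * \<beta> * M - \<beta>\<^sup>2 * \<delta>\<^sup>2
    = - (\<alpha>\<^sup>2 * M\<^sup>2) * ((bessel_R \<nu> y)\<^sup>2 + 2 * c * bessel_R \<nu> y / y - 1)"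
proof -
  have Q: "(bessel_R \<nu> y)\<^sup>2 + 2 * c * bessel_R \<nu> y / y - 1 = - (\<gamma>\<^sup>2 * M\<^sup>2 - 2 * c * \<beta> * M - \<delta>\<^sup>2 * \<beta>\<^sup>2) / (\<alpha>\<^sup>2 * M\<^sup>2)"
    using quadratic_at_slope[OF M_pos, of c] unfolding times_divide_eq_left[of "2 * c", symmetric] R_M .
  have N: "P = - N * (- P / N)" if "0 < N" for N P :: real
    using that by simp
  show ?thesis unfolding Q mult.commute[of "\<beta>\<^sup>2" "\<delta>\<^sup>2"] by (rule N) (use \<alpha> M_pos in simp)
qed

lemma bound_compare:
  shows "M < gh_bound a (\<nu> + 1/2) \<alpha> \<beta> \<delta> \<longleftrightarrow> 0 < (bessel_R \<nu> y)\<^sup>2 + 2 * (\<nu> + 1/2 - a) * bessel_R \<nu> y / y - 1"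
    and "gh_bound a (\<nu> + 1/2) \<alpha> \<beta> \<delta> < M \<longleftrightarrow> (bessel_R \<nu> y)\<^sup>2 + 2 * (\<nu> + 1/2 - a) * bessel_R \<nu> y / y - 1 < 0"
    and "M = gh_bound a (\<nu> + 1/2) \<alpha> \<beta> \<delta> \<longleftrightarrow> (bessel_R \<nu> y)\<^sup>2 + 2 * (\<nu> + 1/2 - a) * bessel_R \<nu> y / y - 1 = 0"
proof -
  define c where "c = \<nu> + 1/2 - a"
  have g: "0 < \<gamma>\<^sup>2" using gamma_sq(2) by simp
  have E: "0 \<le> c\<^sup>2 + \<gamma>\<^sup>2 * \<delta>\<^sup>2" by simp
  have b: "gh_bound a (\<nu> + 1/2) \<alpha> \<beta> \<delta> = \<beta> / \<gamma>\<^sup>2 * (c + sqrt (c\<^sup>2 + \<gamma>\<^sup>2 * \<delta>\<^sup>2))"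
    unfolding gh_bound_def c_def by (simp add: mult.commute)
  \<comment> \<open>Makes the smaller root nonpositive, whereas M is positive.\<close>
  have "\<bar>c\<bar> \<le> sqrt (c\<^sup>2 + \<gamma>\<^sup>2 * \<delta>\<^sup>2)" by (rule real_le_rsqrt) simp
  then have "\<beta> * c \<le> \<beta> * sqrt (c\<^sup>2 + \<gamma>\<^sup>2 * \<delta>\<^sup>2)" using \<beta> by (intro mult_left_mono) auto
  moreover have "0 < \<gamma>\<^sup>2 * M" using g M_pos by simp
  ultimately have pos: "\<beta> * c < \<gamma>\<^sup>2 * M + \<beta> * sqrt (c\<^sup>2 + \<gamma>\<^sup>2 * \<delta>\<^sup>2)" by linarith
  have N: "0 < \<alpha>\<^sup>2 * M\<^sup>2" using \<alpha> M_pos by simp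
  have sgn: "- N * q < 0 \<longleftrightarrow> 0 < q" "0 < - N * q \<longleftrightarrow> q < 0" "- N * q = 0 \<longleftrightarrow> q = 0" if "0 < N" for N q :: real
    using that by (auto simp: zero_less_mult_iff mult_less_0_iff)
  show "M < gh_bound a (\<nu> + 1/2) \<alpha> \<beta> \<delta> \<longleftrightarrow> 0 < (bessel_R \<nu> y)\<^sup>2 + 2 * (\<nu> + 1/2 - a) * bessel_R \<nu> y / y - 1"
    "gh_bound a (\<nu> + 1/2) \<alpha> \<beta> \<delta> < M \<longleftrightarrow> (bessel_R \<nu> y)\<^sup>2 + 2 * (\<nu> + 1/2 - a) * bessel_R \<nu> y / y - 1 < 0"
    "M = gh_bound a (\<nu> + 1/2) \<alpha> \<beta> \<delta> \<longleftrightarrow> (bessel_R \<nu> y)\<^sup>2 + 2 * (\<nu> + 1/2 - a) * bessel_R \<nu> y / y - 1 = 0"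
    unfolding quadratic_root_compare[OF g E b pos] quadratic_mode c_def[symmetric]
    by (rule sgn[OF N])+
qed

lemma lower_bound_A: "gh_bound (3/2) (\<nu> + 1/2) \<alpha> \<beta> \<delta> < M"
  unfolding bound_compare(2) using bessel_R_turan_lower[OF y_pos, of \<nu>] by simp

lemma upper_bound_A: "M < gh_bound (1/2) (\<nu> + 1/2) \<alpha> \<beta> \<delta>"
  unfolding bound_compare(1) using bessel_R_turan_upper[OF y_pos, of \<nu>] by simp

lemma riccati_B: "(bessel_R \<nu> y)\<^sup>2 + 2 * (\<nu> + 1/2 - 1) * bessel_R \<nu> y / y - 1
   = (bessel_R \<nu> y)\<^sup>2 + (2 * \<nu> - 1) * bessel_R \<nu> y / y - 1"
proof -
  have "2 * (\<nu> + 1/2 - 1) = 2 * \<nu> - 1" by simp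
  then show ?thesis by metis
qed

lemma bound_B:
  shows "1/2 < \<nu> \<Longrightarrow> M < gh_bound 1 (\<nu> + 1/2) \<alpha> \<beta> \<delta>"
    and "\<nu> = 1/2 \<Longrightarrow> M = gh_bound 1 (\<nu> + 1/2) \<alpha> \<beta> \<delta>"
    and "\<nu> < 1/2 \<Longrightarrow> gh_bound 1 (\<nu> + 1/2) \<alpha> \<beta> \<delta> < M"
  unfolding bound_compare riccati_B
  using bessel_R_riccati_pos[OF y_pos, of \<nu>] bessel_R_riccati_neg[OF y_pos, of \<nu>]
    bessel_R_riccati_half[OF y_pos]
  by blast+

text \<open>Origin of the correction in (C): at the mode, shifting the Riccati expression from \<nu>
  to \<nu> - 1 adds \<open>2 * (\<nu> - 1) / y\<^sup>2\<close>. Scaled by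
  \<open>\<beta>\<^sup>2 * (s M)\<^sup>2\<close> this becomes a constant, so the equation stays
  quadratic in M; with l = \<nu> + 1/2 its numerator 2 - 2 \<nu> is 3 - 2 l.\<close>

lemma quadratic_C:
  "\<gamma>\<^sup>2 * M\<^sup>2 - 2 * (\<nu> - 1/2) * \<beta> * M - \<beta>\<^sup>2 * (\<delta>\<^sup>2 + (2 - 2 * \<nu>) / \<alpha>\<^sup>2)
    = \<beta>\<^sup>2 * (s M)\<^sup>2 * ((bessel_R (\<nu> - 1) y)\<^sup>2 + (2 * (\<nu> - 1) - 1) * bessel_R (\<nu> - 1) y / y - 1)"
proof -
  define r where "r = bessel_R \<nu> y"
  have s: "0 < s M" using M_pos s_pos[of M] by simp
  have r: "0 < r" unfolding r_def by (rule bessel_R_pos[OF y_pos])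
  have rM: "\<alpha>\<^sup>2 * M\<^sup>2 * r\<^sup>2 = \<beta>\<^sup>2 * (s M)\<^sup>2"
  proof -
    have "\<alpha> * M * r = \<beta> * s M" unfolding r_def R_M using \<alpha> M_pos by simp
    then have "(\<alpha> * M * r)\<^sup>2 = (\<beta> * s M)\<^sup>2" by (rule arg_cong)
    then show ?thesis unfolding power_mult_distrib .
  qed
  have yy: "\<beta>\<^sup>2 * (s M)\<^sup>2 / y\<^sup>2 = \<beta>\<^sup>2 / \<alpha>\<^sup>2"
    unfolding power_mult_distrib using s \<alpha> by (metis mult_divide_mult_cancel_right power_not_zero less_irrefl)
  define q where "q = r\<^sup>2 + (2 * \<nu> - 1) * r / y - 1"
  have shift: "(bessel_R (\<nu> - 1) y)\<^sup>2 + (2 * (\<nu> - 1) - 1) * bessel_R (\<nu> - 1) y / y - 1 = - q / r\<^sup>2 + 2 * (\<nu> - 1) / y\<^sup>2"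
    using riccati_shift[OF y_pos, of "\<nu> - 1"] unfolding r_def q_def by simp
  have distr: "K * (- q / p + m / Y) = - (K / p) * q + m * (K / Y)" for K p Y m :: real
    by (simp add: algebra_simps)
  have rM': "\<beta>\<^sup>2 * (s M)\<^sup>2 / r\<^sup>2 = \<alpha>\<^sup>2 * M\<^sup>2"
    unfolding rM[symmetric] using r by simp
  have "\<beta>\<^sup>2 * (s M)\<^sup>2 * (- q / r\<^sup>2 + 2 * (\<nu> - 1) / y\<^sup>2) = - (\<alpha>\<^sup>2 * M\<^sup>2) * q + 2 * (\<nu> - 1) * (\<beta>\<^sup>2 / \<alpha>\<^sup>2)"
    unfolding distr yy rM' ..
  also have "- (\<alpha>\<^sup>2 * M\<^sup>2) * q = \<gamma>\<^sup>2 * M\<^sup>2 - 2 * (\<nu> - 1/2) * \<beta> * M - \<beta>\<^sup>2 * \<delta>\<^sup>2"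
    unfolding quadratic_mode q_def r_def by (simp add: algebra_simps)
  finally show ?thesis unfolding shift by (simp add: algebra_simps diff_divide_distrib)
qed

lemma bound_C:
  shows "3/2 < \<nu> \<Longrightarrow> gh_bound_C (\<nu> + 1/2) \<alpha> \<beta> \<delta> < M"
    and "\<nu> = 3/2 \<Longrightarrow> M = gh_bound_C (\<nu> + 1/2) \<alpha> \<beta> \<delta>"
    and "\<nu> < 3/2 \<Longrightarrow> M < gh_bound_C (\<nu> + 1/2) \<alpha> \<beta> \<delta>"
proof -
  define c where "c = \<nu> - 1/2"
  define E where "E = \<delta>\<^sup>2 + (2 - 2 * \<nu>) / \<alpha>\<^sup>2"
  have g: "0 < \<gamma>\<^sup>2" using gamma_sq(2) by simp
  \<comment> \<open>For \<nu> > 1 the bound \<gamma> \<le> \<alpha> leaves a perfect square: the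
    radicand is at least
    \<open>(\<nu> - 3/2)\<^sup>2 + \<gamma>\<^sup>2 * \<delta>\<^sup>2\<close>.\<close>
  have gE: "0 \<le> c\<^sup>2 + \<gamma>\<^sup>2 * E"
  proof (cases "\<nu> \<le> 1")
    case True
    then show ?thesis unfolding E_def by simp
  next
    case False
    have "\<gamma>\<^sup>2 / \<alpha>\<^sup>2 \<le> 1" using gamma_sq(1) \<alpha> by simp
    then have "(2 * \<nu> - 2) * (\<gamma>\<^sup>2 / \<alpha>\<^sup>2) \<le> (2 * \<nu> - 2) * 1"
      using False by (intro mult_left_mono) auto
    moreover have "c\<^sup>2 - (2 * \<nu> - 2) = (\<nu> - 3/2)\<^sup>2" unfolding c_def by (simp add: power2_eq_square algebra_simps)
    moreover have "c\<^sup>2 + \<gamma>\<^sup>2 * E = c\<^sup>2 - (2 * \<nu> - 2) * (\<gamma>\<^sup>2 / \<alpha>\<^sup>2) + \<gamma>\<^sup>2 * \<delta>\<^sup>2"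
      unfolding E_def by (simp add: algebra_simps diff_divide_distrib)
    ultimately show ?thesis by (smt (verit, best) mult_nonneg_nonneg zero_le_power2)
  qed
  have b: "gh_bound_C (\<nu> + 1/2) \<alpha> \<beta> \<delta> = \<beta> / \<gamma>\<^sup>2 * (c + sqrt (c\<^sup>2 + \<gamma>\<^sup>2 * E))"
    unfolding gh_bound_C_def c_def E_def by (simp add: algebra_simps)
  have k: "0 < \<beta>\<^sup>2 * (s M)\<^sup>2" using M_pos s_pos[of M] \<beta> by simp
  note q = quadratic_C[folded c_def E_def]
  \<comment> \<open>The smaller root may be positive here. The lower bound of (A) places M above it,
    since 2 (\<nu> - 1) \<ge> c for \<nu> \<ge> 3/2.\<close>
  have pos: "\<beta> * c < \<gamma>\<^sup>2 * M + \<beta> * sqrt (c\<^sup>2 + \<gamma>\<^sup>2 * E)" if "3/2 \<le> \<nu>"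
  proof -
    have "\<bar>\<nu> - 1\<bar> \<le> sqrt ((\<nu> - 1)\<^sup>2 + \<delta>\<^sup>2 * \<gamma>\<^sup>2)" by (rule real_le_rsqrt) simp
    then have "\<beta> / \<gamma>\<^sup>2 * (2 * (\<nu> - 1)) \<le> gh_bound (3/2) (\<nu> + 1/2) \<alpha> \<beta> \<delta>"
      unfolding gh_bound_def using \<beta> that by (intro mult_left_mono) auto
    then have "\<gamma>\<^sup>2 * (\<beta> / \<gamma>\<^sup>2 * (2 * (\<nu> - 1))) < \<gamma>\<^sup>2 * M"
      using lower_bound_A g by (intro mult_strict_left_mono) auto
    then have "\<beta> * (2 * (\<nu> - 1)) < \<gamma>\<^sup>2 * M" using g by simp
    moreover have "\<beta> * c \<le> \<beta> * (2 * (\<nu> - 1))" using that \<beta> unfolding c_def by (intro mult_left_mono) auto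
    moreover have "0 \<le> \<beta> * sqrt (c\<^sup>2 + \<gamma>\<^sup>2 * E)" using \<beta> gE by simp
    ultimately show ?thesis by linarith
  qed
  show "gh_bound_C (\<nu> + 1/2) \<alpha> \<beta> \<delta> < M" if "3/2 < \<nu>"
    unfolding quadratic_root_compare(2)[OF g gE b pos[OF less_imp_le[OF that]]] q
    using that by (intro mult_pos_pos[OF k] bessel_R_riccati_pos y_pos) simp
  show "M = gh_bound_C (\<nu> + 1/2) \<alpha> \<beta> \<delta>" if "\<nu> = 3/2"
  proof -
    have "3/2 \<le> \<nu>" using that by simp
    moreover have "\<nu> - 1 = 1/2" using that by simp
    ultimately show ?thesis
      unfolding quadratic_root_compare(3)[OF g gE b pos[OF \<open>3/2 \<le> \<nu>\<close>]] q \<open>\<nu> - 1 = 1/2\<close> bessel_R_riccati_half[OF y_pos] by simp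
  qed
  show "M < gh_bound_C (\<nu> + 1/2) \<alpha> \<beta> \<delta>" if "\<nu> < 3/2"
  proof (rule quadratic_root_less[OF g \<beta>(1) gE b])
    show "\<gamma>\<^sup>2 * M\<^sup>2 - 2 * c * \<beta> * M - \<beta>\<^sup>2 * E < 0"
      unfolding q using that by (intro mult_pos_neg[OF k] bessel_R_riccati_neg y_pos) simp
  qed
qed

lemma mode_fixed_point: "M = \<beta> / \<alpha>\<^sup>2 * (y / bessel_R \<nu> y)"
  unfolding R_M using \<alpha> \<beta> M_pos s_pos[of M] by (simp add: field_simps power2_eq_square)

end

section \<open>Limits of the mode\<close>

lemma gh_mode_parametersI:
  assumes "0 < \<beta>" "\<beta> < \<alpha>" "0 \<le> \<delta>" "0 < \<delta> \<or> 1 < l"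
  shows "gh_mode_parameters (l - 1/2) \<alpha> \<beta> \<delta>"
  using assms by unfold_locales auto

context gh_mode_parameters
begin

text \<open>The lower bound of (A) is too weak for the limit 2 \<theta> (l - 1). If R reached the
  threshold at x, monotonicity of the quadratic and the bound 2 \<nu> / y^2 on the derivative of R
  would contradict \<open>le\<close>; so the slope at x is positive.\<close>

lemma less_mode_vg:
  assumes \<delta>0: "\<delta> = 0" and x: "0 < x" and le: "2 * \<nu> \<le> 2 * (\<nu> - 1/2) * \<beta> * x - \<gamma>\<^sup>2 * x\<^sup>2"
  shows "x < M"
proof (rule gh_mode_slope(3)[OF nd x])
  have nu: "1/2 < \<nu>" using nd \<delta>0 by simp
  define r where "r = \<beta> * s x / (\<alpha> * x)"
  have r: "0 < r" using x s_pos[of x] \<alpha> \<beta> unfolding r_def by simp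
  have yx: "\<alpha> * s x = \<alpha> * x" using x \<delta>0 by simp
  have ax: "0 < \<alpha> * x" using \<alpha> x by simp
  show "0 < D x"
    unfolding slope_neg_iff(2)[OF x] r_def[symmetric]
  proof (rule ccontr)
    assume "\<not> R x < r"
    then have rR: "r \<le> R x" by simp
    have "r\<^sup>2 + (2 * \<nu> - 1) * r / (\<alpha> * x) - 1 \<le> (R x)\<^sup>2 + (2 * \<nu> - 1) * R x / (\<alpha> * x) - 1"
      using rR r nu ax by (intro diff_right_mono add_mono power_mono divide_right_mono mult_left_mono) auto
    also have "\<dots> < 2 * \<nu> / (\<alpha> * x)\<^sup>2"
      unfolding yx using bessel_R_riccati_less[OF ax, of \<nu>] nu by simp
    finally have "r\<^sup>2 + 2 * (\<nu> - 1/2) / (\<alpha> * x) * r - 1 < 2 * \<nu> / (\<alpha> * x)\<^sup>2"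
      by simp
    moreover have "r\<^sup>2 + 2 * (\<nu> - 1/2) / (\<alpha> * x) * r - 1 = (2 * (\<nu> - 1/2) * \<beta> * x - \<gamma>\<^sup>2 * x\<^sup>2) / (\<alpha> * x)\<^sup>2"
      using quadratic_at_slope[OF x, of "\<nu> - 1/2"] \<delta>0 unfolding r_def[symmetric] yx
      by (simp add: power_mult_distrib)
    moreover have "2 * \<nu> / (\<alpha> * x)\<^sup>2 \<le> (2 * (\<nu> - 1/2) * \<beta> * x - \<gamma>\<^sup>2 * x\<^sup>2) / (\<alpha> * x)\<^sup>2"
      using le by (rule divide_right_mono) simp
    ultimately show False by linarith
  qed
qed

end

text \<open>Raising the argument of the square root by 1 raises its value by at most 1, so the two
  bounds differ by at most 2 q while the lower one tends to infinity. The filter is left open to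
  serve both limits.\<close>

lemma bound_ratio_tendsto:
  fixes M c k :: "real \<Rightarrow> real" and q :: real
  defines "B \<equiv> \<lambda>x a. q * (c x - a + sqrt ((c x - a)\<^sup>2 + k x))"
  assumes q: "0 < q" and k: "\<And>x. 0 \<le> k x"
    and M: "\<forall>\<^sub>F x in F. B x (3/2) < M x \<and> M x < B x (1/2)"
    and lim: "LIM x F. B x (3/2) :> at_top"
  shows "((\<lambda>x. M x / B x (3/2)) \<longlongrightarrow> 1) F" and "((\<lambda>x. M x / B x (1/2)) \<longlongrightarrow> 1) F"
proof -
  have lip: "sqrt ((u + 1)\<^sup>2 + w) \<le> sqrt (u\<^sup>2 + w) + 1" if w: "0 \<le> w" for u w :: real
  proof (rule real_le_lsqrt)
    have "u \<le> sqrt (u\<^sup>2 + w)" using w by (intro real_le_rsqrt) simp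
    moreover have "(sqrt (u\<^sup>2 + w))\<^sup>2 = u\<^sup>2 + w" using w by simp
    ultimately show "(u + 1)\<^sup>2 + w \<le> (sqrt (u\<^sup>2 + w) + 1)\<^sup>2"
      by (simp add: power2_sum)
  qed (use w in auto)
  have BB: "B x (1/2) \<le> B x (3/2) + 2 * q" for x
  proof -
    have "c x - 1/2 = (c x - 3/2) + 1" by simp
    then have "c x - 1/2 + sqrt ((c x - 1/2)\<^sup>2 + k x) \<le> (c x - 3/2 + sqrt ((c x - 3/2)\<^sup>2 + k x)) + 2"
      using lip[OF k[of x], of "c x - 3/2"] by simp
    then have "q * (c x - 1/2 + sqrt ((c x - 1/2)\<^sup>2 + k x)) \<le> q * ((c x - 3/2 + sqrt ((c x - 3/2)\<^sup>2 + k x)) + 2)"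
      using q by (intro mult_left_mono) auto
    then show ?thesis unfolding B_def by (simp add: algebra_simps)
  qed
  have pos: "\<forall>\<^sub>F x in F. 0 < B x (3/2)"
    using lim by (simp add: filterlim_at_top_dense)
  have "((\<lambda>x. 1 + 2 * q / B x (3/2)) \<longlongrightarrow> 1 + 0) F"
    by (intro tendsto_add tendsto_const tendsto_divide_0[OF tendsto_const] filterlim_at_top_imp_at_infinity lim)
  then have up: "((\<lambda>x. 1 + 2 * q / B x (3/2)) \<longlongrightarrow> 1) F" by simp
  show 1: "((\<lambda>x. M x / B x (3/2)) \<longlongrightarrow> 1) F"
  proof (rule tendsto_sandwich[OF _ _ tendsto_const up])
    show "\<forall>\<^sub>F x in F. 1 \<le> M x / B x (3/2)"
      using M pos by eventually_elim simp
    show "\<forall>\<^sub>F x in F. M x / B x (3/2) \<le> 1 + 2 * q / B x (3/2)"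
      using M pos
    proof eventually_elim
      case (elim x)
      then have "M x / B x (3/2) \<le> (B x (3/2) + 2 * q) / B x (3/2)"
        using BB[of x] by (intro divide_right_mono) auto
      then show ?case using elim by (simp add: add_divide_distrib)
    qed
  qed
  have "((\<lambda>x. B x (1/2) / B x (3/2)) \<longlongrightarrow> 1) F"
  proof (rule tendsto_sandwich[OF _ _ tendsto_const up])
    show "\<forall>\<^sub>F x in F. 1 \<le> B x (1/2) / B x (3/2)"
      using M pos by eventually_elim simp
    show "\<forall>\<^sub>F x in F. B x (1/2) / B x (3/2) \<le> 1 + 2 * q / B x (3/2)"
      using pos
    proof eventually_elim
      case (elim x)
      then have "B x (1/2) / B x (3/2) \<le> (B x (3/2) + 2 * q) / B x (3/2)"
        using BB[of x] by (intro divide_right_mono) auto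
      then show ?case using elim by (simp add: add_divide_distrib)
    qed
  qed
  from tendsto_divide[OF 1 this]
  have "((\<lambda>x. M x / B x (3/2) / (B x (1/2) / B x (3/2))) \<longlongrightarrow> 1) F" by simp
  moreover have "\<forall>\<^sub>F x in F. M x / B x (3/2) / (B x (1/2) / B x (3/2)) = M x / B x (1/2)"
    using pos by eventually_elim simp
  ultimately show "((\<lambda>x. M x / B x (1/2)) \<longlongrightarrow> 1) F" by (rule Lim_transform_eventually)
qed

lemma gh_mode_between:
  assumes "0 < \<beta>" "\<beta> < \<alpha>" "0 \<le> \<delta>" "0 < \<delta> \<or> 1 < l"
  shows "gh_bound (3/2) l \<alpha> \<beta> \<delta> < gh_mode l \<alpha> \<beta> \<delta>" "gh_mode l \<alpha> \<beta> \<delta> < gh_bound (1/2) l \<alpha> \<beta> \<delta>"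
proof -
  interpret gh_mode_parameters "l - 1/2" \<alpha> \<beta> \<delta> by (rule gh_mode_parametersI[OF assms])
  show "gh_bound (3/2) l \<alpha> \<beta> \<delta> < gh_mode l \<alpha> \<beta> \<delta>" "gh_mode l \<alpha> \<beta> \<delta> < gh_bound (1/2) l \<alpha> \<beta> \<delta>"
    using lower_bound_A upper_bound_A by simp_all
qed

lemma gh_mode_ratio_order:
  assumes "0 < \<beta>" "\<beta> < \<alpha>" "0 \<le> \<delta>" and a: "a \<in> {3/2, 1/2}"
  shows "((\<lambda>l. gh_mode l \<alpha> \<beta> \<delta> / gh_bound a l \<alpha> \<beta> \<delta>) \<longlongrightarrow> 1) at_top"
proof -
  interpret gh_parameters 0 \<alpha> \<beta> \<delta> using assms by unfold_locales
  have q: "0 < \<beta> / (gh_gamma \<alpha> \<beta>)\<^sup>2" using gamma_sq(2) \<beta> by simp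
  have "\<forall>\<^sub>F l in at_top. gh_bound (3/2) l \<alpha> \<beta> \<delta> < gh_mode l \<alpha> \<beta> \<delta> \<and> gh_mode l \<alpha> \<beta> \<delta> < gh_bound (1/2) l \<alpha> \<beta> \<delta>"
    using eventually_gt_at_top[of 1] by eventually_elim (use assms in \<open>auto intro: gh_mode_between\<close>)
  moreover have "LIM l at_top. gh_bound (3/2) l \<alpha> \<beta> \<delta> :> at_top"
  proof (rule filterlim_at_top_mono)
    show "LIM l at_top. \<beta> / (gh_gamma \<alpha> \<beta>)\<^sup>2 * (- (3/2) + l) :> at_top"
      by (intro filterlim_tendsto_pos_mult_at_top[OF tendsto_const q] filterlim_tendsto_add_at_top[OF tendsto_const filterlim_ident])
    show "\<forall>\<^sub>F l in at_top. \<beta> / (gh_gamma \<alpha> \<beta>)\<^sup>2 * (- (3/2) + l) \<le> gh_bound (3/2) l \<alpha> \<beta> \<delta>"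
      unfolding gh_bound_def using q by (intro always_eventually allI mult_left_mono) auto
  qed
  ultimately have "((\<lambda>l. gh_mode l \<alpha> \<beta> \<delta> / gh_bound (3/2) l \<alpha> \<beta> \<delta>) \<longlongrightarrow> 1) at_top"
    "((\<lambda>l. gh_mode l \<alpha> \<beta> \<delta> / gh_bound (1/2) l \<alpha> \<beta> \<delta>) \<longlongrightarrow> 1) at_top"
    by (intro bound_ratio_tendsto[OF q, where k="\<lambda>_. \<delta>\<^sup>2 * (gh_gamma \<alpha> \<beta>)\<^sup>2" and c="\<lambda>l. l"
        and M="\<lambda>l. gh_mode l \<alpha> \<beta> \<delta>" and F=at_top, folded gh_bound_def]; simp)+
  then show ?thesis using a by (elim insertE emptyE) (simp_all only:)
qed

lemma gh_mode_ratio_scale: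
  assumes "0 < \<beta>" "\<beta> < \<alpha>" and a: "a \<in> {3/2, 1/2}"
  shows "((\<lambda>\<delta>. gh_mode l \<alpha> \<beta> \<delta> / gh_bound a l \<alpha> \<beta> \<delta>) \<longlongrightarrow> 1) at_top"
proof -
  interpret gh_parameters 0 \<alpha> \<beta> 0 using assms by unfold_locales auto
  let ?g = "gh_gamma \<alpha> \<beta>"
  have q: "0 < \<beta> / ?g\<^sup>2" using gamma_sq(2) \<beta> by simp
  have "\<forall>\<^sub>F \<delta> in at_top. gh_bound (3/2) l \<alpha> \<beta> \<delta> < gh_mode l \<alpha> \<beta> \<delta> \<and> gh_mode l \<alpha> \<beta> \<delta> < gh_bound (1/2) l \<alpha> \<beta> \<delta>"
    using eventually_gt_at_top[of 0] by eventually_elim (use assms in \<open>auto intro: gh_mode_between\<close>)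
  moreover have "LIM \<delta> at_top. gh_bound (3/2) l \<alpha> \<beta> \<delta> :> at_top"
  proof (rule filterlim_at_top_mono)
    show "LIM \<delta> at_top. \<beta> / ?g\<^sup>2 * (l - 3/2 + ?g * \<delta>) :> at_top"
      by (intro filterlim_tendsto_pos_mult_at_top[OF tendsto_const q] filterlim_tendsto_add_at_top[OF tendsto_const]
          filterlim_tendsto_pos_mult_at_top[OF tendsto_const gamma_sq(2)] filterlim_ident)
    show "\<forall>\<^sub>F \<delta> in at_top. \<beta> / ?g\<^sup>2 * (l - 3/2 + ?g * \<delta>) \<le> gh_bound (3/2) l \<alpha> \<beta> \<delta>"
    proof (rule always_eventually, rule allI)
      fix \<delta>
      have "?g * \<delta> \<le> sqrt ((l - 3/2)\<^sup>2 + \<delta>\<^sup>2 * ?g\<^sup>2)"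
        by (rule real_le_rsqrt) (simp add: power_mult_distrib)
      then show "\<beta> / ?g\<^sup>2 * (l - 3/2 + ?g * \<delta>) \<le> gh_bound (3/2) l \<alpha> \<beta> \<delta>"
        unfolding gh_bound_def using q by (intro mult_left_mono) auto
    qed
  qed
  ultimately have "((\<lambda>\<delta>. gh_mode l \<alpha> \<beta> \<delta> / gh_bound (3/2) l \<alpha> \<beta> \<delta>) \<longlongrightarrow> 1) at_top"
    "((\<lambda>\<delta>. gh_mode l \<alpha> \<beta> \<delta> / gh_bound (1/2) l \<alpha> \<beta> \<delta>) \<longlongrightarrow> 1) at_top"
    by (intro bound_ratio_tendsto[OF q, where k="\<lambda>\<delta>. \<delta>\<^sup>2 * ?g\<^sup>2" and c="\<lambda>_. l"
        and M="\<lambda>\<delta>. gh_mode l \<alpha> \<beta> \<delta>" and F=at_top, folded gh_bound_def]; simp)+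
  then show ?thesis using a by (elim insertE emptyE) (simp_all only:)
qed

section \<open>Asymptotics of the mode under the scaling by \<sigma>\<close>

locale gh_scaling =
  fixes \<theta> l \<delta> :: real
  assumes \<theta>: "0 < \<theta>" and \<delta>: "0 \<le> \<delta>" and nd: "0 < \<delta> \<or> 1 < l"
begin

abbreviation "al \<sigma> \<equiv> sqrt (\<theta>\<^sup>2 + \<sigma>\<^sup>2) / \<sigma>\<^sup>2"
abbreviation "be \<sigma> \<equiv> \<theta> / \<sigma>\<^sup>2"
abbreviation "m \<equiv> gh_mode_scaled l \<theta> \<delta>"
abbreviation "S \<sigma> \<equiv> sqrt (\<delta>\<^sup>2 + (m \<sigma>)\<^sup>2)"
abbreviation "y \<sigma> \<equiv> al \<sigma> * S \<sigma>"
abbreviation "\<nu> \<equiv> l - 1/2"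

lemma scaled_parameters:
  assumes "0 < \<sigma>"
  shows "0 < be \<sigma>" "be \<sigma> < al \<sigma>"
proof -
  have "\<theta> < sqrt (\<theta>\<^sup>2 + \<sigma>\<^sup>2)" using \<theta> assms by (intro real_less_rsqrt) auto
  then show "0 < be \<sigma>" "be \<sigma> < al \<sigma>" using \<theta> assms by (auto intro!: divide_strict_right_mono)
qed

lemma mode_parameters: "0 < \<sigma> \<Longrightarrow> gh_mode_parameters \<nu> (al \<sigma>) (be \<sigma>) \<delta>"
  using scaled_parameters \<delta> nd by (intro gh_mode_parametersI)

lemma gamma_scaled:
  assumes "0 < \<sigma>"
  shows "gh_gamma (al \<sigma>) (be \<sigma>) = 1 / \<sigma>"
proof -
  have "(al \<sigma>)\<^sup>2 - (be \<sigma>)\<^sup>2 = (1 / \<sigma>)\<^sup>2"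
    using assms by (simp add: power_divide field_simps)
  then show ?thesis unfolding gh_gamma_def using assms by (simp only: real_sqrt_abs) simp
qed

lemma bound_scaled:
  assumes "0 < \<sigma>"
  shows "gh_bound a l (al \<sigma>) (be \<sigma>) \<delta> = \<theta> * (l - a + sqrt ((l - a)\<^sup>2 + \<delta>\<^sup>2 / \<sigma>\<^sup>2))"
  unfolding gh_bound_def gamma_scaled[OF assms] using assms by (simp add: power_divide)

lemma m_pos: "0 < \<sigma> \<Longrightarrow> 0 < m \<sigma>"
  using gh_mode_parameters.M_pos[OF mode_parameters, of \<sigma>] unfolding gh_mode_scaled_def by simp

lemma y_pos: "0 < \<sigma> \<Longrightarrow> 0 < y \<sigma>"
  using gh_mode_parameters.y_pos[OF mode_parameters, of \<sigma>] unfolding gh_mode_scaled_def by simp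

lemma m_fixed_point:
  assumes "0 < \<sigma>"
  shows "m \<sigma> = \<theta> * \<sigma>\<^sup>2 / (\<theta>\<^sup>2 + \<sigma>\<^sup>2) * (y \<sigma> / bessel_R \<nu> (y \<sigma>))"
proof -
  have "be \<sigma> / (al \<sigma>)\<^sup>2 = \<theta> * \<sigma>\<^sup>2 / (\<theta>\<^sup>2 + \<sigma>\<^sup>2)"
    using assms by (simp add: power_divide power2_eq_square)
  then show ?thesis
    using gh_mode_parameters.mode_fixed_point[OF mode_parameters[OF assms]] unfolding gh_mode_scaled_def by simp
qed

text \<open>A bound uniform in \<sigma> \<ge> 1. Since \<alpha> tends to 0, it forces y to tend to
  0, so that only the behaviour of R at the origin matters.\<close>

lemma m_less:
  assumes "1 \<le> \<sigma>"
  shows "m \<sigma> < \<theta> * (l - 1/2 + sqrt ((l - 1/2)\<^sup>2 + \<delta>\<^sup>2))"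
proof -
  have s: "0 < \<sigma>" using assms by simp
  have "m \<sigma> < \<theta> * (l - 1/2 + sqrt ((l - 1/2)\<^sup>2 + \<delta>\<^sup>2 / \<sigma>\<^sup>2))"
    using gh_mode_between(2)[OF scaled_parameters[OF s] \<delta> nd] unfolding bound_scaled[OF s] gh_mode_scaled_def .
  also have "\<dots> \<le> \<theta> * (l - 1/2 + sqrt ((l - 1/2)\<^sup>2 + \<delta>\<^sup>2))"
  proof -
    have "1 \<le> \<sigma>\<^sup>2" using assms by (rule one_le_power)
    then have "\<delta>\<^sup>2 / \<sigma>\<^sup>2 \<le> \<delta>\<^sup>2" using s by (simp add: divide_le_eq mult_le_cancel_left1)
    then show ?thesis using \<theta> by (intro mult_left_mono add_left_mono real_sqrt_le_mono) auto
  qed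
  finally show ?thesis .
qed

lemma al_tendsto_0: "(al \<longlongrightarrow> 0) at_top"
  by real_asymp

lemma factor_tendsto: "((\<lambda>\<sigma>. \<theta> * \<sigma>\<^sup>2 / (\<theta>\<^sup>2 + \<sigma>\<^sup>2)) \<longlongrightarrow> \<theta>) at_top"
  by real_asymp

lemma y_at_0: "filterlim y (at_right 0) at_top"
proof (rule filterlim_at_withinI)
  define C where "C = \<theta> * (l - 1/2 + sqrt ((l - 1/2)\<^sup>2 + \<delta>\<^sup>2))"
  have "((\<lambda>\<sigma>. al \<sigma> * (\<delta> + C)) \<longlongrightarrow> 0 * (\<delta> + C)) at_top"
    by (intro tendsto_mult al_tendsto_0 tendsto_const)
  then have lim: "((\<lambda>\<sigma>. al \<sigma> * (\<delta> + C)) \<longlongrightarrow> 0) at_top" by simp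
  have le: "S \<sigma> \<le> \<delta> + C" if "1 \<le> \<sigma>" for \<sigma>
  proof -
    have "0 < m \<sigma>" "m \<sigma> < C" using m_pos[of \<sigma>] m_less[OF that] that by (auto simp: C_def)
    moreover from this have "S \<sigma> \<le> \<delta> + m \<sigma>" using \<delta> by (intro sqrt_sum_squares_le_sum) auto
    ultimately show ?thesis by simp
  qed
  show "(y \<longlongrightarrow> 0) at_top"
  proof (rule Lim_null_comparison[OF _ lim])
    show "\<forall>\<^sub>F \<sigma> in at_top. norm (y \<sigma>) \<le> al \<sigma> * (\<delta> + C)"
      using eventually_ge_at_top[of 1]
    proof eventually_elim
      case (elim \<sigma>)
      then have "norm (y \<sigma>) = y \<sigma>" using y_pos[of \<sigma>] by simp
      also have "\<dots> \<le> al \<sigma> * (\<delta> + C)" using le[OF elim] by (intro mult_left_mono) auto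
      finally show ?case .
    qed
  qed
  show "\<forall>\<^sub>F \<sigma> in at_top. y \<sigma> \<in> {0<..} - {0}"
    using eventually_gt_at_top[of 0] by eventually_elim (use y_pos in force)
qed

lemma m_tendsto:
  assumes "((\<lambda>u. u / bessel_R \<nu> u) \<longlongrightarrow> L) (at_right 0)"
  shows "(m \<longlongrightarrow> \<theta> * L) at_top"
proof (rule Lim_transform_eventually)
  show "((\<lambda>\<sigma>. \<theta> * \<sigma>\<^sup>2 / (\<theta>\<^sup>2 + \<sigma>\<^sup>2) * (y \<sigma> / bessel_R \<nu> (y \<sigma>))) \<longlongrightarrow> \<theta> * L) at_top"
    by (intro tendsto_mult factor_tendsto filterlim_compose[OF assms y_at_0])
  show "\<forall>\<^sub>F \<sigma> in at_top. \<theta> * \<sigma>\<^sup>2 / (\<theta>\<^sup>2 + \<sigma>\<^sup>2) * (y \<sigma> / bessel_R \<nu> (y \<sigma>)) = m \<sigma>"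
    using eventually_gt_at_top[of 0] by eventually_elim (simp only: m_fixed_point[symmetric])
qed

text \<open>The recurrence at order \<nu> - 1 reads u / R_\<nu> = 2 (\<nu> - 1) + u R_(\<nu>-1), and
  the last term vanishes at the origin as \<nu> > 1.\<close>

lemma mode_asymp_large:
  assumes l: "3/2 < l"
  shows "(m \<longlongrightarrow> \<theta> * (2 * l - 3)) at_top"
proof (rule m_tendsto, rule Lim_transform_eventually)
  have "((\<lambda>u. 2 * (\<nu> - 1) + u * bessel_R (\<nu> - 1) u) \<longlongrightarrow> 2 * (\<nu> - 1) + 0) (at_right 0)"
    using l by (intro tendsto_add tendsto_const bessel_R_mult_null_0) simp
  then show "((\<lambda>u. 2 * (\<nu> - 1) + u * bessel_R (\<nu> - 1) u) \<longlongrightarrow> 2 * l - 3) (at_right 0)"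
    by simp
  show "\<forall>\<^sub>F u in at_right 0. 2 * (\<nu> - 1) + u * bessel_R (\<nu> - 1) u = u / bessel_R \<nu> u"
    using eventually_at_right_less[of 0]
  proof eventually_elim
    case (elim u)
    then show ?case using bessel_R_recurrence[OF elim, of "\<nu> - 1"] by (simp add: field_simps)
  qed
qed

lemma S_tendsto:
  assumes "0 < \<delta>" "(m \<longlongrightarrow> 0) at_top"
  shows "(S \<longlongrightarrow> \<delta>) at_top" "((\<lambda>\<sigma>. y \<sigma> * \<sigma>) \<longlongrightarrow> \<delta>) at_top"
proof -
  have "(S \<longlongrightarrow> sqrt (\<delta>\<^sup>2 + 0\<^sup>2)) at_top"
    by (intro tendsto_intros assms)
  then show S: "(S \<longlongrightarrow> \<delta>) at_top" using \<delta> by simp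
  have "((\<lambda>\<sigma>. al \<sigma> * \<sigma>) \<longlongrightarrow> 1) at_top" by real_asymp
  from tendsto_mult[OF this S] show "((\<lambda>\<sigma>. y \<sigma> * \<sigma>) \<longlongrightarrow> \<delta>) at_top"
    by (simp add: mult_ac)
qed

text \<open>A bootstrap: if u / R behaves like L u^p, the fixed point equation first gives m
  \<rightarrow> 0. Then S tends to \<delta>, y behaves like \<delta>/\<sigma>, and a second use of
  the equation gives the rate.\<close>

lemma mode_asymp_power:
  assumes d: "0 < \<delta>" and p: "0 < p" and L: "L \<noteq> 0"
    and lim: "((\<lambda>u. u / bessel_R \<nu> u / u powr p) \<longlongrightarrow> L) (at_right 0)"
  shows "m \<sim>[at_top] (\<lambda>\<sigma>. L * (\<theta> * \<delta> powr p / \<sigma> powr p))"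
proof (rule asymp_equivI')
  have "((\<lambda>u. u / bessel_R \<nu> u / u powr p * u powr p) \<longlongrightarrow> L * 0) (at_right 0)"
    by (intro tendsto_mult lim tendsto_powr_at_right_0 p)
  then have "((\<lambda>u. u / bessel_R \<nu> u / u powr p * u powr p) \<longlongrightarrow> 0) (at_right 0)" by simp
  moreover have "\<forall>\<^sub>F u in at_right 0. u / bessel_R \<nu> u / u powr p * u powr p = u / bessel_R \<nu> u"
    using eventually_at_right_less[of 0] by eventually_elim simp
  ultimately have "((\<lambda>u. u / bessel_R \<nu> u) \<longlongrightarrow> 0) (at_right 0)" by (rule Lim_transform_eventually)
  from m_tendsto[OF this] have "(m \<longlongrightarrow> 0) at_top" by simp
  note S = S_tendsto[OF d this]
  have "((\<lambda>\<sigma>. \<theta> * \<sigma>\<^sup>2 / (\<theta>\<^sup>2 + \<sigma>\<^sup>2) * (y \<sigma> / bessel_R \<nu> (y \<sigma>) / y \<sigma> powr p) * (y \<sigma> * \<sigma>) powr p / (L * (\<theta> * \<delta> powr p)))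
     \<longlongrightarrow> \<theta> * L * \<delta> powr p / (L * (\<theta> * \<delta> powr p))) at_top"
    using d L \<theta> by (intro tendsto_divide tendsto_mult[OF tendsto_mult] factor_tendsto filterlim_compose[OF lim y_at_0]
      tendsto_powr S tendsto_const) auto
  then have "((\<lambda>\<sigma>. \<theta> * \<sigma>\<^sup>2 / (\<theta>\<^sup>2 + \<sigma>\<^sup>2) * (y \<sigma> / bessel_R \<nu> (y \<sigma>) / y \<sigma> powr p) * (y \<sigma> * \<sigma>) powr p / (L * (\<theta> * \<delta> powr p)))
     \<longlongrightarrow> 1) at_top"
    using d L \<theta> by simp
  moreover have "\<forall>\<^sub>F \<sigma> in at_top. \<theta> * \<sigma>\<^sup>2 / (\<theta>\<^sup>2 + \<sigma>\<^sup>2) * (y \<sigma> / bessel_R \<nu> (y \<sigma>) / y \<sigma> powr p) * (y \<sigma> * \<sigma>) powr p / (L * (\<theta> * \<delta> powr p))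
     = m \<sigma> / (L * (\<theta> * \<delta> powr p / \<sigma> powr p))"
    using eventually_gt_at_top[of 0]
  proof eventually_elim
    case (elim \<sigma>)
    have y: "0 < y \<sigma>" using y_pos[OF elim] .
    have gen: "A * (Y / B / Y powr p) * (Y * \<sigma>) powr p / (L * T) = A * (Y / B) / (L * (T / \<sigma> powr p))"
      if "0 < Y" for A B Y T
      using that elim L by (simp add: powr_mult)
    show ?case unfolding gen[OF y] m_fixed_point[OF elim, symmetric] ..
  qed
  ultimately show "((\<lambda>\<sigma>. m \<sigma> / (L * (\<theta> * \<delta> powr p / \<sigma> powr p))) \<longlongrightarrow> 1) at_top"
    by (rule Lim_transform_eventually)
qed

text \<open>Here 0 < \<nu> < 1, so \<nu> and 1 - \<nu> are both positive and the gamma asymptotics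
  applies to numerator and denominator; the exponent is 2 - 2 \<nu> = 3 - 2 l.\<close>

lemma mode_asymp_middle:
  assumes d: "0 < \<delta>" and l: "1/2 < l" "l < 3/2"
  shows "m \<sim>[at_top] (\<lambda>\<sigma>. 2 powr (2 * l - 2) * Gamma (l - 1/2) / Gamma (3/2 - l) * (\<theta> * \<delta> powr (3 - 2 * l) / \<sigma> powr (3 - 2 * l)))"
proof (rule mode_asymp_power[OF d])
  have G: "0 < Gamma (l - 1/2)" "0 < Gamma (3/2 - l)"
    using l by (auto intro!: Gamma_real_pos)
  show "2 powr (2 * l - 2) * Gamma (l - 1/2) / Gamma (3/2 - l) \<noteq> 0" using G by simp
  show "0 < 3 - 2 * l" using l by simp
  have "1 - \<nu> = 3/2 - l" by simp
  have "0 < Gamma (1 - \<nu>)" using l by (intro Gamma_real_pos) simp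
  then have nz: "2 powr ((1 - \<nu>) - 1) * Gamma (1 - \<nu>) \<noteq> 0" by simp
  have lim: "((\<lambda>u. u powr \<nu> * bessel_K \<nu> u / (u powr (1 - \<nu>) * bessel_K (1 - \<nu>) u))
     \<longlongrightarrow> 2 powr (\<nu> - 1) * Gamma \<nu> / (2 powr ((1 - \<nu>) - 1) * Gamma (1 - \<nu>))) (at_right 0)"
    by (rule tendsto_divide[OF bessel_K_asymp_0 bessel_K_asymp_0 nz]) (use l in auto)
  have eq: "2 powr (\<nu> - 1) * Gamma \<nu> / (2 powr ((1 - \<nu>) - 1) * Gamma (1 - \<nu>)) =
     2 powr (2 * l - 2) * Gamma (l - 1/2) / Gamma (3/2 - l)"
  proof -
    have "2 powr (\<nu> - 1) = 2 powr (2 * l - 2) * 2 powr ((1 - \<nu>) - 1)"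
      by (simp flip: powr_add)
    then show ?thesis using \<open>1 - \<nu> = 3/2 - l\<close> by simp
  qed
  have ev: "\<forall>\<^sub>F u in at_right 0. u powr \<nu> * bessel_K \<nu> u / (u powr (1 - \<nu>) * bessel_K (1 - \<nu>) u)
    = u / bessel_R \<nu> u / u powr (3 - 2 * l)"
    using eventually_at_right_less[of 0]
  proof eventually_elim
    case (elim u)
    have K: "bessel_K (\<nu> - 1) u = bessel_K (1 - \<nu>) u" using bessel_K_minus[of "1 - \<nu>" u] by simp
    have "u powr \<nu> / u powr (1 - \<nu>) = u / u powr (3 - 2 * l)"
    proof -
      have "u powr \<nu> * u powr (3 - 2 * l) = u powr (1 + (1 - \<nu>))"
        by (simp flip: powr_add)
      also have "\<dots> = u powr 1 * u powr (1 - \<nu>)" by (rule powr_add)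
      finally have "u powr \<nu> * u powr (3 - 2 * l) = u powr 1 * u powr (1 - \<nu>)" .
      then show ?thesis using elim by (simp add: field_simps)
    qed
    then have "u powr \<nu> / u powr (1 - \<nu>) * (bessel_K \<nu> u / bessel_K (1 - \<nu>) u) = u / u powr (3 - 2 * l) * (bessel_K \<nu> u / bessel_K (1 - \<nu>) u)"
      by (rule arg_cong)
    then show ?case unfolding bessel_R_def K by (simp add: mult_ac)
  qed
  show "((\<lambda>u. u / bessel_R \<nu> u / u powr (3 - 2 * l)) \<longlongrightarrow> 2 powr (2 * l - 2) * Gamma (l - 1/2) / Gamma (3/2 - l)) (at_right 0)"
    using Lim_transform_eventually[OF lim ev] unfolding eq .
qed

text \<open>For \<nu> < 0, reflection followed by the recurrence gives R_\<nu> = R_(-\<nu>) - 2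
  \<nu> / u; the singular term dominates, and -2 \<nu> = 1 - 2 l.\<close>

lemma mode_asymp_small:
  assumes d: "0 < \<delta>" and l: "l < 1/2"
  shows "m \<sim>[at_top] (\<lambda>\<sigma>. \<theta> * \<delta>\<^sup>2 / ((1 - 2 * l) * \<sigma>\<^sup>2))"
proof -
  have A: "m \<sim>[at_top] (\<lambda>\<sigma>. 1 / (1 - 2 * l) * (\<theta> * \<delta> powr 2 / \<sigma> powr 2))"
  proof (rule mode_asymp_power[OF d])
    have "((\<lambda>u. 1 / (u * bessel_R (- \<nu>) u + 2 * (- \<nu>))) \<longlongrightarrow> 1 / (0 + 2 * (- \<nu>))) (at_right 0)"
      using l by (intro tendsto_intros bessel_R_mult_null_0) auto
    then have lim: "((\<lambda>u. 1 / (u * bessel_R (- \<nu>) u + 2 * (- \<nu>))) \<longlongrightarrow> 1 / (1 - 2 * l)) (at_right 0)"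
      by simp
    have ev: "\<forall>\<^sub>F u in at_right 0. 1 / (u * bessel_R (- \<nu>) u + 2 * (- \<nu>)) = u / bessel_R \<nu> u / u powr 2"
      using eventually_at_right_less[of 0]
    proof eventually_elim
      case (elim u)
      have "1 / bessel_R \<nu> u = 1 / (bessel_R (- \<nu>) u + 2 * (- \<nu>) / u)"
        using bessel_R_recurrence[OF elim, of "- \<nu>"] bessel_R_reflect[of \<nu> u] by simp
      moreover have "u / B / u powr 2 = 1 / u * (1 / B)" for B
        using elim by (simp add: power2_eq_square)
      moreover have "1 / u * (1 / (B + w / u)) = 1 / (u * B + w)" for B w
        using elim by (simp add: distrib_left)
      ultimately show ?case by simp
    qed
    show "((\<lambda>u. u / bessel_R \<nu> u / u powr 2) \<longlongrightarrow> 1 / (1 - 2 * l)) (at_right 0)"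
      by (rule Lim_transform_eventually[OF lim ev])
  qed (use l in auto)
  have ev: "\<forall>\<^sub>F \<sigma> in at_top. 1 / (1 - 2 * l) * (\<theta> * \<delta> powr 2 / \<sigma> powr 2) = \<theta> * \<delta>\<^sup>2 / ((1 - 2 * l) * \<sigma>\<^sup>2)"
    using eventually_gt_at_top[of 0] by eventually_elim (use d in simp)
  show ?thesis by (rule asymp_equiv_cong[THEN iffD1, OF _ ev A]) simp
qed

end

context gh_scaling
begin

text \<open>At \<nu> = 1 the denominator \<open>bessel_K 0\<close> is logarithmic, so the fixed
  point equation gives m (-ln y) \<rightarrow> \<theta>. In ln y = ln \<alpha> + ln S the second
  term is negligible after multiplication by m, even for \<delta> = 0 where S = m, and -ln \<alpha>
  behaves like ln \<sigma>.\<close>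

lemma mode_asymp_critical:
  assumes l: "l = 3/2"
  shows "m \<sim>[at_top] (\<lambda>\<sigma>. \<theta> / ln \<sigma>)"
proof -
  have nu: "\<nu> = 1" using l by simp
  have uK: "((\<lambda>u. u * bessel_K 1 u) \<longlongrightarrow> 1) (at_right 0)"
  proof (rule Lim_transform_eventually)
    show "((\<lambda>u. u powr 1 * bessel_K 1 u) \<longlongrightarrow> 1) (at_right 0)"
      using bessel_K_asymp_0[of 1] by simp
    show "\<forall>\<^sub>F u in at_right 0. u powr 1 * bessel_K 1 u = u * bessel_K 1 u"
      using eventually_at_right_less[of 0] by eventually_elim simp
  qed
  have quot: "u / bessel_R \<nu> u = u * bessel_K 1 u / bessel_K 0 u" for u
    unfolding nu bessel_R_def by simp
  have "((\<lambda>u. u / bessel_R \<nu> u) \<longlongrightarrow> 0) (at_right 0)"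
    unfolding quot
    by (intro tendsto_divide_0[OF uK] filterlim_at_top_imp_at_infinity bessel_K_0_at_top)
  from m_tendsto[OF this] have m0: "(m \<longlongrightarrow> 0) at_top" by simp
  have lim1: "((\<lambda>\<sigma>. \<theta> * \<sigma>\<^sup>2 / (\<theta>\<^sup>2 + \<sigma>\<^sup>2) * (y \<sigma> * bessel_K 1 (y \<sigma>)) / (bessel_K 0 (y \<sigma>) / (- ln (y \<sigma>))))
    \<longlongrightarrow> \<theta> * 1 / 1) at_top"
    by (intro tendsto_divide[OF tendsto_mult[OF factor_tendsto filterlim_compose[OF uK y_at_0]]
      filterlim_compose[OF bessel_K_0_asymp_0 y_at_0]]) simp
  have "\<forall>\<^sub>F \<sigma> in at_top. \<theta> * \<sigma>\<^sup>2 / (\<theta>\<^sup>2 + \<sigma>\<^sup>2) * (y \<sigma> * bessel_K 1 (y \<sigma>)) / (bessel_K 0 (y \<sigma>) / (- ln (y \<sigma>)))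
      = m \<sigma> * (- ln (y \<sigma>))"
    using eventually_gt_at_top[of 0]
  proof eventually_elim
    case (elim \<sigma>)
    have gen: "A * B / (C / D) = A * (B / C) * D" for A B C D :: real by simp
    show ?case unfolding gen quot[symmetric] m_fixed_point[OF elim, symmetric] ..
  qed
  from Lim_transform_eventually[OF lim1 this]
  have mlny: "((\<lambda>\<sigma>. m \<sigma> * (- ln (y \<sigma>))) \<longlongrightarrow> \<theta>) at_top"
    unfolding mult_1_right div_by_1 .
  have mlnS: "((\<lambda>\<sigma>. m \<sigma> * ln (S \<sigma>)) \<longlongrightarrow> 0) at_top"
  proof (cases "0 < \<delta>")
    case True
    have "((\<lambda>\<sigma>. m \<sigma> * ln (S \<sigma>)) \<longlongrightarrow> 0 * ln \<delta>) at_top"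
      using True by (intro tendsto_mult m0 tendsto_ln S_tendsto(1)) auto
    then show ?thesis by simp
  next
    case False
    then have d: "\<delta> = 0" using \<delta> by simp
    have "filterlim m (at_right 0) at_top"
    proof (rule filterlim_at_withinI[OF m0])
      show "\<forall>\<^sub>F \<sigma> in at_top. m \<sigma> \<in> {0<..} - {0}"
        using eventually_gt_at_top[of 0] by eventually_elim (use m_pos in force)
    qed
    moreover have "((\<lambda>t::real. t * ln t) \<longlongrightarrow> 0) (at_right 0)" by real_asymp
    ultimately have lim: "((\<lambda>\<sigma>. m \<sigma> * ln (m \<sigma>)) \<longlongrightarrow> 0) at_top"
      by (rule filterlim_compose[rotated])
    have "\<forall>\<^sub>F \<sigma> in at_top. m \<sigma> * ln (m \<sigma>) = m \<sigma> * ln (S \<sigma>)"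
      using eventually_gt_at_top[of 0]
    proof eventually_elim
      case (elim \<sigma>)
      have "S \<sigma> = m \<sigma>" using m_pos[OF elim] d by simp
      then show ?case by simp
    qed
    then show ?thesis by (rule Lim_transform_eventually[OF lim])
  qed
  have lnal: "((\<lambda>\<sigma>. - ln (al \<sigma>) / ln \<sigma>) \<longlongrightarrow> 1) at_top"
    using \<theta> by real_asymp
  have "((\<lambda>\<sigma>. (m \<sigma> * (- ln (y \<sigma>)) + m \<sigma> * ln (S \<sigma>)) / (- ln (al \<sigma>) / ln \<sigma>) / \<theta>) \<longlongrightarrow> (\<theta> + 0) / 1 / \<theta>) at_top"
    using \<theta> by (intro tendsto_divide tendsto_add mlny mlnS lnal tendsto_const) auto
  then have lim: "((\<lambda>\<sigma>. (m \<sigma> * (- ln (y \<sigma>)) + m \<sigma> * ln (S \<sigma>)) / (- ln (al \<sigma>) / ln \<sigma>) / \<theta>) \<longlongrightarrow> 1) at_top"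
    using \<theta> by simp
  have al1: "\<forall>\<^sub>F \<sigma> in at_top. al \<sigma> < 1"
    using order_tendstoD(2)[OF al_tendsto_0] by simp
  have "\<forall>\<^sub>F \<sigma> in at_top. (m \<sigma> * (- ln (y \<sigma>)) + m \<sigma> * ln (S \<sigma>)) / (- ln (al \<sigma>) / ln \<sigma>) / \<theta> = m \<sigma> / (\<theta> / ln \<sigma>)"
    using eventually_gt_at_top[of 1] al1
  proof eventually_elim
    case (elim \<sigma>)
    then have s: "0 < \<sigma>" by simp
    have a: "0 < al \<sigma>" using scaled_parameters[OF s] by simp
    have "0 < S \<sigma>" using y_pos[OF s] a by (rule zero_less_mult_pos)
    then have "ln (y \<sigma>) = ln (al \<sigma>) + ln (S \<sigma>)" using a by (intro ln_mult_pos)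
    moreover have "ln (al \<sigma>) < 0" using a elim by (intro ln_less_zero)
    moreover have "(p * (- (q + w)) + p * w) / (- q / v) / \<theta> = p / (\<theta> / v)" if "q < 0" for p q v w
    proof -
      have "p * (- (q + w)) + p * w = p * (- q)" by (simp add: algebra_simps)
      then show ?thesis using that by simp
    qed
    ultimately show ?case by simp
  qed
  from Lim_transform_eventually[OF lim this] show ?thesis by (rule asymp_equivI')
qed

text \<open>For \<delta> = 0 the bound (B) equals the limit for every \<sigma>, so only values below
  the limit require work.\<close>

lemma mode_asymp_vg:
  assumes d: "\<delta> = 0"
  shows "(m \<longlongrightarrow> 2 * \<theta> * (l - 1)) (at_right 0)"
proof (rule order_tendstoI)
  have l: "1 < l" using nd d by simp
  fix x
  show "\<forall>\<^sub>F \<sigma> in at_right 0. m \<sigma> < x" if "2 * \<theta> * (l - 1) < x"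
    using eventually_at_right_less[of 0]
  proof eventually_elim
    case (elim \<sigma>)
    have "m \<sigma> < gh_bound 1 l (al \<sigma>) (be \<sigma>) \<delta>"
      using gh_mode_parameters.bound_B(1)[OF mode_parameters[OF elim]] l unfolding gh_mode_scaled_def by simp
    also have "\<dots> = 2 * \<theta> * (l - 1)"
      unfolding bound_scaled[OF elim] using l d by simp
    finally show ?case using that by simp
  qed
  show "\<forall>\<^sub>F \<sigma> in at_right 0. x < m \<sigma>" if x: "x < 2 * \<theta> * (l - 1)"
  proof (cases "0 < x")
    case False
    show ?thesis
      by (rule eventually_mono[OF eventually_at_right_less]) (use False m_pos in force)
  next
    case True
    \<comment> \<open>K divided by \<open>\<sigma>\<^sup>2\<close> is the right-hand side in the
      criterion \<open>less_mode_vg\<close>; it outgrows 2 \<nu> as \<sigma> decreases to 0.\<close>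
    define K where "K = x * (2 * \<theta> * (l - 1) - x)"
    have K: "0 < K" using True x unfolding K_def by simp
    have "((\<lambda>\<sigma>. 2 * \<nu> * \<sigma>\<^sup>2) \<longlongrightarrow> 2 * \<nu> * 0\<^sup>2) (at_right 0)" by (intro tendsto_intros)
    then have "\<forall>\<^sub>F \<sigma> in at_right 0. 2 * \<nu> * \<sigma>\<^sup>2 < K"
      using K by (intro order_tendstoD) auto
    then show ?thesis
      using eventually_at_right_less[of 0]
    proof eventually_elim
      case (elim \<sigma>)
      interpret P: gh_mode_parameters \<nu> "al \<sigma>" "be \<sigma>" \<delta> by (rule mode_parameters[OF elim(2)])
      have "2 * \<nu> \<le> K / \<sigma>\<^sup>2" using elim by (simp add: pos_le_divide_eq)
      also have "K / \<sigma>\<^sup>2 = 2 * (\<nu> - 1/2) * be \<sigma> * x - (gh_gamma (al \<sigma>) (be \<sigma>))\<^sup>2 * x\<^sup>2"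
        unfolding gamma_scaled[OF elim(2)] K_def using elim(2) by (simp add: field_simps power2_eq_square)
      finally show ?case
        using P.less_mode_vg[OF d True] unfolding gh_mode_scaled_def by simp
    qed
  qed
qed

end

section \<open>Assembly of the bounds and optimality of the constants\<close>

lemma gh_mode_vg_eq_0:
  assumes "0 < \<beta>" "\<beta> < \<alpha>" "0 < l" "l \<le> 1"
  shows "gh_mode l \<alpha> \<beta> 0 = 0"
proof -
  interpret gh_parameters "l - 1/2" \<alpha> \<beta> 0 using assms by unfold_locales auto
  show ?thesis using gh_mode_eq_0 assms by simp
qed

lemma gh_mode_bounds:
  assumes adm: "gh_admissible l \<alpha> \<beta> \<delta>" and \<beta>: "0 < \<beta>" and M: "M = gh_mode l \<alpha> \<beta> \<delta>"
  shows "(0 < \<delta> \<longrightarrow> gh_bound (3/2) l \<alpha> \<beta> \<delta> < M \<and> M < gh_bound (1/2) l \<alpha> \<beta> \<delta>) \<and>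
      (\<delta> = 0 \<and> 3/2 < l \<longrightarrow> gh_bound (3/2) l \<alpha> \<beta> \<delta> < M) \<and>
      (\<delta> = 0 \<and> 1/2 < l \<longrightarrow> M < gh_bound (1/2) l \<alpha> \<beta> \<delta>) \<and>
      (0 < \<delta> \<and> 1 < l \<longrightarrow> M < gh_bound 1 l \<alpha> \<beta> \<delta>) \<and>
      (0 < \<delta> \<and> l = 1 \<longrightarrow> M = gh_bound 1 l \<alpha> \<beta> \<delta>) \<and>
      (0 < \<delta> \<and> l < 1 \<longrightarrow> M > gh_bound 1 l \<alpha> \<beta> \<delta>) \<and>
      (\<delta> = 0 \<and> 1 < l \<longrightarrow> M < gh_bound 1 l \<alpha> \<beta> \<delta>) \<and>
      (\<delta> = 0 \<and> l = 1 \<longrightarrow> M = gh_bound 1 l \<alpha> \<beta> \<delta> \<and> M = 0) \<and>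
      (0 < \<delta> \<and> 2 < l \<longrightarrow> M > gh_bound_C l \<alpha> \<beta> \<delta>) \<and>
      (0 < \<delta> \<and> l = 2 \<longrightarrow> M = gh_bound_C l \<alpha> \<beta> \<delta>) \<and>
      (0 < \<delta> \<and> l < 2 \<longrightarrow> M < gh_bound_C l \<alpha> \<beta> \<delta>) \<and>
      (\<delta> = 0 \<and> 2 < l \<longrightarrow> M > gh_bound_C l \<alpha> \<beta> \<delta>) \<and>
      (\<delta> = 0 \<and> l = 2 \<longrightarrow> M = gh_bound_C l \<alpha> \<beta> \<delta>) \<and>
      (\<delta> = 0 \<and> 1 < l \<and> l < 2 \<longrightarrow> M < gh_bound_C l \<alpha> \<beta> \<delta>)"
proof (cases "0 < \<delta> \<or> 1 < l")
  case True
  have ab: "\<beta> < \<alpha>" "0 \<le> \<delta>" using adm \<beta> by (auto simp: gh_admissible_def)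
  interpret P: gh_mode_parameters "l - 1/2" \<alpha> \<beta> \<delta> by (rule gh_mode_parametersI[OF \<beta> ab True])
  have l: "l - 1/2 + 1/2 = l" by simp
  have "gh_bound (3/2) l \<alpha> \<beta> \<delta> < M" "M < gh_bound (1/2) l \<alpha> \<beta> \<delta>"
    unfolding M using P.lower_bound_A P.upper_bound_A unfolding l .
  moreover have "1 < l \<Longrightarrow> M < gh_bound 1 l \<alpha> \<beta> \<delta>" "l = 1 \<Longrightarrow> M = gh_bound 1 l \<alpha> \<beta> \<delta>" "l < 1 \<Longrightarrow> gh_bound 1 l \<alpha> \<beta> \<delta> < M"
    unfolding M using P.bound_B unfolding l by simp_all
  moreover have "2 < l \<Longrightarrow> gh_bound_C l \<alpha> \<beta> \<delta> < M" "l = 2 \<Longrightarrow> M = gh_bound_C l \<alpha> \<beta> \<delta>" "l < 2 \<Longrightarrow> M < gh_bound_C l \<alpha> \<beta> \<delta>"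
    unfolding M using P.bound_C unfolding l by simp_all
  ultimately show ?thesis using True by auto
next
  \<comment> \<open>Only \<delta> = 0, l \<le> 1 is left. The mode is 0, so positivity of the upper
    bound in (A) and the vanishing of (B) at l = 1 suffice.\<close>
  case False
  then have d: "\<delta> = 0" "0 < l" "l \<le> 1" "\<beta> < \<alpha>" using adm \<beta> by (auto simp: gh_admissible_def)
  interpret P: gh_parameters 0 \<alpha> \<beta> 0 using \<beta> d by unfold_locales auto
  have M0: "M = 0" unfolding M d(1) using gh_mode_vg_eq_0[OF \<beta> d(4,2,3)] .
  have "0 < gh_bound (1/2) l \<alpha> \<beta> \<delta>" if "1/2 < l"
    unfolding gh_bound_def using that \<beta> P.gamma_sq(2) d by simp
  moreover have "gh_bound 1 1 \<alpha> \<beta> 0 = 0" by (simp add: gh_bound_def)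
  ultimately show ?thesis using d M0 by auto
qed

text \<open>Equality in (C) makes the mode explicit at l = 2, \<delta> = 0, \<alpha> = 1. Up to a
  common factor, 1 + \<beta> is compared with 4 - 2 a, so any \<beta> below 3 - 2 a refutes the
  bound.\<close>

lemma lower_bound_optimal:
  assumes a: "a < 3/2"
  shows "\<exists>l \<alpha> \<beta> \<delta>. 0 < \<beta> \<and> \<beta> < \<alpha> \<and> (0 < \<delta> \<or> \<delta> = 0 \<and> 3/2 < l) \<and> gh_mode l \<alpha> \<beta> \<delta> < gh_bound a l \<alpha> \<beta> \<delta>"
proof -
  define \<beta> :: real where "\<beta> = min (1/2) ((3 - 2 * a) / 2)"
  have b: "0 < \<beta>" "\<beta> < 1" "\<beta> < 3 - 2 * a" using a unfolding \<beta>_def by (auto simp: min_def)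
  interpret P: gh_mode_parameters "3/2" 1 \<beta> 0 using b by unfold_locales auto
  let ?g = "gh_gamma 1 \<beta>"
  have g: "?g\<^sup>2 = 1 - \<beta>\<^sup>2" "0 < ?g" using P.gamma_sq by simp_all
  have "gh_bound_C 2 1 \<beta> 0 = \<beta> / ?g\<^sup>2 * (1 + sqrt (1 - ?g\<^sup>2))"
    unfolding gh_bound_C_def by simp
  also have "sqrt (1 - ?g\<^sup>2) = \<beta>" unfolding g(1) using b by simp
  finally have "gh_mode 2 1 \<beta> 0 = \<beta> / ?g\<^sup>2 * (1 + \<beta>)"
    using P.bound_C(2) by simp
  also have "\<dots> < \<beta> / ?g\<^sup>2 * (4 - 2 * a)"
    using b g(2) by (intro mult_strict_left_mono) auto
  also have "\<dots> = gh_bound a 2 1 \<beta> 0" using a unfolding gh_bound_def by simp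
  finally show ?thesis using b by (intro exI[of _ 2] exI[of _ 1] exI[of _ \<beta>] exI[of _ 0]) auto
qed

text \<open>Take l = 0 and \<theta> = \<delta> = 1 with \<sigma> large: the mode behaves like 1 /
  \<sigma>^2, the bound like 1 / (2 a \<sigma>^2), and their ratio 1 / (2 a) is below 1.\<close>

lemma upper_bound_optimal:
  assumes a: "1/2 < a"
  shows "\<exists>l \<alpha> \<beta> \<delta>. 0 < \<beta> \<and> \<beta> < \<alpha> \<and> (0 < \<delta> \<or> \<delta> = 0 \<and> 1/2 < l) \<and> gh_bound a l \<alpha> \<beta> \<delta> < gh_mode l \<alpha> \<beta> \<delta>"
proof -
  interpret P: gh_scaling 1 0 1 by unfold_locales auto
  have asym: "gh_mode_scaled 0 1 1 \<sim>[at_top] (\<lambda>\<sigma>. 1 / \<sigma>\<^sup>2)"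
    using P.mode_asymp_small by simp
  have a0: "0 < a" using a by simp
  \<comment> \<open>Rationalizing the difference exposes its order 1 / \<sigma>^2, which
    cancellation hides.\<close>
  have eq: "- a + sqrt (a\<^sup>2 + 1 / \<sigma>\<^sup>2) = 1 / \<sigma>\<^sup>2 / (a + sqrt (a\<^sup>2 + 1 / \<sigma>\<^sup>2))" for \<sigma>
  proof -
    let ?q = "sqrt (a\<^sup>2 + 1 / \<sigma>\<^sup>2)"
    have "(- a + ?q) * (a + ?q) = ?q\<^sup>2 - a\<^sup>2" by (simp add: algebra_simps power2_eq_square)
    also have "\<dots> = 1 / \<sigma>\<^sup>2" by simp
    finally have prod: "(- a + ?q) * (a + ?q) = 1 / \<sigma>\<^sup>2" .
    have "0 \<le> ?q" by simp
    then have "a + ?q \<noteq> 0" using a0 by linarith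
    then show ?thesis using prod by (rule eq_divide_imp)
  qed
  have "((\<lambda>\<sigma>::real. 1 / \<sigma>\<^sup>2) \<longlongrightarrow> 0) at_top" by real_asymp
  then have "((\<lambda>\<sigma>. a + sqrt (a\<^sup>2 + 1 / \<sigma>\<^sup>2)) \<longlongrightarrow> a + sqrt (a\<^sup>2 + 0)) at_top"
    by (intro tendsto_intros)
  then have "(\<lambda>\<sigma>. a + sqrt (a\<^sup>2 + 1 / \<sigma>\<^sup>2)) \<sim>[at_top] (\<lambda>_. 2 * a)"
    using a0 by (intro tendsto_imp_asymp_equiv_const) auto
  from asymp_equiv_divide[OF asymp_equiv_refl this]
  have "(\<lambda>\<sigma>. - a + sqrt (a\<^sup>2 + 1 / \<sigma>\<^sup>2)) \<sim>[at_top] (\<lambda>\<sigma>. 1 / \<sigma>\<^sup>2 / (2 * a))"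
    unfolding eq .
  then have "((\<lambda>\<sigma>. (- a + sqrt (a\<^sup>2 + 1 / \<sigma>\<^sup>2)) / gh_mode_scaled 0 1 1 \<sigma>) \<sim>[at_top] (\<lambda>\<sigma>. 1 / \<sigma>\<^sup>2 / (2 * a) / (1 / \<sigma>\<^sup>2)))"
    by (rule asymp_equiv_divide[OF _ asym])
  moreover have "((\<lambda>\<sigma>::real. 1 / \<sigma>\<^sup>2 / (2 * a) / (1 / \<sigma>\<^sup>2)) \<longlongrightarrow> 1 / (2 * a)) at_top"
    by (rule Lim_transform_eventually[OF tendsto_const], rule eventually_mono[OF eventually_gt_at_top[of 0]]) simp
  ultimately have "((\<lambda>\<sigma>. (- a + sqrt (a\<^sup>2 + 1 / \<sigma>\<^sup>2)) / gh_mode_scaled 0 1 1 \<sigma>) \<longlongrightarrow> 1 / (2 * a)) at_top"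
    by (rule asymp_equiv_tendsto_transfer[OF asymp_equiv_symI])
  then have "\<forall>\<^sub>F \<sigma> in at_top. (- a + sqrt (a\<^sup>2 + 1 / \<sigma>\<^sup>2)) / gh_mode_scaled 0 1 1 \<sigma> < 1"
    using a by (intro order_tendstoD) auto
  then have "\<forall>\<^sub>F \<sigma> in at_top. 0 < \<sigma> \<and> (- a + sqrt (a\<^sup>2 + 1 / \<sigma>\<^sup>2)) / gh_mode_scaled 0 1 1 \<sigma> < 1"
    using eventually_gt_at_top[of 0] by eventually_elim simp
  then obtain \<sigma> :: real where s: "0 < \<sigma>" "(- a + sqrt (a\<^sup>2 + 1 / \<sigma>\<^sup>2)) / gh_mode_scaled 0 1 1 \<sigma> < 1"
    using eventually_happens'[OF trivial_limit_at_top_linorder] by blast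
  then have "gh_bound a 0 (P.al \<sigma>) (P.be \<sigma>) 1 < gh_mode_scaled 0 1 1 \<sigma>"
    unfolding P.bound_scaled[OF s(1)] using P.m_pos[OF s(1)] by (simp add: pos_divide_less_eq)
  then have "gh_bound a 0 (P.al \<sigma>) (P.be \<sigma>) 1 < gh_mode 0 (P.al \<sigma>) (P.be \<sigma>) 1"
    unfolding gh_mode_scaled_def .
  then show ?thesis using P.scaled_parameters[OF s(1)] zero_less_one by blast
qed

text \<open>With l = a and \<delta> = 0 the proposed bound is 0, while the mode is positive because
  l > 1.\<close>

lemma upper_bound_B_optimal:
  assumes a: "1 < a"
  shows "\<exists>l \<alpha> \<beta> \<delta>. 0 < \<beta> \<and> \<beta> < \<alpha> \<and> 0 \<le> \<delta> \<and> 1 < l \<and> gh_bound a l \<alpha> \<beta> \<delta> < gh_mode l \<alpha> \<beta> \<delta>"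
proof -
  interpret P: gh_mode_parameters "a - 1/2" 2 1 0 using a by unfold_locales auto
  have "gh_bound a a 2 1 0 < gh_mode a 2 1 0"
    using P.M_pos by (simp add: gh_bound_def)
  then show ?thesis using a by (intro exI[of _ a] exI[of _ 2] exI[of _ 1] exI[of _ 0]) auto
qed

lemma gh_mode_asymptotics:
  assumes \<theta>: "0 < \<theta>"
  shows "(3/2 < l \<and> 0 \<le> \<delta> \<longrightarrow>
         gh_mode_scaled l \<theta> \<delta> \<sim>[at_top] (\<lambda>\<sigma>. \<theta> * (2 * l - 3))) \<and>
      (l = 3/2 \<and> 0 \<le> \<delta> \<longrightarrow>
         gh_mode_scaled l \<theta> \<delta> \<sim>[at_top] (\<lambda>\<sigma>. \<theta> / ln \<sigma>)) \<and>
      (1/2 < l \<and> l < 3/2 \<and> 0 < \<delta> \<longrightarrow>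
         gh_mode_scaled l \<theta> \<delta> \<sim>[at_top]
           (\<lambda>\<sigma>. 2 powr (2 * l - 2) * Gamma (l - 1/2) / Gamma (3/2 - l)
                  * (\<theta> * \<delta> powr (3 - 2 * l) / \<sigma> powr (3 - 2 * l)))) \<and>
      (l < 1/2 \<and> 0 < \<delta> \<longrightarrow>
         gh_mode_scaled l \<theta> \<delta> \<sim>[at_top] (\<lambda>\<sigma>. \<theta> * \<delta>\<^sup>2 / ((1 - 2 * l) * \<sigma>\<^sup>2)))"
proof (intro conjI impI)
  have P: "gh_scaling \<theta> l \<delta>" if "0 \<le> \<delta>" "0 < \<delta> \<or> 1 < l"
    using that \<theta> by unfold_locales
  show "gh_mode_scaled l \<theta> \<delta> \<sim>[at_top] (\<lambda>\<sigma>. \<theta> * (2 * l - 3))" if "3/2 < l \<and> 0 \<le> \<delta>"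
    using that \<theta> by (intro tendsto_imp_asymp_equiv_const gh_scaling.mode_asymp_large P) auto
  show "gh_mode_scaled l \<theta> \<delta> \<sim>[at_top] (\<lambda>\<sigma>. \<theta> / ln \<sigma>)" if "l = 3/2 \<and> 0 \<le> \<delta>"
    using that by (intro gh_scaling.mode_asymp_critical P) auto
  show "gh_mode_scaled l \<theta> \<delta> \<sim>[at_top]
           (\<lambda>\<sigma>. 2 powr (2 * l - 2) * Gamma (l - 1/2) / Gamma (3/2 - l)
                  * (\<theta> * \<delta> powr (3 - 2 * l) / \<sigma> powr (3 - 2 * l)))" if "1/2 < l \<and> l < 3/2 \<and> 0 < \<delta>"
    using that by (intro gh_scaling.mode_asymp_middle P) auto
  show "gh_mode_scaled l \<theta> \<delta> \<sim>[at_top] (\<lambda>\<sigma>. \<theta> * \<delta>\<^sup>2 / ((1 - 2 * l) * \<sigma>\<^sup>2))" if "l < 1/2 \<and> 0 < \<delta>"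
    using that by (intro gh_scaling.mode_asymp_small P) auto
qed

lemma gh_mode_asymptotics_vg:
  assumes "0 < \<theta>" "1 < l"
  shows "gh_mode_scaled l \<theta> 0 \<sim>[at_right 0] (\<lambda>\<sigma>. 2 * \<theta> * (l - 1))"
proof -
  interpret gh_scaling \<theta> l 0 using assms by unfold_locales auto
  show ?thesis using mode_asymp_vg assms by (intro tendsto_imp_asymp_equiv_const) auto
qed

theorem theorem2p1:
  "(\<forall>l \<alpha> \<beta> \<delta> M. gh_admissible l \<alpha> \<beta> \<delta> \<and> 0 < \<beta> \<and> M = gh_mode l \<alpha> \<beta> \<delta> \<longrightarrow>
      (0 < \<delta> \<longrightarrow> gh_bound (3/2) l \<alpha> \<beta> \<delta> < M \<and> M < gh_bound (1/2) l \<alpha> \<beta> \<delta>) \<and>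
      (\<delta> = 0 \<and> 3/2 < l \<longrightarrow> gh_bound (3/2) l \<alpha> \<beta> \<delta> < M) \<and>
      (\<delta> = 0 \<and> 1/2 < l \<longrightarrow> M < gh_bound (1/2) l \<alpha> \<beta> \<delta>) \<and>
      (0 < \<delta> \<and> 1 < l \<longrightarrow> M < gh_bound 1 l \<alpha> \<beta> \<delta>) \<and>
      (0 < \<delta> \<and> l = 1 \<longrightarrow> M = gh_bound 1 l \<alpha> \<beta> \<delta>) \<and>
      (0 < \<delta> \<and> l < 1 \<longrightarrow> M > gh_bound 1 l \<alpha> \<beta> \<delta>) \<and>
      (\<delta> = 0 \<and> 1 < l \<longrightarrow> M < gh_bound 1 l \<alpha> \<beta> \<delta>) \<and>
      (\<delta> = 0 \<and> l = 1 \<longrightarrow> M = gh_bound 1 l \<alpha> \<beta> \<delta> \<and> M = 0) \<and>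
      (0 < \<delta> \<and> 2 < l \<longrightarrow> M > gh_bound_C l \<alpha> \<beta> \<delta>) \<and>
      (0 < \<delta> \<and> l = 2 \<longrightarrow> M = gh_bound_C l \<alpha> \<beta> \<delta>) \<and>
      (0 < \<delta> \<and> l < 2 \<longrightarrow> M < gh_bound_C l \<alpha> \<beta> \<delta>) \<and>
      (\<delta> = 0 \<and> 2 < l \<longrightarrow> M > gh_bound_C l \<alpha> \<beta> \<delta>) \<and>
      (\<delta> = 0 \<and> l = 2 \<longrightarrow> M = gh_bound_C l \<alpha> \<beta> \<delta>) \<and>
      (\<delta> = 0 \<and> 1 < l \<and> l < 2 \<longrightarrow> M < gh_bound_C l \<alpha> \<beta> \<delta>))
   \<and>
   (\<forall>a\<in>{3/2, 1/2}. \<forall>\<alpha> \<beta>. 0 < \<beta> \<and> \<beta> < \<alpha> \<longrightarrow>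
      (\<forall>\<delta>\<ge>0. ((\<lambda>l. gh_mode l \<alpha> \<beta> \<delta> / gh_bound a l \<alpha> \<beta> \<delta>) \<longlongrightarrow> 1) at_top) \<and>
      (\<forall>l. ((\<lambda>\<delta>. gh_mode l \<alpha> \<beta> \<delta> / gh_bound a l \<alpha> \<beta> \<delta>) \<longlongrightarrow> 1) at_top))
   \<and>
   (\<forall>\<theta> l \<delta>. 0 < \<theta> \<longrightarrow>
      (3/2 < l \<and> 0 \<le> \<delta> \<longrightarrow>
         gh_mode_scaled l \<theta> \<delta> \<sim>[at_top] (\<lambda>\<sigma>. \<theta> * (2 * l - 3))) \<and>
      (l = 3/2 \<and> 0 \<le> \<delta> \<longrightarrow>
         gh_mode_scaled l \<theta> \<delta> \<sim>[at_top] (\<lambda>\<sigma>. \<theta> / ln \<sigma>)) \<and>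
      (1/2 < l \<and> l < 3/2 \<and> 0 < \<delta> \<longrightarrow>
         gh_mode_scaled l \<theta> \<delta> \<sim>[at_top]
           (\<lambda>\<sigma>. 2 powr (2 * l - 2) * Gamma (l - 1/2) / Gamma (3/2 - l)
                  * (\<theta> * \<delta> powr (3 - 2 * l) / \<sigma> powr (3 - 2 * l)))) \<and>
      (l < 1/2 \<and> 0 < \<delta> \<longrightarrow>
         gh_mode_scaled l \<theta> \<delta> \<sim>[at_top] (\<lambda>\<sigma>. \<theta> * \<delta>\<^sup>2 / ((1 - 2 * l) * \<sigma>\<^sup>2))))
   \<and>
   (\<forall>l \<alpha> \<beta>. 0 < \<beta> \<and> \<beta> < \<alpha> \<and> 0 < l \<and> l \<le> 1 \<longrightarrow> gh_mode l \<alpha> \<beta> 0 = 0)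
   \<and>
   (\<forall>\<theta> l. 0 < \<theta> \<and> 1 < l \<longrightarrow>
      gh_mode_scaled l \<theta> 0 \<sim>[at_right 0] (\<lambda>\<sigma>. 2 * \<theta> * (l - 1)))
   \<and>
   (\<forall>a<3/2. \<not> (\<forall>l \<alpha> \<beta> \<delta>. 0 < \<beta> \<and> \<beta> < \<alpha> \<and> (0 < \<delta> \<or> \<delta> = 0 \<and> 3/2 < l) \<longrightarrow>
      gh_bound a l \<alpha> \<beta> \<delta> \<le> gh_mode l \<alpha> \<beta> \<delta>))
   \<and>
   (\<forall>a>1/2. \<not> (\<forall>l \<alpha> \<beta> \<delta>. 0 < \<beta> \<and> \<beta> < \<alpha> \<and> (0 < \<delta> \<or> \<delta> = 0 \<and> 1/2 < l) \<longrightarrow>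
      gh_mode l \<alpha> \<beta> \<delta> \<le> gh_bound a l \<alpha> \<beta> \<delta>))
   \<and>
   (\<forall>a>1. \<not> (\<forall>l \<alpha> \<beta> \<delta>. 0 < \<beta> \<and> \<beta> < \<alpha> \<and> 0 \<le> \<delta> \<and> 1 < l \<longrightarrow>
      gh_mode l \<alpha> \<beta> \<delta> \<le> gh_bound a l \<alpha> \<beta> \<delta>))"
  apply (intro conjI)
  subgoal by (intro allI impI, elim conjE) (rule gh_mode_bounds)
  subgoal by (intro ballI allI impI conjI; elim conjE; intro gh_mode_ratio_order gh_mode_ratio_scale; assumption)
  subgoal by (intro allI impI) (rule gh_mode_asymptotics)
  subgoal using gh_mode_vg_eq_0 by blast
  subgoal using gh_mode_asymptotics_vg by blast
  subgoal using lower_bound_optimal by (meson not_le)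
  subgoal using upper_bound_optimal by (meson not_le)
  subgoal using upper_bound_B_optimal by (meson not_le)
  done

end
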